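(* $\mathrm{Th}(\mathcal{M}_1)=\mathrm{Jan}$.
   Context: $\Phi_e$ is the Turing functional with index $e$. For $\mathcal{A},\mathcal{B}\subseteq\omega^\omega$, $\mathcal{A}\leq_1\mathcal{B}$ means: there are a uniformly $\Pi^0_1$ (effective, with a computable sequence of indices) sequence $\mathcal{V}_0,\mathcal{V}_1,\dots$ of subsets of $\omega^\omega$ with $\mathcal{B}\subseteq\bigcup_i\mathcal{V}_i$ and a computable sequence $e_0,e_1,\dots$ such that for every $i$ and every $f\in\mathcal{B}\cap\mathcal{V}_i$ the function $\Phi_{e_i}(f)$ is total and in $\mathcal{A}$. $\mathcal{M}_1$ is the set of $\equiv_1$-equivalence classes of subsets of $\omega^\omega$, ordered by $\leq_1$. It is a Brouwer algebra: a bounded distributive lattice with join $\oplus$, meet $\otimes$, and implication $\to$ with $a\oplus c\geq b$ iff $c\geq a\to b$. The theory $\mathrm{Th}(\mathscr{B})$ of a Brouwer algebra $\mathscr{B}$ is the set of propositional formulas that evaluate to $0$ under every valuation of the variables in $\mathscr{B}$, where $\wedge$ is interpreted as $\oplus$, $\vee$ as $\otimes$, implication as $\to$, and negation $\neg x$ as $x\to1$ ($1$ the top element). $\mathrm{Jan}$ is Jankov's logic: the deductive closure of intuitionistic propositional logic together with the weak law of the excluded middle $\neg p\vee\neg\neg p$ (as an axiom scheme). *)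

theory Defs
  imports Complex_Main "HOL-Library.Nat_Bijection" "HOL-Algebra.Lattice"
begin

section \<open>Turing functionals\<close>

text \<open>Programs for partial functions on the natural numbers that may query an oracle. Tuples of
  arguments are handled by the Cantor pairing \<^const>\<open>prod_encode\<close>, so every program is unary.
  \<open>Prec\<close> is primitive recursion (in the second component of the argument) and \<open>Mu\<close> is unbounded
  search.\<close>

datatype prog =
    Zero | Succ | Fst | Snd | Oracle
  | Tup prog prog | Comp prog prog | Prec prog prog | Mu prog

primrec run :: "prog \<Rightarrow> (nat \<Rightarrow> nat) \<Rightarrow> nat \<Rightarrow> nat option" where
  "run Zero f = (\<lambda>n. Some 0)"
| "run Succ f = (\<lambda>n. Some (Suc n))"
| "run Fst f = (\<lambda>n. Some (fst (prod_decode n)))"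
| "run Snd f = (\<lambda>n. Some (snd (prod_decode n)))"
| "run Oracle f = (\<lambda>n. Some (f n))"
| "run (Tup p q) f = (\<lambda>n. Option.bind (run p f n) (\<lambda>a.
     Option.bind (run q f n) (\<lambda>b. Some (prod_encode (a, b)))))"
| "run (Comp p q) f = (\<lambda>n. Option.bind (run q f n) (run p f))"
| "run (Prec p q) f = (\<lambda>n. rec_nat
     (run p f (fst (prod_decode n)))
     (\<lambda>j r. Option.bind r (\<lambda>m. run q f (prod_encode (fst (prod_decode n), prod_encode (j, m)))))
     (snd (prod_decode n)))"
| "run (Mu p) f = (\<lambda>n.
     if \<exists>k. run p f (prod_encode (n, k)) = Some 0 \<and>
            (\<forall>j<k. \<exists>m. run p f (prod_encode (n, j)) = Some (Suc m))
     then Some (LEAST k. run p f (prod_encode (n, k)) = Some 0)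
     else None)"

text \<open>The numbering of programs underlying the indices. It is a bijection between natural numbers
  and programs, and it is effective, hence an acceptable numbering.\<close>

function prog_of_nat :: "nat \<Rightarrow> prog" where
  "prog_of_nat e =
     (if e < 5 then [Zero, Succ, Fst, Snd, Oracle] ! e
      else let c = (e - 5) div 4; a = fst (prod_decode c); b = snd (prod_decode c) in
        if (e - 5) mod 4 = 0 then Tup (prog_of_nat a) (prog_of_nat b)
        else if (e - 5) mod 4 = 1 then Comp (prog_of_nat a) (prog_of_nat b)
        else if (e - 5) mod 4 = 2 then Prec (prog_of_nat a) (prog_of_nat b)
        else Mu (prog_of_nat c))"
  by pat_completeness auto

lemma fst_prod_decode_le: "fst (prod_decode c) \<le> c"
  by (metis le_prod_encode_1 prod.collapse prod_decode_inverse)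

lemma snd_prod_decode_le: "snd (prod_decode c) \<le> c"
  by (metis le_prod_encode_2 prod.collapse prod_decode_inverse)

termination prog_of_nat
proof (relation "measure (\<lambda>e. e)", goal_cases)
  case 1 show ?case by simp
qed (auto intro!: le_less_trans[OF fst_prod_decode_le] le_less_trans[OF snd_prod_decode_le])

declare prog_of_nat.simps [simp del]

primrec nat_of_prog :: "prog \<Rightarrow> nat" where
  "nat_of_prog Zero = 0"
| "nat_of_prog Succ = 1"
| "nat_of_prog Fst = 2"
| "nat_of_prog Snd = 3"
| "nat_of_prog Oracle = 4"
| "nat_of_prog (Tup p q) = 5 + 4 * prod_encode (nat_of_prog p, nat_of_prog q)"
| "nat_of_prog (Comp p q) = 6 + 4 * prod_encode (nat_of_prog p, nat_of_prog q)"
| "nat_of_prog (Prec p q) = 7 + 4 * prod_encode (nat_of_prog p, nat_of_prog q)"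
| "nat_of_prog (Mu p) = 8 + 4 * nat_of_prog p"

lemma prog_of_nat_base [simp]:
  "prog_of_nat 0 = Zero" "prog_of_nat (Suc 0) = Succ" "prog_of_nat 2 = Fst"
  "prog_of_nat 3 = Snd" "prog_of_nat 4 = Oracle"
  by (subst prog_of_nat.simps, simp)+

lemma prog_of_nat_step [simp]:
  "prog_of_nat (5 + 4 * c) =
     Tup (prog_of_nat (fst (prod_decode c))) (prog_of_nat (snd (prod_decode c)))"
  "prog_of_nat (6 + 4 * c) =
     Comp (prog_of_nat (fst (prod_decode c))) (prog_of_nat (snd (prod_decode c)))"
  "prog_of_nat (7 + 4 * c) =
     Prec (prog_of_nat (fst (prod_decode c))) (prog_of_nat (snd (prod_decode c)))"
  "prog_of_nat (8 + 4 * c) = Mu (prog_of_nat c)"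
proof -
  have eqs: "5 + 4 * c - 5 = 4 * c" "6 + 4 * c - 5 = 1 + 4 * c"
       "7 + 4 * c - 5 = 2 + 4 * c" "8 + 4 * c - 5 = 3 + 4 * c"
       "\<not> 5 + 4 * c < 5" "\<not> 6 + 4 * c < 5" "\<not> 7 + 4 * c < 5" "\<not> 8 + 4 * c < 5"
       "4 * c div 4 = c" "(1 + 4 * c) div 4 = c" "(2 + 4 * c) div 4 = c" "(3 + 4 * c) div 4 = c"
       "4 * c mod 4 = 0" "(1 + 4 * c) mod 4 = 1" "(2 + 4 * c) mod 4 = 2" "(3 + 4 * c) mod 4 = 3"
    by (simp_all add: mod_Suc)
  have neqs: "(1::nat) \<noteq> 0" "(2::nat) \<noteq> 0" "(3::nat) \<noteq> 0" "(2::nat) \<noteq> 1" "(3::nat) \<noteq> 1" "(3::nat) \<noteq> 2"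
    by simp_all
  note if_simps = Let_def eqs neqs if_True if_False refl
  show
    "prog_of_nat (5 + 4 * c) =
       Tup (prog_of_nat (fst (prod_decode c))) (prog_of_nat (snd (prod_decode c)))"
    "prog_of_nat (6 + 4 * c) =
       Comp (prog_of_nat (fst (prod_decode c))) (prog_of_nat (snd (prod_decode c)))"
    "prog_of_nat (7 + 4 * c) =
       Prec (prog_of_nat (fst (prod_decode c))) (prog_of_nat (snd (prod_decode c)))"
    "prog_of_nat (8 + 4 * c) = Mu (prog_of_nat c)"
    by (subst prog_of_nat.simps, simp only: if_simps)+
qed

lemma prog_of_nat_of_prog [simp]: "prog_of_nat (nat_of_prog p) = p"
  by (induction p) simp_all

lemma nat_of_prog_of_nat [simp]: "nat_of_prog (prog_of_nat e) = e"
proof (induction e rule: less_induct)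
  case (less e)
  define c where "c = (e - 5) div 4"
  have e: "e = (e - 5) mod 4 + 4 * c + 5" if "\<not> e < 5"
    using that div_mult_mod_eq[of "e - 5" 4] unfolding c_def by linarith
  have "(e - 5) mod 4 < 4" by simp
  with e consider "e < 5" | "e = 5 + 4 * c" | "e = 6 + 4 * c" | "e = 7 + 4 * c" | "e = 8 + 4 * c"
    by linarith
  then show ?case
  proof cases
    case 1
    then have "e = 0 \<or> e = Suc 0 \<or> e = 2 \<or> e = 3 \<or> e = 4" by linarith
    then show ?thesis by (elim disjE) (simp_all del: One_nat_def)
  qed (use less[of c] less[of "fst (prod_decode c)"] less[of "snd (prod_decode c)"]
    fst_prod_decode_le[of c] snd_prod_decode_le[of c] in \<open>simp_all\<close>)
qed

definition turing_functional :: "nat \<Rightarrow> (nat \<Rightarrow> nat) \<Rightarrow> nat \<Rightarrow> nat option"  (\<open>\<Phi>\<close>) where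
  "\<Phi> e = run (prog_of_nat e)"

text \<open>Absolute computability is computability from the constant zero oracle.\<close>

definition computable :: "(nat \<Rightarrow> nat) \<Rightarrow> bool" where
  "computable g \<longleftrightarrow> (\<exists>e. \<forall>n. \<Phi> e (\<lambda>_. 0) n = Some (g n))"

definition ce_set :: "nat \<Rightarrow> nat set" where
  "ce_set e = dom (\<Phi> e (\<lambda>_. 0))"

section \<open>The reducibility and its degrees\<close>

text \<open>The \<open>\<Pi>\<^sup>0\<^sub>1\<close> class with index \<open>e\<close>: the complement of the union of the basic open sets given by
  the (coded) finite strings in the \<open>e\<close>-th computably enumerable set.\<close>

definition Pi01_class :: "nat \<Rightarrow> (nat \<Rightarrow> nat) set" where
  "Pi01_class e = {f. \<forall>n. list_encode (map f [0..<n]) \<notin> ce_set e}"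

definition uniformly_Pi01 :: "(nat \<Rightarrow> (nat \<Rightarrow> nat) set) \<Rightarrow> bool" where
  "uniformly_Pi01 V \<longleftrightarrow> (\<exists>p. computable p \<and> (\<forall>i. V i = Pi01_class (p i)))"

definition le1 :: "(nat \<Rightarrow> nat) set \<Rightarrow> (nat \<Rightarrow> nat) set \<Rightarrow> bool"  (infix \<open>\<le>\<^sub>1\<close> 50) where
  "A \<le>\<^sub>1 B \<longleftrightarrow>
     (\<exists>V e. uniformly_Pi01 V \<and> B \<subseteq> (\<Union>i. V i) \<and> computable e \<and>
        (\<forall>i. \<forall>f \<in> B \<inter> V i. \<exists>g \<in> A. \<forall>n. \<Phi> (e i) f n = Some (g n)))"

definition equiv1 :: "((nat \<Rightarrow> nat) set \<times> (nat \<Rightarrow> nat) set) set" where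
  "equiv1 = {(A, B). A \<le>\<^sub>1 B \<and> B \<le>\<^sub>1 A}"

definition M1 :: "(nat \<Rightarrow> nat) set set gorder"  (\<open>\<M>\<^sub>1\<close>) where
  "\<M>\<^sub>1 = \<lparr>carrier = UNIV // equiv1, eq = (=), le = (\<lambda>a b. \<exists>A\<in>a. \<exists>B\<in>b. A \<le>\<^sub>1 B)\<rparr>"

section \<open>Propositional formulas and the theory of a Brouwer algebra\<close>

datatype form =
    Var nat | Conj form form | Disj form form | Impl form form | Neg form

text \<open>All operations of a Brouwer algebra are determined by its order: join, meet, bottom and top are
  those of the lattice, and \<open>a \<rightarrow> b\<close> is the element with \<open>b \<sqsubseteq> a \<squnion> c\<close> iff \<open>(a \<rightarrow> b) \<sqsubseteq> c\<close> for
  all \<open>c\<close>.\<close>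

definition brouwer_imp :: "('a, 'b) gorder_scheme \<Rightarrow> 'a \<Rightarrow> 'a \<Rightarrow> 'a" where
  "brouwer_imp L a b =
     (THE d. d \<in> carrier L \<and> (\<forall>c \<in> carrier L. b \<sqsubseteq>\<^bsub>L\<^esub> a \<squnion>\<^bsub>L\<^esub> c \<longleftrightarrow> d \<sqsubseteq>\<^bsub>L\<^esub> c))"

text \<open>The order is dual to the one used in Heyting semantics: conjunction is the join, disjunction
  the meet, and truth is the bottom element.\<close>

primrec interp :: "('a, 'b) gorder_scheme \<Rightarrow> (nat \<Rightarrow> 'a) \<Rightarrow> form \<Rightarrow> 'a" where
  "interp L v (Var p) = v p"
| "interp L v (Conj \<phi> \<psi>) = interp L v \<phi> \<squnion>\<^bsub>L\<^esub> interp L v \<psi>"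
| "interp L v (Disj \<phi> \<psi>) = interp L v \<phi> \<sqinter>\<^bsub>L\<^esub> interp L v \<psi>"
| "interp L v (Impl \<phi> \<psi>) = brouwer_imp L (interp L v \<phi>) (interp L v \<psi>)"
| "interp L v (Neg \<phi>) = brouwer_imp L (interp L v \<phi>) \<top>\<^bsub>L\<^esub>"

definition Th :: "('a, 'b) gorder_scheme \<Rightarrow> form set" where
  "Th L = {\<phi>. \<forall>v. range v \<subseteq> carrier L \<longrightarrow> interp L v \<phi> = \<bottom>\<^bsub>L\<^esub>}"

section \<open>Jankov's logic\<close>

inductive_set IPC_closure :: "form set \<Rightarrow> form set" for \<Gamma> where
  hyp: "\<phi> \<in> \<Gamma> \<Longrightarrow> \<phi> \<in> IPC_closure \<Gamma>"
| K: "Impl \<phi> (Impl \<psi> \<phi>) \<in> IPC_closure \<Gamma>"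
| S: "Impl (Impl \<phi> (Impl \<psi> \<chi>)) (Impl (Impl \<phi> \<psi>) (Impl \<phi> \<chi>)) \<in> IPC_closure \<Gamma>"
| conjE1: "Impl (Conj \<phi> \<psi>) \<phi> \<in> IPC_closure \<Gamma>"
| conjE2: "Impl (Conj \<phi> \<psi>) \<psi> \<in> IPC_closure \<Gamma>"
| conjI: "Impl \<phi> (Impl \<psi> (Conj \<phi> \<psi>)) \<in> IPC_closure \<Gamma>"
| disjI1: "Impl \<phi> (Disj \<phi> \<psi>) \<in> IPC_closure \<Gamma>"
| disjI2: "Impl \<psi> (Disj \<phi> \<psi>) \<in> IPC_closure \<Gamma>"
| disjE: "Impl (Impl \<phi> \<chi>) (Impl (Impl \<psi> \<chi>) (Impl (Disj \<phi> \<psi>) \<chi>)) \<in> IPC_closure \<Gamma>"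
| negI: "Impl (Impl \<phi> \<psi>) (Impl (Impl \<phi> (Neg \<psi>)) (Neg \<phi>)) \<in> IPC_closure \<Gamma>"
| negE: "Impl (Neg \<phi>) (Impl \<phi> \<psi>) \<in> IPC_closure \<Gamma>"
| mp: "Impl \<phi> \<psi> \<in> IPC_closure \<Gamma> \<Longrightarrow> \<phi> \<in> IPC_closure \<Gamma> \<Longrightarrow> \<psi> \<in> IPC_closure \<Gamma>"

definition Jan :: "form set" where
  "Jan = IPC_closure {Disj (Neg \<phi>) (Neg (Neg \<phi>)) | \<phi>. True}"

end

theory Submission
  imports Defs "HOL-Library.Sublist"
begin

text \<open>Soundness is a computation in a Brouwer algebra; the weak excluded middle holds because
  \<open>A \<oplus> B\<close> is empty only if \<open>A\<close> or \<open>B\<close> is, so that \<open>\<not> a\<close> is always \<open>0\<close> or \<open>1\<close>.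

  Conversely, a formula outside \<open>Jan\<close> is refuted in a finite Kripke frame with a least and a greatest element,
  hence also in the powerset of a finite set ordered by inclusion. Let \<open>g x\<close> be pairwise Turing incomparable
  functions and let \<open>A c\<close> consist of the functions not computable from any \<open>g x\<close> with \<open>x \<in> c\<close>. Sending an
  up-closed \<open>U\<close> to the meet of the \<open>A c\<close> with \<open>c \<in> U\<close> turns forcing into evaluation in \<open>\<M>\<^sub>1\<close>. The critical case
  is the implication: \<open>A c\<close> is co-countable, so by Baire category a covering by countably many closed sets has a
  member containing all of \<open>A c\<close> within some basic open set. A non-uniform reduction thus becomes
  uniform there, and the basic open set is a finite amount of information that can be guessed.\<close>

section \<open>Uniformly computable functionals\<close>

text \<open>The obstacle is that a reduction from \<open>mass U\<close> joined with \<open>C\<close>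
  may choose its piece of the covering by looking at the whole of an \<open>x\<close> in
  \<open>avoid u\<close>, whereas a reduction from \<open>C\<close> sees only some \<open>h\<close>
  in \<open>C\<close> and cannot compute any such \<open>x\<close>. A guess consists of a string, a
  piece and an output tag. That all extensions of the string, joined with \<open>h\<close>, stay in
  that piece with that tag is an effectively closed condition on \<open>h\<close>, because for a
  closed piece it suffices to test the extensions of finite support. So the guesses index the new
  covering; the output is \<open>h\<close> itself with a tag read off from the guess, and no
  \<open>x\<close> is ever computed.

  Every function lies in \<open>avoid {}\<close>, and \<open>avoid (c \<union> d)\<close> is
  equivalent to the join of \<open>avoid c\<close> and \<open>avoid d\<close>: unions of sets become
  joins of degrees, which is why the frame has to be a powerset.

  The semantics \<open>run\<close> has no notion of stage, so bounded simulation is replaced by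
  checking finite derivations. Above that level everything is phrased with semidecidable relations,
  and indices return only where the definition of \<open>\<le>\<^sub>1\<close> demands them.\<close>

abbreviation pr :: "nat \<Rightarrow> nat \<Rightarrow> nat" where "pr a b \<equiv> prod_encode (a, b)"
definition pfst :: "nat \<Rightarrow> nat" where "pfst n = fst (prod_decode n)"
definition psnd :: "nat \<Rightarrow> nat" where "psnd n = snd (prod_decode n)"

lemma pr_simps [simp]: "pfst (pr a b) = a" "psnd (pr a b) = b" "pr (pfst n) (psnd n) = n"
  by (simp_all add: pfst_def psnd_def)

lemma psnd_le: "psnd n \<le> n"
  by (simp add: psnd_def snd_prod_decode_le)

text \<open>One program works for all oracles and halts everywhere. Bound variables are packed with
  the argument as \<open>pfst m\<close> and \<open>psnd m\<close>, so that the closure rules below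
  can be applied backwards by \<open>intro\<close>.\<close>

definition eff :: "((nat \<Rightarrow> nat) \<Rightarrow> nat \<Rightarrow> nat) \<Rightarrow> bool" where
  "eff F \<longleftrightarrow> (\<exists>p. \<forall>f n. run p f n = Some (F f n))"

text \<open>Truth is the value 0 because \<open>Mu\<close> searches for a zero.\<close>

definition dec :: "((nat \<Rightarrow> nat) \<Rightarrow> nat \<Rightarrow> bool) \<Rightarrow> bool" where
  "dec P \<longleftrightarrow> eff (\<lambda>f n. if P f n then 0 else 1)"

lemma effI: "(\<And>f n. run p f n = Some (F f n)) \<Longrightarrow> eff F"
  by (auto simp: eff_def)

lemma eff_unary:
  assumes "\<And>f n. run p f n = Some (h f n)" "eff A"
  shows "eff (\<lambda>f n. h f (A f n))"
proof -
  obtain a where "\<And>f n. run a f n = Some (A f n)" using assms(2) by (auto simp: eff_def)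
  then show ?thesis using assms(1) by (intro effI[of "Comp p a"]) simp
qed

lemma eff_comp: "eff F \<Longrightarrow> eff A \<Longrightarrow> eff (\<lambda>f n. F f (A f n))"
  by (metis eff_def eff_unary)

lemma eff_Suc: "eff A \<Longrightarrow> eff (\<lambda>f n. Suc (A f n))"
  by (rule eff_unary[of Succ "\<lambda>f. Suc"]) simp_all

lemma eff_pfst: "eff A \<Longrightarrow> eff (\<lambda>f n. pfst (A f n))"
  by (rule eff_unary[of Fst "\<lambda>f. pfst"]) (simp_all add: pfst_def)

lemma eff_psnd: "eff A \<Longrightarrow> eff (\<lambda>f n. psnd (A f n))"
  by (rule eff_unary[of Snd "\<lambda>f. psnd"]) (simp_all add: psnd_def)

lemma eff_oracle: "eff A \<Longrightarrow> eff (\<lambda>f n. f (A f n))"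
  by (rule eff_unary[of Oracle "\<lambda>f. f"]) simp_all

lemma eff_pr: "eff A \<Longrightarrow> eff B \<Longrightarrow> eff (\<lambda>f n. pr (A f n) (B f n))"
proof -
  assume "eff A" "eff B"
  then obtain a b where "\<And>f n. run a f n = Some (A f n)" "\<And>f n. run b f n = Some (B f n)"
    by (auto simp: eff_def)
  then show ?thesis by (intro effI[of "Tup a b"]) simp
qed

text \<open>The identity is not a primitive; recoding both components yields it because the pairing
  is surjective.\<close>

definition id_prog :: prog where "id_prog = Tup Fst Snd"

lemma run_id_prog [simp]: "run id_prog f n = Some n"
  by (simp add: id_prog_def)

lemma eff_id: "eff (\<lambda>f n. n)"
  by (rule effI[of id_prog]) simp

primrec const_prog :: "nat \<Rightarrow> prog" where
  "const_prog 0 = Zero"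
| "const_prog (Suc k) = Comp Succ (const_prog k)"

lemma run_const_prog [simp]: "run (const_prog k) f n = Some k"
  by (induction k) auto

lemma eff_const: "eff (\<lambda>f n. k)"
  by (rule effI[of "const_prog k"]) simp

lemma eff_rec:
  assumes "eff A" "eff (\<lambda>f m. B f (pfst m) (pfst (psnd m)) (psnd (psnd m)))" "eff C"
  shows "eff (\<lambda>f n. rec_nat (A f n) (\<lambda>j r. B f n j r) (C f n))"
proof -
  obtain a b c where abc: "\<And>f n. run a f n = Some (A f n)"
    "\<And>f m. run b f m = Some (B f (pfst m) (pfst (psnd m)) (psnd (psnd m)))"
    "\<And>f n. run c f n = Some (C f n)"
    using assms by (auto simp: eff_def)
  have "rec_nat (Some (A f n)) (\<lambda>j r. Option.bind r (\<lambda>m. run b f (pr n (pr j m)))) k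
     = Some (rec_nat (A f n) (\<lambda>j r. B f n j r) k)" for f n k
    by (induction k) (simp_all add: abc)
  then show ?thesis
    by (intro effI[of "Comp (Prec a b) (Tup id_prog c)"]) (simp add: abc)
qed

lemmas eff_basic = eff_id eff_const eff_Suc eff_pfst eff_psnd eff_oracle eff_pr

lemma eff_if0: "eff P \<Longrightarrow> eff A \<Longrightarrow> eff B \<Longrightarrow> eff (\<lambda>f n. if P f n = 0 then A f n else B f n)"
proof -
  assume "eff P" "eff A" "eff B"
  moreover from \<open>eff B\<close> have "eff (\<lambda>f m. B f (pfst m))"
    by (rule eff_comp) (intro eff_basic)
  ultimately have "eff (\<lambda>f n. rec_nat (A f n) (\<lambda>j r. B f n) (P f n))"
    by (intro eff_rec)
  moreover have "rec_nat (A f n) (\<lambda>j r. B f n) k = (if k = 0 then A f n else B f n)" for f n k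
    by (cases k) auto
  ultimately show ?thesis by simp
qed

lemma eff_if: "dec P \<Longrightarrow> eff A \<Longrightarrow> eff B \<Longrightarrow> eff (\<lambda>f n. if P f n then A f n else B f n)"
proof -
  assume "dec P" "eff A" "eff B"
  then have "eff (\<lambda>f n. if (if P f n then 0 else 1) = (0::nat) then A f n else B f n)"
    unfolding dec_def by (rule eff_if0)
  moreover have "(if (if P f n then 0 else 1) = (0::nat) then A f n else B f n) = (if P f n then A f n else B f n)" for f n
    by simp
  ultimately show ?thesis by simp
qed

lemma dec_eq0: "eff A \<Longrightarrow> dec (\<lambda>f n. A f n = 0)"
  unfolding dec_def by (intro eff_if0 eff_basic)

lemma dec_if: "dec P \<Longrightarrow> dec Q \<Longrightarrow> dec R \<Longrightarrow> dec (\<lambda>f n. if P f n then Q f n else R f n)"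
proof -
  assume a: "dec P" "dec Q" "dec R"
  have "(if (if P f n then Q f n else R f n) then 0 else 1::nat) =
    (if P f n then (if Q f n then 0 else 1) else (if R f n then 0 else 1))" for f n
    by simp
  with a show ?thesis unfolding dec_def[of "\<lambda>f n. if P f n then Q f n else R f n"]
    by (simp add: eff_if dec_def[symmetric])
qed

lemma dec_const: "dec (\<lambda>f n. b)"
  unfolding dec_def by (rule eff_const)

lemma dec_not: "dec P \<Longrightarrow> dec (\<lambda>f n. \<not> P f n)"
  using dec_if[of P "\<lambda>_ _. False" "\<lambda>_ _. True"] by (simp add: if_bool_eq_disj dec_const)

lemma dec_conj: "dec P \<Longrightarrow> dec Q \<Longrightarrow> dec (\<lambda>f n. P f n \<and> Q f n)"
  using dec_if[of P Q "\<lambda>_ _. False"] by (simp add: if_bool_eq_disj dec_const)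

lemma dec_disj: "dec P \<Longrightarrow> dec Q \<Longrightarrow> dec (\<lambda>f n. P f n \<or> Q f n)"
  using dec_not[OF dec_conj[OF dec_not dec_not, of P Q]] by simp

lemma dec_imp: "dec P \<Longrightarrow> dec Q \<Longrightarrow> dec (\<lambda>f n. P f n \<longrightarrow> Q f n)"
  using dec_disj[OF dec_not, of P Q] by simp

lemma eff_add: "eff A \<Longrightarrow> eff B \<Longrightarrow> eff (\<lambda>f n. A f n + B f n)"
proof -
  assume "eff A" "eff B"
  then have "eff (\<lambda>f n. rec_nat (A f n) (\<lambda>j r. Suc r) (B f n))"
    by (intro eff_rec eff_basic)
  moreover have "rec_nat a (\<lambda>j r. Suc r) b = a + b" for a b :: nat
    by (induction b) auto
  ultimately show ?thesis by simp
qed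

lemma eff_pred: "eff A \<Longrightarrow> eff (\<lambda>f n. A f n - 1)"
proof -
  assume "eff A"
  then have "eff (\<lambda>f n. rec_nat 0 (\<lambda>j r. j) (A f n))"
    by (intro eff_rec eff_basic)
  moreover have "rec_nat 0 (\<lambda>j r. j) b = b - 1" for b :: nat
    by (cases b) auto
  ultimately show ?thesis by simp
qed

lemma eff_diff: "eff A \<Longrightarrow> eff B \<Longrightarrow> eff (\<lambda>f n. A f n - B f n)"
proof -
  assume "eff A" "eff B"
  then have "eff (\<lambda>f n. rec_nat (A f n) (\<lambda>j r. r - 1) (B f n))"
    by (intro eff_rec eff_pred eff_basic)
  moreover have "rec_nat a (\<lambda>j r. r - 1) b = a - b" for a b :: nat
    by (induction b) auto
  ultimately show ?thesis by simp
qed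

lemma dec_le: "eff A \<Longrightarrow> eff B \<Longrightarrow> dec (\<lambda>f n. A f n \<le> B f n)"
  using dec_eq0[OF eff_diff, of A B] by simp

lemma dec_less: "eff A \<Longrightarrow> eff B \<Longrightarrow> dec (\<lambda>f n. A f n < B f n)"
  using dec_not[OF dec_le, of B A] by (simp add: not_le)

lemma dec_eq: "eff A \<Longrightarrow> eff B \<Longrightarrow> dec (\<lambda>f n. A f n = B f n)"
  using dec_conj[OF dec_le dec_le, of A B B A] by (simp add: order_eq_iff)

lemma dec_comp: "dec P \<Longrightarrow> eff A \<Longrightarrow> dec (\<lambda>f n. P f (A f n))"
  unfolding dec_def by (rule eff_comp[of "\<lambda>f n. if P f n then 0 else 1" A])

lemma dec_bex:
  assumes "dec (\<lambda>f m. P f (pfst m) (psnd m))" "eff B"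
  shows "dec (\<lambda>f n. \<exists>j<B f n. P f n j)"
proof -
  have "dec (\<lambda>f m. P f (pfst m) (pfst (psnd m)))"
    using dec_comp[OF assms(1), of "\<lambda>f m. pr (pfst m) (pfst (psnd m))"] by (simp add: eff_basic)
  then have "eff (\<lambda>f n. rec_nat 1 (\<lambda>j r. if P f n j then 0 else r) (B f n))"
    using assms by (intro eff_rec eff_basic eff_if)
  moreover have "rec_nat 1 (\<lambda>j r. if P f n j then 0 else r) b = (if \<exists>j<b. P f n j then 0 else 1::nat)"
    for f n b by (induction b) (auto simp: less_Suc_eq)
  ultimately show ?thesis by (simp add: dec_def)
qed

lemma dec_ball:
  assumes "dec (\<lambda>f m. P f (pfst m) (psnd m))" "eff B"
  shows "dec (\<lambda>f n. \<forall>j<B f n. P f n j)"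
  using dec_not[OF dec_bex[OF dec_not[OF assms(1)] assms(2)]] by simp

lemmas dec_logic = dec_const dec_eq dec_le dec_less dec_not dec_conj dec_disj dec_imp dec_bex dec_ball
lemmas eff_arith = eff_basic eff_if eff_add eff_diff

text \<open>Lists are coded as in \<^const>\<open>list_encode\<close>; \<open>cdrop i s\<close> is \<open>0\<close> iff \<open>i\<close> is not a
  position of the list coded by \<open>s\<close>.\<close>

definition cdrop :: "nat \<Rightarrow> nat \<Rightarrow> nat" where
  "cdrop i s = rec_nat s (\<lambda>j r. psnd (r - 1)) i"

definition chd :: "nat \<Rightarrow> nat" where
  "chd s = pfst (s - 1)"

lemma eff_cdrop: "eff A \<Longrightarrow> eff B \<Longrightarrow> eff (\<lambda>f n. cdrop (A f n) (B f n))"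
  unfolding cdrop_def by (intro eff_rec eff_arith)

lemma eff_chd: "eff A \<Longrightarrow> eff (\<lambda>f n. chd (A f n))"
  unfolding chd_def by (intro eff_arith)

lemma cdrop_list_encode [simp]: "cdrop i (list_encode xs) = list_encode (drop i xs)"
proof (induction i)
  case (Suc i)
  have "psnd (list_encode ys - 1) = list_encode (tl ys)" for ys
    \<comment> \<open>At 0 this gives \<open>psnd 0 = 0\<close>, so dropping from the empty list
      stays at its code 0.\<close>
    using psnd_le[of 0] by (cases ys) simp_all
  with Suc show ?case by (simp add: cdrop_def drop_Suc tl_drop)
qed (simp add: cdrop_def)

lemma list_encode_eq0 [simp]: "list_encode xs = 0 \<longleftrightarrow> xs = []"
  by (cases xs) auto

lemma chd_list_encode [simp]: "xs \<noteq> [] \<Longrightarrow> chd (list_encode xs) = hd xs"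
  by (cases xs) (auto simp: chd_def)

text \<open>With the next lemma, this lets quantifiers over positions and entries of a coded list be
  bounded by the code, which keeps them decidable.\<close>

lemma length_le_list_encode: "length xs \<le> list_encode xs"
  by (induction xs) (auto intro: le_trans[OF _ le_prod_encode_2])

lemma mem_less_list_encode: "x \<in> set xs \<Longrightarrow> x < list_encode xs"
  by (induction xs) (auto simp: less_Suc_eq_le intro: le_prod_encode_1 le_trans[OF _ le_prod_encode_2]
    dest: less_imp_le)

text \<open>A code grows at its head, so the recursion runs downwards from the last position: after
  \<open>j\<close> steps it holds the values on the last \<open>j\<close> places.\<close>

lemma eff_string:
  assumes "eff (\<lambda>f m. G f (pfst m) (psnd m))" "eff K"
  shows "eff (\<lambda>f n. list_encode (map (G f n) [0..<K f n]))"
proof -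
  have "eff (\<lambda>f m. G f (pfst m) (K f (pfst m) - Suc (pfst (psnd m))))"
    using eff_comp[OF assms(1), of "\<lambda>f m. pr (pfst m) (K f (pfst m) - Suc (pfst (psnd m)))"]
    by (simp add: eff_arith eff_comp[OF assms(2)])
  then have "eff (\<lambda>f n. rec_nat 0 (\<lambda>j r. Suc (pr (G f n (K f n - Suc j)) r)) (K f n))"
    using assms(2) by (intro eff_rec eff_basic)
  moreover have "rec_nat 0 (\<lambda>j r. Suc (pr (G f n (k - Suc j)) r)) j = list_encode (map (G f n) [k - j..<k])"
    if "j \<le> k" for f n k j
    using that
  proof (induction j)
    case (Suc j)
    then have "[k - Suc j..<k] = (k - Suc j) # [k - j..<k]"
      by (metis Suc_diff_Suc Suc_le_lessD diff_less less_Suc_eq_0_disj not_less_zero upt_conv_Cons less_le_trans zero_less_Suc)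
    with Suc show ?case by simp
  qed simp
  ultimately show ?thesis by simp
qed

text \<open>Operations on coded finite sets are needed at finitely many arguments only; a table
  spares any proof that they are computable in general.\<close>

lemma eff_table: "finite S \<Longrightarrow> \<exists>h. eff (\<lambda>f. h) \<and> (\<forall>n\<in>S. h n = t n)"
proof (induction rule: finite_induct)
  case (insert a S)
  then obtain h where "eff (\<lambda>f. h)" "\<forall>n\<in>S. h n = t n" by blast
  moreover from this have "eff (\<lambda>f n. if n = a then t a else h n)"
    by (intro eff_if dec_eq eff_id eff_const)
  ultimately show ?case
    by (intro exI[of _ "\<lambda>n. if n = a then t a else h n"]) auto
qed (use eff_const in blast)

lemma dec_finite: "finite S \<Longrightarrow> dec (\<lambda>f n. n \<in> S)"
proof (induction rule: finite_induct)
  case (insert a S)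
  then show ?case using dec_disj[OF dec_eq[OF eff_id eff_const, of a], of "\<lambda>f n. n \<in> S"] by simp
qed (simp add: dec_const)

lemma eff_case_nat:
  assumes "eff A" "eff (\<lambda>f m. B f (pfst m) (psnd m))" "eff K"
  shows "eff (\<lambda>f n. case K f n of 0 \<Rightarrow> A f n | Suc j \<Rightarrow> B f n j)"
proof -
  have "eff (\<lambda>f m. B f (pfst m) (pfst (psnd m)))"
    using eff_comp[OF assms(2), of "\<lambda>f m. pr (pfst m) (pfst (psnd m))"] by (simp add: eff_basic)
  then have "eff (\<lambda>f n. rec_nat (A f n) (\<lambda>j r. B f n j) (K f n))"
    using assms by (intro eff_rec)
  moreover have "rec_nat (A f n) (\<lambda>j r. B f n j) k = (case k of 0 \<Rightarrow> A f n | Suc j \<Rightarrow> B f n j)" for f n k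
    by (cases k) auto
  ultimately show ?thesis by simp
qed

section \<open>Kleene normal form\<close>

abbreviation tr :: "nat \<Rightarrow> nat \<Rightarrow> nat \<Rightarrow> nat" where
  "tr e n y \<equiv> pr e (pr n y)"

text \<open>\<open>just \<sigma> S e n y\<close>: the computation of program \<open>e\<close> on \<open>n\<close> with result \<open>y\<close> follows in one step from the
  computations in \<open>S\<close>, where the oracle may be queried within the string \<open>\<sigma>\<close> only.\<close>

definition just :: "nat list \<Rightarrow> nat set \<Rightarrow> nat \<Rightarrow> nat \<Rightarrow> nat \<Rightarrow> bool" where
  "just \<sigma> S e n y \<longleftrightarrow>
     e = 0 \<and> y = 0 \<or> e = Suc 0 \<and> y = Suc n \<or> e = 2 \<and> y = pfst n \<or> e = 3 \<and> y = psnd n \<or>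
     e = 4 \<and> n < length \<sigma> \<and> y = \<sigma> ! n \<or>
     (\<exists>c. e = 5 + 4 * c \<and> (\<exists>u v. tr (pfst c) n u \<in> S \<and> tr (psnd c) n v \<in> S \<and> y = pr u v)) \<or>
     (\<exists>c. e = 6 + 4 * c \<and> (\<exists>u. tr (psnd c) n u \<in> S \<and> tr (pfst c) u y \<in> S)) \<or>
     (\<exists>c. e = 7 + 4 * c \<and> (psnd n = 0 \<and> tr (pfst c) (pfst n) y \<in> S \<or>
        psnd n \<noteq> 0 \<and> (\<exists>u. tr e (pr (pfst n) (psnd n - 1)) u \<in> S \<and> tr (psnd c) (pr (pfst n) (pr (psnd n - 1) u)) y \<in> S))) \<or>
     (\<exists>c. e = 8 + 4 * c \<and> tr c (pr n y) 0 \<in> S \<and> (\<forall>j<y. \<exists>u. tr c (pr n j) (Suc u) \<in> S))"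

text \<open>The premises of an entry stand behind it. A derivation is therefore extended by consing
  its conclusion, and derivations may be concatenated.\<close>

fun valid :: "nat list \<Rightarrow> nat list \<Rightarrow> bool" where
  "valid \<sigma> [] \<longleftrightarrow> True"
| "valid \<sigma> (z # zs) \<longleftrightarrow> just \<sigma> (set zs) (pfst z) (pfst (psnd z)) (psnd (psnd z)) \<and> valid \<sigma> zs"

lemma just_mono:
  assumes "just \<sigma> S e n y" "S \<subseteq> T"
  shows "just \<sigma> T e n y"
proof -
  from assms(2) have "x \<in> S \<longrightarrow> x \<in> T" for x by blast
  then have "just \<sigma> S e n y \<longrightarrow> just \<sigma> T e n y"
    unfolding just_def by (intro disj_mono conj_mono ex_mono all_mono imp_mono imp_refl allI)
  with assms(1) show ?thesis by blast
qed

lemma valid_append: "valid \<sigma> xs \<Longrightarrow> valid \<sigma> ys \<Longrightarrow> valid \<sigma> (xs @ ys)"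
  by (induction xs) (auto intro: just_mono)

lemma run_Prec_0: "psnd n = 0 \<Longrightarrow> run (Prec p q) f n = run p f (pfst n)"
  by (simp add: pfst_def psnd_def)

lemma run_Prec_Suc:
  "psnd n = Suc j \<Longrightarrow> run (Prec p q) f n =
     Option.bind (run (Prec p q) f (pr (pfst n) j)) (\<lambda>m. run q f (pr (pfst n) (pr j m)))"
  by (simp add: pfst_def psnd_def)

lemma run_Mu_eq_Some:
  "run (Mu p) f n = Some y \<longleftrightarrow>
     run p f (pr n y) = Some 0 \<and> (\<forall>j<y. \<exists>m. run p f (pr n j) = Some (Suc m))"
proof -
  have "(LEAST k. run p f (pr n k) = Some 0) = k"
    if "run p f (pr n k) = Some 0" "\<forall>j<k. \<exists>m. run p f (pr n j) = Some (Suc m)" for k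
    using that by (intro Least_equality) (force simp: not_less[symmetric])+
  then show ?thesis by auto
qed

lemma just_sound:
  assumes "just (map f [0..<k]) S e n y"
    and S: "\<And>e n y. tr e n y \<in> S \<Longrightarrow> run (prog_of_nat e) f n = Some y"
  shows "run (prog_of_nat e) f n = Some y"
  using assms(1) unfolding just_def
proof (elim HOL.disjE exE conjE)
  fix c
  assume "e = 7 + 4 * c" "psnd n = 0" "tr (pfst c) (pfst n) y \<in> S"
  with S show ?thesis by (simp add: pfst_def[of c] run_Prec_0 del: run.simps)
next
  fix c u
  assume e: "e = 7 + 4 * c" and "psnd n \<noteq> 0" "tr e (pr (pfst n) (psnd n - 1)) u \<in> S"
    and u: "tr (psnd c) (pr (pfst n) (pr (psnd n - 1) u)) y \<in> S"
  from this(2) obtain j where "psnd n = Suc j" by (cases "psnd n") auto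
  with S[OF \<open>tr e _ _ \<in> S\<close>] S[OF u] show ?thesis
    by (simp add: e psnd_def[of c] run_Prec_Suc del: run.simps)
next
  fix c
  assume "e = 8 + 4 * c" "tr c (pr n y) 0 \<in> S" "\<forall>j<y. \<exists>u. tr c (pr n j) (Suc u) \<in> S"
  then show ?thesis by (simp add: run_Mu_eq_Some del: run.simps) (use S in blast)
qed (auto simp: pfst_def psnd_def dest!: S)

lemma valid_sound:
  assumes "valid (map f [0..<k]) zs" "z \<in> set zs"
  shows "run (prog_of_nat (pfst z)) f (pfst (psnd z)) = Some (psnd (psnd z))"
  using assms
proof (induction zs arbitrary: z)
  case (Cons x zs)
  have "run (prog_of_nat e) f n = Some y" if "tr e n y \<in> set zs" for e n y
    using Cons.IH[OF _ that] Cons.prems(1) by simp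
  then show ?case using Cons just_sound[of f k "set zs" "pfst x" "pfst (psnd x)" "psnd (psnd x)"] by auto
qed simp

text \<open>Validity is demanded for all long enough initial segments of the oracle, so that
  derivations with different uses can be merged by passing to the larger bound.\<close>

definition derivable :: "(nat \<Rightarrow> nat) \<Rightarrow> nat \<Rightarrow> nat \<Rightarrow> nat \<Rightarrow> bool" where
  "derivable f e n y \<longleftrightarrow> (\<exists>k zs. \<forall>k'\<ge>k. valid (map f [0..<k']) zs \<and> tr e n y \<in> set zs)"

lemma derivable_step:
  assumes "finite S" "\<And>z. z \<in> S \<Longrightarrow> derivable f (pfst z) (pfst (psnd z)) (psnd (psnd z))"
    and "\<And>k'. k' \<ge> k \<Longrightarrow> just (map f [0..<k']) S e n y"
  shows "derivable f e n y"
proof -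
  from assms(1,2) have "\<exists>k zs. \<forall>k'\<ge>k. valid (map f [0..<k']) zs \<and> S \<subseteq> set zs"
  proof (induction rule: finite_induct)
    case (insert z S)
    then obtain k zs k1 zs1 where "\<forall>k'\<ge>k. valid (map f [0..<k']) zs \<and> S \<subseteq> set zs"
      "\<forall>k'\<ge>k1. valid (map f [0..<k']) zs1 \<and> z \<in> set zs1"
      unfolding derivable_def by (auto, metis pr_simps(3))
    then show ?case by (intro exI[of _ "max k k1"] exI[of _ "zs @ zs1"]) (auto simp: valid_append)
  qed (auto intro!: exI[of _ "[]"])
  then obtain k1 zs where "\<forall>k'\<ge>k1. valid (map f [0..<k']) zs \<and> S \<subseteq> set zs" by blast
  with assms(3) have "\<forall>k'\<ge>max k k1. valid (map f [0..<k']) (tr e n y # zs)"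
    by (auto intro: just_mono)
  then show ?thesis unfolding derivable_def by (intro exI[of _ "max k k1"] exI[of _ "tr e n y # zs"]) simp
qed

lemma run_derivable: "run p f n = Some y \<Longrightarrow> derivable f (nat_of_prog p) n y"
proof (induction p arbitrary: n y)
  case (Tup p q)
  then obtain u v where uv: "run p f n = Some u" "run q f n = Some v" "y = pr u v"
    by (auto simp: bind_eq_Some_conv)
  show ?case
    by (rule derivable_step[of "{tr (nat_of_prog p) n u, tr (nat_of_prog q) n v}" _ 0])
      (use Tup.IH uv in \<open>auto simp: just_def\<close>)
next
  case (Comp p q)
  then obtain u where u: "run q f n = Some u" "run p f u = Some y"
    by (auto simp: bind_eq_Some_conv)
  show ?case
    by (rule derivable_step[of "{tr (nat_of_prog q) n u, tr (nat_of_prog p) u y}" _ 0])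
      (use Comp.IH u in \<open>auto simp: just_def\<close>)
next
  case (Prec p q)
  \<comment> \<open>A second induction, on the recursion argument: the rule for \<open>Prec\<close>
    has a premise about the same program.\<close>
  have "derivable f (nat_of_prog (Prec p q)) (pr a j) y"
    if "run (Prec p q) f (pr a j) = Some y" for a j y
    using that
  proof (induction j arbitrary: y)
    case 0
    show ?case
      by (rule derivable_step[of "{tr (nat_of_prog p) a y}" _ 0])
        (use Prec.IH 0 in \<open>auto simp: just_def\<close>)
  next
    case (Suc j)
    then obtain u where u: "run (Prec p q) f (pr a j) = Some u" "run q f (pr a (pr j u)) = Some y"
      by (auto simp: bind_eq_Some_conv)
    show ?case
      by (rule derivable_step[of "{tr (nat_of_prog (Prec p q)) (pr a j) u,
            tr (nat_of_prog q) (pr a (pr j u)) y}" _ 0])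
        (use Prec.IH Suc.IH u in \<open>auto simp: just_def\<close>)
  qed
  from this[of "pfst n" "psnd n" y] Prec.prems show ?case by (simp del: run.simps)
next
  case (Mu p)
  then have y: "run p f (pr n y) = Some 0" "\<forall>j<y. \<exists>m. run p f (pr n j) = Some (Suc m)"
    using run_Mu_eq_Some by blast+
  then obtain m where m: "\<And>j. j < y \<Longrightarrow> run p f (pr n j) = Some (Suc (m j))" by metis
  define S where "S = insert (tr (nat_of_prog p) (pr n y) 0)
    ((\<lambda>j. tr (nat_of_prog p) (pr n j) (Suc (m j))) ` {..<y})"
  have "derivable f (pfst z) (pfst (psnd z)) (psnd (psnd z))" if "z \<in> S" for z
    using that Mu.IH[OF y(1)] Mu.IH[OF m] by (auto simp: S_def)
  moreover have "just \<sigma> S (nat_of_prog (Mu p)) n y" for \<sigma>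
  proof -
    have "tr (nat_of_prog p) (pr n y) 0 \<in> S"
      "\<forall>j<y. \<exists>u. tr (nat_of_prog p) (pr n j) (Suc u) \<in> S"
      by (auto simp: S_def)
    then show ?thesis
      unfolding just_def nat_of_prog.simps
      by (intro HOL.disjI2) (rule exI[of _ "nat_of_prog p"], simp)
  qed
  ultimately show ?case by (rule derivable_step[of S, rotated]) (auto simp: S_def)
next
  case Oracle
  \<comment> \<open>The query at \<open>n\<close> can be answered once the string has length
    \<open>Suc n\<close>.\<close>
  then show ?case by - (rule derivable_step[of "{}" _ "Suc n"], auto simp: just_def)
qed (rule derivable_step[of "{}" _ 0]; auto simp: just_def pfst_def psnd_def)+

section \<open>Decidable checking of coded derivations\<close>

definition memc :: "nat \<Rightarrow> nat \<Rightarrow> bool" where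
  "memc z t \<longleftrightarrow> (\<exists>i<t. cdrop i t \<noteq> 0 \<and> chd (cdrop i t) = z)"

text \<open>The counterpart of \<open>just\<close> on codes. All quantifiers are bounded so that
  \<open>dec_logic\<close> applies, and \<open>4 * c\<close> is written as a sum because addition
  has a closure rule in \<open>eff_arith\<close> and multiplication has none.\<close>

definition justc :: "nat \<Rightarrow> nat \<Rightarrow> nat \<Rightarrow> nat \<Rightarrow> nat \<Rightarrow> bool" where
  "justc s t e n y \<longleftrightarrow>
     e = 0 \<and> y = 0 \<or> e = Suc 0 \<and> y = Suc n \<or> e = 2 \<and> y = pfst n \<or> e = 3 \<and> y = psnd n \<or>
     e = 4 \<and> cdrop n s \<noteq> 0 \<and> y = chd (cdrop n s) \<or>
     (\<exists>c<e. e = 5 + (c + c + c + c) \<and>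
        (\<exists>u<t. \<exists>v<t. memc (tr (pfst c) n u) t \<and> memc (tr (psnd c) n v) t \<and> y = pr u v)) \<or>
     (\<exists>c<e. e = 6 + (c + c + c + c) \<and> (\<exists>u<t. memc (tr (psnd c) n u) t \<and> memc (tr (pfst c) u y) t)) \<or>
     (\<exists>c<e. e = 7 + (c + c + c + c) \<and> (psnd n = 0 \<and> memc (tr (pfst c) (pfst n) y) t \<or>
        psnd n \<noteq> 0 \<and> (\<exists>u<t. memc (tr e (pr (pfst n) (psnd n - 1)) u) t \<and>
               memc (tr (psnd c) (pr (pfst n) (pr (psnd n - 1) u)) y) t))) \<or>
     (\<exists>c<e. e = 8 + (c + c + c + c) \<and> memc (tr c (pr n y) 0) t \<and>
        (\<forall>j<y. \<exists>u<t. memc (tr c (pr n j) (Suc u)) t))"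

definition chk :: "nat \<Rightarrow> nat \<Rightarrow> nat \<Rightarrow> nat \<Rightarrow> nat \<Rightarrow> bool" where
  "chk s e n y t \<longleftrightarrow> memc (tr e n y) t \<and>
     (\<forall>j<t. cdrop j t \<noteq> 0 \<longrightarrow> justc s (cdrop (Suc j) t)
        (pfst (chd (cdrop j t))) (pfst (psnd (chd (cdrop j t)))) (psnd (psnd (chd (cdrop j t)))))"

lemma dec_memc:
  assumes "eff A" "eff B"
  shows "dec (\<lambda>f n. memc (A f n) (B f n))"
proof -
  have "dec (\<lambda>f m. memc (pfst m) (psnd m))"
    unfolding memc_def by (intro dec_logic eff_arith eff_cdrop eff_chd)
  from dec_comp[OF this eff_pr[OF assms]] show ?thesis by simp
qed

lemma dec_chk:
  assumes "eff A" "eff B" "eff C" "eff D" "eff E"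
  shows "dec (\<lambda>f n. chk (A f n) (B f n) (C f n) (D f n) (E f n))"
proof -
  have "dec (\<lambda>f m. justc (pfst m) (pfst (psnd m)) (pfst (psnd (psnd m))) (pfst (psnd (psnd (psnd m)))) (psnd (psnd (psnd (psnd m)))))"
    unfolding justc_def by (intro dec_logic eff_arith eff_cdrop eff_chd dec_memc)
  note justc = dec_comp[OF this, of "\<lambda>f n. pr (A f n) (pr (B f n) (pr (C f n) (pr (D f n) (E f n))))" for A B C D E, simplified]
  have "dec (\<lambda>f m. chk (pfst m) (pfst (psnd m)) (pfst (psnd (psnd m))) (pfst (psnd (psnd (psnd m)))) (psnd (psnd (psnd (psnd m)))))"
    unfolding chk_def by (intro dec_logic eff_arith eff_cdrop eff_chd dec_memc justc)
  from dec_comp[OF this, of "\<lambda>f n. pr (A f n) (pr (B f n) (pr (C f n) (pr (D f n) (E f n))))"] assms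
  show ?thesis by (simp add: eff_pr)
qed

lemma memc_list_encode [simp]: "memc z (list_encode zs) \<longleftrightarrow> z \<in> set zs"
proof -
  have "cdrop i (list_encode zs) \<noteq> 0 \<and> chd (cdrop i (list_encode zs)) = z \<longleftrightarrow> i < length zs \<and> zs ! i = z" for i
    by (auto simp: hd_drop_conv_nth)
  then show ?thesis
    unfolding memc_def in_set_conv_nth using less_le_trans[OF _ length_le_list_encode[of zs]] by auto
qed

text \<open>The bounds put on the intermediate results in \<open>justc\<close> lose nothing: a
  result recorded in the list is smaller than the code of the list.\<close>

lemma memc_bound: "memc (tr e n u) t \<Longrightarrow> u < t" "memc (tr e n (Suc u)) t \<Longrightarrow> u < t"
proof -
  have "u \<le> tr e n u" "u \<le> tr e n (Suc u)" for e n u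
    using le_prod_encode_2[of "pr n u" e] le_prod_encode_2[of u n]
      le_prod_encode_2[of "pr n (Suc u)" e] le_prod_encode_2[of "Suc u" n] by linarith+
  moreover have "memc z t \<Longrightarrow> z < t" for z
    using mem_less_list_encode[of z "list_decode t"] memc_list_encode[of z "list_decode t"] by simp
  ultimately show "memc (tr e n u) t \<Longrightarrow> u < t" "memc (tr e n (Suc u)) t \<Longrightarrow> u < t"
    using le_less_trans by blast+
qed

lemma justc_list_encode: "justc (list_encode \<sigma>) (list_encode zs) e n y \<longleftrightarrow> just \<sigma> (set zs) e n y"
proof -
  have bnd: "(\<exists>u<t. memc (tr a b u) t \<and> P u) \<longleftrightarrow> (\<exists>u. memc (tr a b u) t \<and> P u)"
    "(\<exists>u<t. memc (tr a b (Suc u)) t) \<longleftrightarrow> (\<exists>u. memc (tr a b (Suc u)) t)"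
    "(\<exists>u<t. \<exists>v<t. memc (tr a b u) t \<and> memc (tr a' b v) t \<and> Q u v) \<longleftrightarrow>
      (\<exists>u v. memc (tr a b u) t \<and> memc (tr a' b v) t \<and> Q u v)" for a a' b P Q t
    by (meson memc_bound)+
  have cbd: "(\<exists>c<e. e = 5 + (c + c + c + c) \<and> P c) \<longleftrightarrow> (\<exists>c. e = 5 + 4 * c \<and> P c)"
    "(\<exists>c<e. e = 6 + (c + c + c + c) \<and> P c) \<longleftrightarrow> (\<exists>c. e = 6 + 4 * c \<and> P c)"
    "(\<exists>c<e. e = 7 + (c + c + c + c) \<and> P c) \<longleftrightarrow> (\<exists>c. e = 7 + 4 * c \<and> P c)"
    "(\<exists>c<e. e = 8 + (c + c + c + c) \<and> P c) \<longleftrightarrow> (\<exists>c. e = 8 + 4 * c \<and> P c)" for P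
    by (rule ex_cong1, rule iffI; force)+
  have orc: "cdrop n (list_encode \<sigma>) \<noteq> 0 \<and> y = chd (cdrop n (list_encode \<sigma>)) \<longleftrightarrow> n < length \<sigma> \<and> y = \<sigma> ! n"
    by (auto simp: hd_drop_conv_nth)
  show ?thesis
    unfolding just_def justc_def bnd cbd orc
    unfolding memc_list_encode ..
qed

lemma chk_list_encode:
  "chk (list_encode \<sigma>) e n y (list_encode zs) \<longleftrightarrow> valid \<sigma> zs \<and> tr e n y \<in> set zs"
proof -
  have "valid \<sigma> zs \<longleftrightarrow> (\<forall>j<length zs. just \<sigma> (set (drop (Suc j) zs))
    (pfst (zs ! j)) (pfst (psnd (zs ! j))) (psnd (psnd (zs ! j))))"
    by (induction zs) (auto simp: less_Suc_eq_0_disj)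
  moreover have "(\<forall>j<list_encode zs. cdrop j (list_encode zs) \<noteq> 0 \<longrightarrow> P j) \<longleftrightarrow> (\<forall>j<length zs. P j)" for P
    using length_le_list_encode[of zs] by auto
  ultimately show ?thesis
    unfolding chk_def by (auto simp: justc_list_encode hd_drop_conv_nth)
qed

text \<open>Kleene's normal form. It has two consequences: programs can be simulated from their
  indices (\<open>semi_run\<close>), and a convergent computation depends on a finite part of the
  oracle (\<open>semi_use\<close>).\<close>

lemma run_iff_chk:
  "run (prog_of_nat e) f n = Some y \<longleftrightarrow> (\<exists>k t. chk (list_encode (map f [0..<k])) e n y t)"
proof
  assume "run (prog_of_nat e) f n = Some y"
  then have "derivable f e n y" using run_derivable by fastforce
  then show "\<exists>k t. chk (list_encode (map f [0..<k])) e n y t"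
    unfolding derivable_def using chk_list_encode by (metis le_refl)
next
  assume "\<exists>k t. chk (list_encode (map f [0..<k])) e n y t"
  then show "run (prog_of_nat e) f n = Some y"
    using chk_list_encode[of _ e n y "list_decode _"] valid_sound[of f _ _ "tr e n y"] by auto
qed

section \<open>Semidecidable relations and the reducibility\<close>

lemma ex_pr_iff: "(\<exists>w. Q (pfst w) (psnd w)) \<longleftrightarrow> (\<exists>a b. Q a b)"
  by (metis pr_simps(1,2))

text \<open>Semidecidability uniformly in the oracle. Since this notion is closed under the
  operations below, reductions can be combined without computing with indices.\<close>

definition semi :: "((nat \<Rightarrow> nat) \<Rightarrow> nat \<Rightarrow> bool) \<Rightarrow> bool" where
  "semi R \<longleftrightarrow> (\<exists>P. dec P \<and> (\<forall>f n. R f n \<longleftrightarrow> (\<exists>k. P f (pr n k))))"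

lemma semiI: "dec P \<Longrightarrow> (\<And>f n. R f n \<longleftrightarrow> (\<exists>k. P f (pr n k))) \<Longrightarrow> semi R"
  by (auto simp: semi_def)

lemma semi_dec: "dec P \<Longrightarrow> semi P"
  by (rule semiI[OF dec_comp[of P "\<lambda>f. pfst"]]) (auto intro: eff_basic)

lemma semi_comp:
  assumes "semi R" "eff A"
  shows "semi (\<lambda>f n. R f (A f n))"
proof -
  from assms(1) obtain P where P: "dec P" "\<And>f n. R f n \<longleftrightarrow> (\<exists>k. P f (pr n k))"
    by (auto simp: semi_def)
  have "eff (\<lambda>f m. pr (A f (pfst m)) (psnd m))"
    by (intro eff_basic eff_comp[OF assms(2)])
  from dec_comp[OF P(1) this] show ?thesis
    by (rule semiI) (simp add: P)
qed

lemma semi_conj: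
  assumes "semi R" "semi Q"
  shows "semi (\<lambda>f n. R f n \<and> Q f n)"
proof -
  from assms obtain P P' where P: "dec P" "\<And>f n. R f n \<longleftrightarrow> (\<exists>k. P f (pr n k))"
    "dec P'" "\<And>f n. Q f n \<longleftrightarrow> (\<exists>k. P' f (pr n k))"
    by (auto simp: semi_def)
  have "dec (\<lambda>f m. P f (pr (pfst m) (pfst (psnd m))) \<and> P' f (pr (pfst m) (psnd (psnd m))))"
    by (intro dec_conj dec_comp[OF P(1)] dec_comp[OF P(3)] eff_basic)
  then show ?thesis
    by (rule semiI) (simp add: P ex_pr_iff[of "\<lambda>a b. P _ (pr _ a) \<and> P' _ (pr _ b)"])
qed

lemma semi_disj:
  assumes "semi R" "semi Q"
  shows "semi (\<lambda>f n. R f n \<or> Q f n)"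
proof -
  from assms obtain P P' where P: "dec P" "\<And>f n. R f n \<longleftrightarrow> (\<exists>k. P f (pr n k))"
    "dec P'" "\<And>f n. Q f n \<longleftrightarrow> (\<exists>k. P' f (pr n k))"
    by (auto simp: semi_def)
  from dec_disj[OF P(1,3)] show ?thesis
    by (rule semiI) (auto simp: P)
qed

lemma semi_ex:
  assumes "semi (\<lambda>f m. R f (pfst m) (psnd m))"
  shows "semi (\<lambda>f n. \<exists>k. R f n k)"
proof -
  from assms obtain P where P: "dec P" "\<And>f n. R f (pfst n) (psnd n) \<longleftrightarrow> (\<exists>k. P f (pr n k))"
    by (auto simp: semi_def)
  have "dec (\<lambda>f m. P f (pr (pr (pfst m) (pfst (psnd m))) (psnd (psnd m))))"
    by (intro dec_comp[OF P(1)] eff_basic)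
  then show ?thesis
  proof (rule semiI)
    fix f n
    have "R f n k \<longleftrightarrow> (\<exists>t. P f (pr (pr n k) t))" for k
      using P(2)[of f "pr n k"] by simp
    then show "(\<exists>k. R f n k) \<longleftrightarrow>
        (\<exists>k. P f (pr (pr (pfst (pr n k)) (pfst (psnd (pr n k)))) (psnd (psnd (pr n k)))))"
      using ex_pr_iff[of "\<lambda>k t. P f (pr (pr n k) t)"] by simp
  qed
qed

text \<open>The witnesses for all \<open>j\<close> below the bound are collected in one coded
  list.\<close>

lemma semi_ball:
  assumes "semi (\<lambda>f m. R f (pfst m) (psnd m))" "eff B"
  shows "semi (\<lambda>f n. \<forall>j<B f n. R f n j)"
proof -
  from assms obtain P where P: "dec P" "\<And>f n. R f (pfst n) (psnd n) \<longleftrightarrow> (\<exists>k. P f (pr n k))"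
    by (auto simp: semi_def)
  have "dec (\<lambda>f m. P f (pr (pr (pfst (pfst m)) (psnd m)) (chd (cdrop (psnd m) (psnd (pfst m))))))"
    by (intro dec_comp[OF P(1)] eff_basic eff_chd eff_cdrop)
  then have "dec (\<lambda>f m. \<forall>j<B f (pfst m). P f (pr (pr (pfst m) j) (chd (cdrop j (psnd m)))))"
    by (intro dec_ball eff_comp[OF assms(2)] eff_basic)
  then show ?thesis
  proof (rule semiI)
    fix f n
    show "(\<forall>j<B f n. R f n j) \<longleftrightarrow>
      (\<exists>k. \<forall>j<B f (pfst (pr n k)). P f (pr (pr (pfst (pr n k)) j) (chd (cdrop j (psnd (pr n k))))))"
    proof
      assume "\<forall>j<B f n. R f n j"
      then obtain w where w: "\<And>j. j < B f n \<Longrightarrow> P f (pr (pr n j) (w j))"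
        using P(2)[of f "pr n _"] by simp metis
      then show "\<exists>k. \<forall>j<B f (pfst (pr n k)). P f (pr (pr (pfst (pr n k)) j) (chd (cdrop j (psnd (pr n k)))))"
        by (intro exI[of _ "list_encode (map w [0..<B f n])"]) (simp add: hd_drop_conv_nth)
    next
      assume "\<exists>k. \<forall>j<B f (pfst (pr n k)). P f (pr (pr (pfst (pr n k)) j) (chd (cdrop j (psnd (pr n k)))))"
      then show "\<forall>j<B f n. R f n j" using P(2)[of f "pr n _"] by simp blast
    qed
  qed
qed

text \<open>A universal machine: the index and even the simulated oracle may depend on the
  input.\<close>

lemma semi_run:
  assumes "eff (\<lambda>f m. G f (pfst m) (psnd m))" "eff E" "eff N" "eff Y"
  shows "semi (\<lambda>f n. run (prog_of_nat (E f n)) (G f n) (N f n) = Some (Y f n))"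
proof -
  have "eff (\<lambda>f m. G f (pfst (pfst (pfst m))) (psnd m))"
    using eff_comp[OF assms(1), of "\<lambda>f m. pr (pfst (pfst (pfst m))) (psnd m)"] by (simp add: eff_basic)
  then have "dec (\<lambda>f m. chk (list_encode (map (G f (pfst (pfst m))) [0..<psnd (pfst m)])) (E f (pfst (pfst m)))
     (N f (pfst (pfst m))) (Y f (pfst (pfst m))) (psnd m))"
    by (intro dec_chk eff_string eff_basic eff_comp[OF assms(2)] eff_comp[OF assms(3)] eff_comp[OF assms(4)])
  then show ?thesis unfolding run_iff_chk by (intro semi_ex semi_dec)
qed

text \<open>The search runs over pairs of a value and a witness for it, and returns the value. Where
  \<open>G\<close> is the graph of a function, this computes the function.\<close>

lemma semi_uniformize:
  assumes "semi G"
  obtains q where "\<And>f n. run q f n = None \<longleftrightarrow> (\<forall>y. \<not> G f (pr n y))"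
    "\<And>f n y. run q f n = Some y \<Longrightarrow> G f (pr n y)"
proof -
  from assms obtain P where P: "dec P" "\<And>f n. G f n \<longleftrightarrow> (\<exists>k. P f (pr n k))"
    by (auto simp: semi_def)
  have "dec (\<lambda>f m. P f (pr (pr (pfst m) (pfst (psnd m))) (psnd (psnd m))))"
    by (intro dec_comp[OF P(1)] eff_basic)
  then obtain c where c: "\<And>f m. run c f m =
      Some (if P f (pr (pr (pfst m) (pfst (psnd m))) (psnd (psnd m))) then 0 else 1)"
    by (auto simp: dec_def eff_def)
  let ?q = "Comp Fst (Mu c)"
  have Mu: "run (Mu c) f n = Some w \<longleftrightarrow> P f (pr (pr n (pfst w)) (psnd w)) \<and>
      (\<forall>j<w. \<not> P f (pr (pr n (pfst j)) (psnd j)))" for f n w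
    unfolding run_Mu_eq_Some by (auto simp: c)
  have "run (Mu c) f n \<noteq> None \<longleftrightarrow> (\<exists>w. P f (pr (pr n (pfst w)) (psnd w)))" for f n
  proof
    assume "\<exists>w. P f (pr (pr n (pfst w)) (psnd w))"
    then have "run (Mu c) f n = Some (LEAST w. P f (pr (pr n (pfst w)) (psnd w)))"
      unfolding Mu by (metis (mono_tags, lifting) LeastI not_less_Least)
    then show "run (Mu c) f n \<noteq> None" by simp
  qed (use Mu in auto)
  moreover have "(\<exists>w. P f (pr (pr n (pfst w)) (psnd w))) \<longleftrightarrow> (\<exists>y. G f (pr n y))" for f n
    by (simp add: P(2) ex_pr_iff[of "\<lambda>y t. P f (pr (pr n y) t)"])
  moreover have fst_q: "run ?q f n = map_option pfst (run (Mu c) f n)" for f n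
    by (cases "run (Mu c) f n") (simp_all add: pfst_def del: run.simps(9))
  ultimately have q: "run ?q f n = None \<longleftrightarrow> (\<forall>y. \<not> G f (pr n y))" for f n
    by (metis None_eq_map_option_iff)
  have "G f (pr n y)" if y: "run ?q f n = Some y" for f n y
  proof -
    obtain w where "run (Mu c) f n = Some w" "y = pfst w"
      using y by (auto simp: fst_q simp del: run.simps)
    then show ?thesis using Mu P(2) by blast
  qed
  with q show thesis by (rule that)
qed

lemma semi_program:
  assumes "semi R"
  obtains r where "\<And>f n. R f n \<longleftrightarrow> (\<exists>y. run r f n = Some y)"
proof -
  have "semi (\<lambda>f m. R f (pfst m))" by (intro semi_comp[OF assms] eff_basic)
  then obtain q where "\<And>f n. run q f n = None \<longleftrightarrow> (\<forall>y. \<not> R f (pfst (pr n y)))"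
    by (elim semi_uniformize) blast
  then show thesis by (intro that[of q]) (metis not_Some_eq pr_simps(1))
qed

text \<open>The use principle. \<open>D\<close> reads no oracle, so all dependence on
  \<open>f\<close> goes through a finite initial segment.\<close>

lemma semi_use:
  assumes "semi R"
  obtains D where "dec (\<lambda>f. D)"
    "\<And>f n. R f n \<longleftrightarrow> (\<exists>k t. D (pr (list_encode (map f [0..<k])) (pr n t)))"
proof -
  obtain r where r: "\<And>f n. R f n \<longleftrightarrow> (\<exists>y. run r f n = Some y)"
    using semi_program[OF assms] by blast
  let ?D = "\<lambda>m. chk (pfst m) (nat_of_prog r) (pfst (psnd m)) (pfst (psnd (psnd m))) (psnd (psnd (psnd m)))"
  have "dec (\<lambda>f. ?D)" by (intro dec_chk eff_basic)
  moreover have "R f n \<longleftrightarrow> (\<exists>k t. ?D (pr (list_encode (map f [0..<k])) (pr n t)))" for f n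
    using run_iff_chk[of "nat_of_prog r" f n] ex_pr_iff[of "\<lambda>y t. chk (list_encode (map f [0..<_])) (nat_of_prog r) n y t"]
    unfolding r by simp blast
  ultimately show thesis by (rule that)
qed

lemma semi_oracle:
  assumes "semi R" "eff (\<lambda>f m. G f (pfst m) (psnd m))" "eff A"
  shows "semi (\<lambda>f n. R (G f n) (A f n))"
proof -
  obtain r where r: "\<And>f n. R f n \<longleftrightarrow> (\<exists>y. run r f n = Some y)"
    using semi_program[OF assms(1)] by blast
  have "eff (\<lambda>f m. G f (pfst (pfst m)) (psnd m))"
    using eff_comp[OF assms(2), of "\<lambda>f m. pr (pfst (pfst m)) (psnd m)"] by (simp add: eff_basic)
  then have "semi (\<lambda>f m. run (prog_of_nat (nat_of_prog r)) (G f (pfst m)) (A f (pfst m)) = Some (psnd m))"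
    by (intro semi_run eff_basic eff_comp[OF assms(3)])
  then show ?thesis unfolding r by (intro semi_ex) simp
qed

text \<open>Composition with an oracle \<open>g\<close> that is known only through a semidecidable
  graph, possibly meaningful for some inputs only. \<open>Q\<close> guesses an initial segment of
  \<open>g\<close>, has \<open>G\<close> confirm each entry and then applies the use principle to
  \<open>R\<close>; nothing is claimed where \<open>G\<close> is not a graph.\<close>

lemma semi_subst:
  assumes "semi R" "semi G"
  obtains Q where "semi Q"
    "\<And>f n g. (\<And>l y. G f (pr n (pr l y)) \<longleftrightarrow> g l = y) \<Longrightarrow> Q f n \<longleftrightarrow> R g n"
proof -
  obtain D where D: "dec (\<lambda>f. D)"
    "\<And>f n. R f n \<longleftrightarrow> (\<exists>k t. D (pr (list_encode (map f [0..<k])) (pr n t)))"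
    using semi_use[OF assms(1)] by blast
  let ?Q = "\<lambda>f n. \<exists>s t. (\<forall>j<s. cdrop j s = 0 \<or> G f (pr n (pr j (chd (cdrop j s))))) \<and> D (pr s (pr n t))"
  have "semi ?Q"
  proof (intro semi_ex semi_conj semi_ball semi_disj semi_comp[OF assms(2)], goal_cases)
    case 1
    show ?case by (intro semi_dec dec_eq eff_basic eff_cdrop)
  next
    case 4
    show ?case by (rule semi_dec, rule dec_comp[OF D(1)]) (intro eff_basic)
  qed (intro eff_basic eff_chd eff_cdrop)+
  moreover have "?Q f n \<longleftrightarrow> R g n" if g: "\<And>l y. G f (pr n (pr l y)) \<longleftrightarrow> g l = y" for f n g
  proof -
    have "(\<forall>j<list_encode xs. cdrop j (list_encode xs) = 0 \<or> G f (pr n (pr j (chd (cdrop j (list_encode xs))))))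
      \<longleftrightarrow> xs = map g [0..<length xs]" for xs
    proof -
      have "(cdrop j (list_encode xs) = 0 \<or> G f (pr n (pr j (chd (cdrop j (list_encode xs)))))) \<longleftrightarrow>
          (j < length xs \<longrightarrow> xs ! j = g j)" for j
        by (cases "j < length xs") (auto simp: g hd_drop_conv_nth)
      then have "(\<forall>j<list_encode xs. cdrop j (list_encode xs) = 0 \<or> G f (pr n (pr j (chd (cdrop j (list_encode xs))))))
          \<longleftrightarrow> (\<forall>j<length xs. xs ! j = g j)"
        using length_le_list_encode[of xs] by (meson less_le_trans)
      also have "\<dots> \<longleftrightarrow> xs = map g [0..<length xs]"
        unfolding list_eq_iff_nth_eq[of xs "map g [0..<length xs]"] by simp
      finally show ?thesis .
    qed
    then have "?Q f n \<longleftrightarrow> (\<exists>xs t. xs = map g [0..<length xs] \<and> D (pr (list_encode xs) (pr n t)))"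
      by (metis list_decode_inverse)
    also have "\<dots> \<longleftrightarrow> R g n"
      unfolding D(2) by (metis diff_zero length_map length_upt)
    finally show ?thesis .
  qed
  ultimately show thesis by (rule that)
qed

text \<open>\<open>R f i\<close> stands for \<open>f \<notin> V i\<close>, and \<open>G\<close> is the uniform graph of the functionals \<open>\<Phi> (e i)\<close>; both need to
  be meaningful on \<open>B\<close> only.\<close>

definition red :: "((nat \<Rightarrow> nat) \<Rightarrow> nat \<Rightarrow> bool) \<Rightarrow> ((nat \<Rightarrow> nat) \<Rightarrow> nat \<Rightarrow> bool) \<Rightarrow>
    (nat \<Rightarrow> nat) set \<Rightarrow> (nat \<Rightarrow> nat) set \<Rightarrow> bool" where
  "red R G A B \<longleftrightarrow> (\<forall>f\<in>B. (\<exists>i. \<not> R f i) \<and>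
     (\<forall>i. \<not> R f i \<longrightarrow> (\<exists>g\<in>A. \<forall>n y. G f (pr (pr i n) y) \<longleftrightarrow> g n = y)))"

definition const_code :: "nat \<Rightarrow> nat" where
  "const_code i = nat_of_prog (const_prog i)"

lemma eff_const_code: "eff A \<Longrightarrow> eff (\<lambda>f n. const_code (A f n))"
proof -
  assume "eff A"
  \<comment> \<open>If \<open>r\<close> is the number of \<open>p\<close>, then
    \<open>6 + 4 * pr 1 r\<close> is the number of \<open>Comp Succ p\<close>.\<close>
  then have "eff (\<lambda>f n. rec_nat 0 (\<lambda>j r. 6 + (pr 1 r + pr 1 r + pr 1 r + pr 1 r)) (A f n))"
    by (intro eff_rec eff_arith)
  moreover have "rec_nat 0 (\<lambda>j r. 6 + (pr 1 r + pr 1 r + pr 1 r + pr 1 r)) k = const_code k" for k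
    by (induction k) (simp_all add: const_code_def)
  ultimately show ?thesis by simp
qed

lemma computable_eff: "eff (\<lambda>f. h) \<Longrightarrow> computable h"
  unfolding eff_def computable_def turing_functional_def by (metis prog_of_nat_of_prog)

lemma smn_theorem: "\<exists>h. computable h \<and> (\<forall>i f n. \<Phi> (h i) f n = run q f (pr i n))"
proof -
  let ?h = "\<lambda>i. nat_of_prog (Comp q (Tup (const_prog i) id_prog))"
  \<comment> \<open>Here \<open>t\<close> and \<open>u\<close> are the coded pairs of arguments of
    \<open>Tup\<close> and of the outer \<open>Comp\<close>.\<close>
  have "eff (\<lambda>f i. let t = pr (const_code i) (nat_of_prog id_prog);
      u = pr (nat_of_prog q) (5 + (t + t + t + t)) in 6 + (u + u + u + u))"
    unfolding Let_def by (intro eff_arith eff_const_code)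
  then have "computable ?h"
    by (intro computable_eff) (simp add: Let_def const_code_def add.commute)
  then show ?thesis
    by (intro exI[of _ ?h]) (simp add: turing_functional_def)
qed

text \<open>Computability refers to the zero oracle, so \<open>h\<close> is evaluated by simulation
  with that oracle, whatever \<open>f\<close> is.\<close>

lemma semi_computable_graph:
  assumes "computable h" "eff A" "eff B"
  shows "semi (\<lambda>f n. h (A f n) = B f n)"
proof -
  obtain e where "\<And>n. run (prog_of_nat e) (\<lambda>_. 0) n = Some (h n)"
    using assms(1) by (auto simp: computable_def turing_functional_def)
  then have "h (A f n) = B f n \<longleftrightarrow> run (prog_of_nat e) (\<lambda>_. 0) (A f n) = Some (B f n)" for f n
    by simp
  then show ?thesis using semi_run[of "\<lambda>_ _ _. 0" "\<lambda>_ _. e" A B] assms(2,3) by (simp add: eff_const)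
qed

text \<open>Leaving a class is a search over initial segments, hence semidecidable. Conversely, the
  use principle turns a semidecidable relation into a c.e. set of strings, uniformization turns the
  graph into a program, and the s-m-n theorem makes both sequences of indices computable.\<close>

theorem le1_iff: "A \<le>\<^sub>1 B \<longleftrightarrow> (\<exists>R G. semi R \<and> semi G \<and> red R G A B)"
proof
  assume "A \<le>\<^sub>1 B"
  then obtain p h where ph: "computable p" "computable h" "B \<subseteq> (\<Union>i. Pi01_class (p i))"
    "\<And>i f. f \<in> B \<Longrightarrow> f \<in> Pi01_class (p i) \<Longrightarrow> \<exists>g\<in>A. \<forall>n. \<Phi> (h i) f n = Some (g n)"
    unfolding le1_def uniformly_Pi01_def by (auto simp: Bex_def)
  let ?R = "\<lambda>f i. \<exists>w k y. p i = w \<and>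
    run (prog_of_nat w) (\<lambda>_. 0) (list_encode (map f [0..<k])) = Some y"
  let ?G = "\<lambda>f m. \<exists>w. h (pfst (pfst m)) = w \<and> run (prog_of_nat w) f (psnd (pfst m)) = Some (psnd m)"
  have "semi ?R"
    by (intro semi_ex semi_conj semi_computable_graph[OF ph(1)] semi_run eff_basic eff_string)
  moreover have "semi ?G"
    by (intro semi_ex semi_conj semi_computable_graph[OF ph(2)] semi_run eff_basic)
  moreover have "\<not> ?R f i \<longleftrightarrow> f \<in> Pi01_class (p i)" for f i
    by (auto simp: Pi01_class_def ce_set_def dom_def turing_functional_def)
  then have "red ?R ?G A B"
    unfolding red_def using ph(3,4) by (fastforce simp: turing_functional_def)
  ultimately show "\<exists>R G. semi R \<and> semi G \<and> red R G A B" by blast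
next
  assume "\<exists>R G. semi R \<and> semi G \<and> red R G A B"
  then obtain R G where RG: "semi R" "semi G" "red R G A B" by blast
  obtain D where D: "dec (\<lambda>f. D)"
    "\<And>f n. R f n \<longleftrightarrow> (\<exists>k t. D (pr (list_encode (map f [0..<k])) (pr n t)))"
    using semi_use[OF RG(1)] by blast
  have "semi (\<lambda>f m. \<exists>t. D (pr (psnd m) (pr (pfst m) t)))"
    by (intro semi_ex) (intro semi_dec dec_comp[OF D(1)] eff_basic)
  then obtain r where r: "\<And>f m. (\<exists>t. D (pr (psnd m) (pr (pfst m) t))) \<longleftrightarrow> (\<exists>y. run r f m = Some y)"
    using semi_program by blast
  obtain q where q: "\<And>f n. run q f n = None \<longleftrightarrow> (\<forall>y. \<not> G f (pr n y))"
    "\<And>f n y. run q f n = Some y \<Longrightarrow> G f (pr n y)"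
    using semi_uniformize[OF RG(2)] by blast
  obtain p where p: "computable p" "\<And>i f n. \<Phi> (p i) f n = run r f (pr i n)" using smn_theorem[of r] by blast
  obtain h where h: "computable h" "\<And>i f n. \<Phi> (h i) f n = run q f (pr i n)" using smn_theorem[of q] by blast
  have V: "f \<in> Pi01_class (p i) \<longleftrightarrow> \<not> R f i" for f i
    unfolding Pi01_class_def ce_set_def dom_def D(2)
    \<comment> \<open>As \<open>D\<close> ignores the oracle, halting of \<open>r\<close> may be
      tested with the zero oracle that \<open>ce_set\<close> prescribes.\<close>
    using r[of "pr i _" "\<lambda>_. 0"] by (auto simp: p)
  have h_total: "\<exists>g\<in>A. \<forall>n. \<Phi> (h i) f n = Some (g n)" if "f \<in> B" "\<not> R f i" for f i
  proof -
    from RG(3) that obtain g where g: "g \<in> A" "\<And>n y. G f (pr (pr i n) y) \<longleftrightarrow> g n = y"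
      unfolding red_def by blast
    have "run q f (pr i n) = Some (g n)" for n
      using q(1)[of f "pr i n"] q(2)[of f "pr i n"] g(2)[of n] by (cases "run q f (pr i n)") auto
    with g(1) h(2) show ?thesis by auto
  qed
  have "uniformly_Pi01 (\<lambda>i. Pi01_class (p i))"
    unfolding uniformly_Pi01_def using p(1) by blast
  moreover have "B \<subseteq> (\<Union>i. Pi01_class (p i))"
  proof
    fix f
    assume "f \<in> B"
    with RG(3) obtain i where "\<not> R f i" unfolding red_def by blast
    then show "f \<in> (\<Union>i. Pi01_class (p i))" using V by auto
  qed
  moreover have "\<forall>i. \<forall>f \<in> B \<inter> Pi01_class (p i). \<exists>g \<in> A. \<forall>n. \<Phi> (h i) f n = Some (g n)"
    using V h_total by simp
  ultimately show "A \<le>\<^sub>1 B"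
    using h(1) unfolding le1_def by (intro exI[of _ "\<lambda>i. Pi01_class (p i)"] exI[of _ h]) simp
qed

section \<open>Join, meet and implication of mass problems\<close>

lemma le1I: "semi R \<Longrightarrow> semi G \<Longrightarrow> red R G A B \<Longrightarrow> A \<le>\<^sub>1 B"
  using le1_iff by blast

lemma le1_eff:
  assumes "eff F" "\<And>f. f \<in> B \<Longrightarrow> F f \<in> A"
  shows "A \<le>\<^sub>1 B"
proof (rule le1I)
  show "semi (\<lambda>f m. False)" by (intro semi_dec dec_const)
  show "semi (\<lambda>f m. F f (psnd (pfst m)) = psnd m)"
    by (intro semi_dec dec_eq eff_comp[OF assms(1)] eff_basic)
  show "red (\<lambda>f m. False) (\<lambda>f m. F f (psnd (pfst m)) = psnd m) A B"
    using assms(2) unfolding red_def by auto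
qed

lemma le1_superset: "B \<subseteq> A \<Longrightarrow> A \<le>\<^sub>1 B"
  by (rule le1_eff[of "\<lambda>f n. f n"]) (auto intro: eff_basic)

lemma le1_refl: "A \<le>\<^sub>1 A"
  by (rule le1_superset) simp

text \<open>The new index is a pair: a piece for the step from \<open>C\<close> to \<open>B\<close>
  and then a piece for the step from \<open>B\<close> to \<open>A\<close>. The intermediate function
  exists only if the first piece contains \<open>f\<close>; elsewhere the disjunct \<open>R2\<close>
  already excludes the index, so the values of \<open>R\<close> and \<open>G\<close> there are
  irrelevant.\<close>

lemma le1_trans:
  assumes "A \<le>\<^sub>1 B" "B \<le>\<^sub>1 C"
  shows "A \<le>\<^sub>1 C"
proof -
  obtain R1 G1 where 1: "semi R1" "semi G1" "red R1 G1 A B" using assms(1) le1_iff by blast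
  obtain R2 G2 where 2: "semi R2" "semi G2" "red R2 G2 B C" using assms(2) le1_iff by blast
  have "semi (\<lambda>g m. R1 g (psnd m))" "semi (\<lambda>f m. G2 f (pr (pr (pfst (pfst m)) (pfst (psnd m))) (psnd (psnd m))))"
    by (intro semi_comp[OF 1(1)] semi_comp[OF 2(2)] eff_basic)+
  then obtain R where R: "semi R" "\<And>f n g. (\<And>l y. G2 f (pr (pr (pfst n) l) y) \<longleftrightarrow> g l = y) \<Longrightarrow>
      R f n \<longleftrightarrow> R1 g (psnd n)"
    by (rule semi_subst) simp
  have "semi (\<lambda>g m. G1 g (pr (pr (psnd (pfst (pfst m))) (psnd (pfst m))) (psnd m)))"
    "semi (\<lambda>f m. G2 f (pr (pr (pfst (pfst (pfst (pfst m)))) (pfst (psnd m))) (psnd (psnd m))))"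
    by (intro semi_comp[OF 1(2)] semi_comp[OF 2(2)] eff_basic)+
  then obtain G where G: "semi G" "\<And>f n g. (\<And>l y. G2 f (pr (pr (pfst (pfst (pfst n))) l) y) \<longleftrightarrow> g l = y) \<Longrightarrow>
      G f n \<longleftrightarrow> G1 g (pr (pr (psnd (pfst (pfst n))) (psnd (pfst n))) (psnd n))"
    by (rule semi_subst) simp
  show ?thesis
  proof (rule le1I)
    show "semi (\<lambda>f m. R2 f (pfst m) \<or> R f m)"
      by (intro semi_disj R(1) semi_comp[OF 2(1)] eff_basic)
    have "(\<exists>m. \<not> R2 f (pfst m) \<and> \<not> R f m) \<and> (\<forall>m. \<not> R2 f (pfst m) \<and> \<not> R f m \<longrightarrow>
        (\<exists>h\<in>A. \<forall>n y. G f (pr (pr m n) y) \<longleftrightarrow> h n = y))" if "f \<in> C" for f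
    proof -
      from that 2(3) have i: "\<exists>i. \<not> R2 f i"
        "\<And>i. \<not> R2 f i \<Longrightarrow> \<exists>g\<in>B. \<forall>n y. G2 f (pr (pr i n) y) \<longleftrightarrow> g n = y"
        unfolding red_def by blast+
      have m: "(\<exists>j. \<not> R f (pr i j)) \<and> (\<forall>j. \<not> R f (pr i j) \<longrightarrow>
        (\<exists>h\<in>A. \<forall>n y. G f (pr (pr (pr i j) n) y) \<longleftrightarrow> h n = y))" if "\<not> R2 f i" for i
      proof -
        from i(2)[OF that] obtain g where g: "g \<in> B" "\<And>n y. G2 f (pr (pr i n) y) \<longleftrightarrow> g n = y"
          by blast
        have "R f (pr i j) \<longleftrightarrow> R1 g j" for j
          using R(2)[of f "pr i j" g] g(2) by simp
        moreover have "G f (pr (pr (pr i j) n) y) \<longleftrightarrow> G1 g (pr (pr j n) y)" for j n y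
          using G(2)[of f "pr (pr (pr i j) n) y" g] g(2) by simp
        ultimately show ?thesis using g(1) 1(3) unfolding red_def by auto
      qed
      from i(1) obtain i where "\<not> R2 f i" by blast
      moreover from m[OF this] obtain j where "\<not> R f (pr i j)" by blast
      ultimately have "\<exists>m. \<not> R2 f (pfst m) \<and> \<not> R f m" by (intro exI[of _ "pr i j"]) simp
      moreover have "\<exists>h\<in>A. \<forall>n y. G f (pr (pr k n) y) \<longleftrightarrow> h n = y" if "\<not> R2 f (pfst k)" "\<not> R f k" for k
        using m[OF that(1)] that(2) by (metis pr_simps(3))
      ultimately show ?thesis by blast
    qed
    then show "red (\<lambda>f m. R2 f (pfst m) \<or> R f m) G A C"
      unfolding red_def by simp
  qed (rule G(1))
qed

section \<open>Interleaving and tagging as join and meet\<close>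

definition evens :: "(nat \<Rightarrow> nat) \<Rightarrow> nat \<Rightarrow> nat" where "evens f n = f (n + n)"
definition odds :: "(nat \<Rightarrow> nat) \<Rightarrow> nat \<Rightarrow> nat" where "odds f n = f (Suc (n + n))"
definition ileave :: "(nat \<Rightarrow> nat) \<Rightarrow> (nat \<Rightarrow> nat) \<Rightarrow> nat \<Rightarrow> nat" where
  "ileave g h n = (if even n then g (n div 2) else h (n div 2))"
definition tail :: "(nat \<Rightarrow> nat) \<Rightarrow> nat \<Rightarrow> nat" where "tail f n = f (Suc n)"
definition cons :: "nat \<Rightarrow> (nat \<Rightarrow> nat) \<Rightarrow> nat \<Rightarrow> nat" where
  "cons a f n = (case n of 0 \<Rightarrow> a | Suc k \<Rightarrow> f k)"

lemma ileave_simps [simp]: "evens (ileave g h) = g" "odds (ileave g h) = h" "ileave (evens f) (odds f) = f"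
proof -
  show "evens (ileave g h) = g" by (simp add: fun_eq_iff evens_def ileave_def mult_2[symmetric])
  show "odds (ileave g h) = h" by (simp add: fun_eq_iff odds_def ileave_def mult_2[symmetric])
  show "ileave (evens f) (odds f) = f"
    by (auto simp: fun_eq_iff ileave_def evens_def odds_def mult_2[symmetric] elim!: evenE oddE)
qed

lemma cons_simps [simp]: "cons a f 0 = a" "cons a f (Suc n) = f n" "tail (cons a f) = f" "cons (f 0) (tail f) = f"
  by (auto simp: cons_def tail_def fun_eq_iff split: nat.split)

lemma eff_half: "eff A \<Longrightarrow> eff (\<lambda>f n. A f n div 2)"
proof -
  assume "eff A"
  then have "eff (\<lambda>f n. rec_nat 0 (\<lambda>j r. if r + r = j then r else Suc r) (A f n))"
    by (intro eff_rec eff_arith dec_eq)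
  moreover have "rec_nat 0 (\<lambda>j r. if r + r = j then r else Suc r) k = k div 2" for k :: nat
    by (induction k) auto
  ultimately show ?thesis by simp
qed

lemma dec_even: "eff A \<Longrightarrow> dec (\<lambda>f n. even (A f n))"
proof -
  assume "eff A"
  then have "dec (\<lambda>f n. A f n div 2 + A f n div 2 = A f n)"
    by (intro dec_eq eff_add eff_half)
  moreover have "k div 2 + k div 2 = k \<longleftrightarrow> even k" for k :: nat by presburger
  ultimately show ?thesis by simp
qed

lemma eff_ileave:
  assumes "eff (\<lambda>f m. G f (pfst m) (psnd m))" "eff (\<lambda>f m. H f (pfst m) (psnd m))" "eff K"
  shows "eff (\<lambda>f n. ileave (G f n) (H f n) (K f n))"
proof -
  have "eff (\<lambda>f n. G f n (K f n div 2))" "eff (\<lambda>f n. H f n (K f n div 2))"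
    using eff_comp[OF assms(1), of "\<lambda>f n. pr n (K f n div 2)"]
      eff_comp[OF assms(2), of "\<lambda>f n. pr n (K f n div 2)"] assms(3)
    by (simp_all add: eff_basic eff_half)
  then show ?thesis unfolding ileave_def using assms(3) by (intro eff_if dec_even)
qed

lemma eff_cons:
  assumes "eff A" "eff (\<lambda>f m. B f (pfst m) (psnd m))" "eff K"
  shows "eff (\<lambda>f n. cons (A f n) (B f n) (K f n))"
  unfolding cons_def using assms by (intro eff_case_nat)

definition mjoin :: "(nat \<Rightarrow> nat) set \<Rightarrow> (nat \<Rightarrow> nat) set \<Rightarrow> (nat \<Rightarrow> nat) set" where
  "mjoin A B = {f. evens f \<in> A \<and> odds f \<in> B}"

definition mmeet :: "(nat \<Rightarrow> nat) set \<Rightarrow> (nat \<Rightarrow> nat) set \<Rightarrow> (nat \<Rightarrow> nat) set" where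
  "mmeet A B = {f. tail f \<in> (if f 0 = 0 then A else B)}"

lemma le1_mjoin1: "A \<le>\<^sub>1 mjoin A B"
proof (rule le1_eff[of evens])
  show "eff evens" unfolding evens_def[abs_def] by (intro eff_arith)
qed (simp add: mjoin_def)

lemma le1_mjoin2: "B \<le>\<^sub>1 mjoin A B"
proof (rule le1_eff[of odds])
  show "eff odds" unfolding odds_def[abs_def] by (intro eff_arith)
qed (simp add: mjoin_def)

lemma mjoin_least:
  assumes "A \<le>\<^sub>1 C" "B \<le>\<^sub>1 C"
  shows "mjoin A B \<le>\<^sub>1 C"
proof -
  obtain R1 G1 where 1: "semi R1" "semi G1" "red R1 G1 A C" using assms(1) le1_iff by blast
  obtain R2 G2 where 2: "semi R2" "semi G2" "red R2 G2 B C" using assms(2) le1_iff by blast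
  let ?R = "\<lambda>f i. R1 f (pfst i) \<or> R2 f (psnd i)"
  let ?G = "\<lambda>f m. even (psnd (pfst m)) \<and> G1 f (pr (pr (pfst (pfst (pfst m))) (psnd (pfst m) div 2)) (psnd m)) \<or>
     odd (psnd (pfst m)) \<and> G2 f (pr (pr (psnd (pfst (pfst m))) (psnd (pfst m) div 2)) (psnd m))"
  show ?thesis
  proof (rule le1I)
    show "semi ?R" by (intro semi_disj semi_comp[OF 1(1)] semi_comp[OF 2(1)] eff_basic)
    show "semi ?G"
      by (intro semi_disj semi_conj semi_comp[OF 1(2)] semi_comp[OF 2(2)])
        (intro semi_dec dec_not dec_even eff_basic eff_half)+
    show "red ?R ?G (mjoin A B) C" unfolding red_def
    proof (intro ballI HOL.conjI allI impI)
      fix f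
      assume f: "f \<in> C"
      with 1(3) 2(3) obtain i j where "\<not> R1 f i" "\<not> R2 f j" unfolding red_def by blast
      then show "\<exists>k. \<not> (R1 f (pfst k) \<or> R2 f (psnd k))" by (intro exI[of _ "pr i j"]) simp
      fix k
      assume "\<not> (R1 f (pfst k) \<or> R2 f (psnd k))"
      with f 1(3) 2(3) obtain g h where "g \<in> A" "\<forall>n y. G1 f (pr (pr (pfst k) n) y) \<longleftrightarrow> g n = y"
        "h \<in> B" "\<forall>n y. G2 f (pr (pr (psnd k) n) y) \<longleftrightarrow> h n = y"
        unfolding red_def by blast
      then show "\<exists>g\<in>mjoin A B. \<forall>n y. ?G f (pr (pr k n) y) \<longleftrightarrow> g n = y"
        by (intro bexI[of _ "ileave g h"]) (auto simp: mjoin_def ileave_def)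
    qed
  qed
qed

lemma mmeet_le1_1: "mmeet A B \<le>\<^sub>1 A"
  by (rule le1_eff[of "cons 0"]) (auto simp: mmeet_def intro!: eff_cons eff_basic)

lemma mmeet_le1_2: "mmeet A B \<le>\<^sub>1 B"
  by (rule le1_eff[of "cons 1"]) (auto simp: mmeet_def intro!: eff_cons eff_basic)

lemma mmeet_greatest:
  assumes "C \<le>\<^sub>1 A" "C \<le>\<^sub>1 B"
  shows "C \<le>\<^sub>1 mmeet A B"
proof -
  obtain R1 G1 where 1: "semi R1" "semi G1" "red R1 G1 C A" using assms(1) le1_iff by blast
  obtain R2 G2 where 2: "semi R2" "semi G2" "red R2 G2 C B" using assms(2) le1_iff by blast
  have tl: "eff (\<lambda>f m. tail f (psnd m))" unfolding tail_def by (intro eff_basic)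
  have case0: "semi (\<lambda>f m. f 0 = 0 \<and> P (tail f) m \<or> f 0 \<noteq> 0 \<and> Q (tail f) m)"
    if "semi P" "semi Q" for P Q
    by (intro semi_disj semi_conj semi_oracle[OF that(1)] semi_oracle[OF that(2)] tl)
      (intro semi_dec dec_not dec_eq eff_basic)+
  show ?thesis
  proof (rule le1I)
    show "semi (\<lambda>f m. f 0 = 0 \<and> R1 (tail f) m \<or> f 0 \<noteq> 0 \<and> R2 (tail f) m)"
      using 1(1) 2(1) by (rule case0)
    show "semi (\<lambda>f m. f 0 = 0 \<and> G1 (tail f) m \<or> f 0 \<noteq> 0 \<and> G2 (tail f) m)"
      using 1(2) 2(2) by (rule case0)
    show "red (\<lambda>f m. f 0 = 0 \<and> R1 (tail f) m \<or> f 0 \<noteq> 0 \<and> R2 (tail f) m)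
      (\<lambda>f m. f 0 = 0 \<and> G1 (tail f) m \<or> f 0 \<noteq> 0 \<and> G2 (tail f) m) C (mmeet A B)"
      using 1(3) 2(3) unfolding red_def mmeet_def by (auto split: if_splits)
  qed
qed

section \<open>Implication\<close>

definition halts :: "nat \<Rightarrow> (nat \<Rightarrow> nat) \<Rightarrow> nat \<Rightarrow> bool" where
  "halts e f n \<longleftrightarrow> (\<exists>y. run (prog_of_nat e) f n = Some y)"

text \<open>The first value of an element is a pair of programs for the two relations of a reduction.\<close>

definition mimp :: "(nat \<Rightarrow> nat) set \<Rightarrow> (nat \<Rightarrow> nat) set \<Rightarrow> (nat \<Rightarrow> nat) set" where
  "mimp A B = {f. red (halts (pfst (f 0))) (halts (psnd (f 0))) B (mjoin A {tail f})}"

lemma semi_halts: "semi R \<Longrightarrow> \<exists>e. halts e = R"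
proof -
  assume "semi R"
  then obtain r where "\<And>f n. R f n \<longleftrightarrow> (\<exists>y. run r f n = Some y)" using semi_program by blast
  then show ?thesis by (intro exI[of _ "nat_of_prog r"]) (auto simp: halts_def fun_eq_iff)
qed

lemma le1_mjoin_mimp: "B \<le>\<^sub>1 mjoin A (mimp A B)"
proof (rule le1I)
  \<comment> \<open>Removes the programs from the second half. What remains is the input in
    \<open>mjoin A {tail (odds f)}\<close> on which the coded reduction is promised to work.\<close>
  let ?o = "\<lambda>f. ileave (evens f) (tail (odds f))"
  have o: "eff (\<lambda>f m. ?o f (psnd m))"
    unfolding evens_def odds_def tail_def by (intro eff_ileave eff_arith)
  have semi: "semi (\<lambda>f n. halts (E f) (?o f) n)" if "eff (\<lambda>f n. E f)" for E
    unfolding halts_def by (intro semi_ex semi_run o that eff_basic)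
  have e: "eff (\<lambda>f n. pfst (odds f 0))" "eff (\<lambda>f n. psnd (odds f 0))"
    unfolding odds_def by (intro eff_arith)+
  from semi[OF e(1)] semi[OF e(2)]
  show "semi (\<lambda>f n. halts (pfst (odds f 0)) (?o f) n)" "semi (\<lambda>f n. halts (psnd (odds f 0)) (?o f) n)" .
  show "red (\<lambda>f n. halts (pfst (odds f 0)) (?o f) n) (\<lambda>f n. halts (psnd (odds f 0)) (?o f) n) B (mjoin A (mimp A B))"
    unfolding red_def
  proof
    fix f
    assume "f \<in> mjoin A (mimp A B)"
    then have "red (halts (pfst (odds f 0))) (halts (psnd (odds f 0))) B (mjoin A {tail (odds f)})"
      "?o f \<in> mjoin A {tail (odds f)}"
      by (simp_all add: mjoin_def mimp_def)
    then show "(\<exists>i. \<not> halts (pfst (odds f 0)) (?o f) i) \<and> (\<forall>i. \<not> halts (pfst (odds f 0)) (?o f) i \<longrightarrow>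
       (\<exists>g\<in>B. \<forall>n y. halts (psnd (odds f 0)) (?o f) (pr (pr i n) y) = (g n = y)))"
      unfolding red_def by blast
  qed
qed

text \<open>From right to left a fixed reduction is merely quoted: its two programs are put in front
  of every element of \<open>C\<close>. This step is uniform although the quoted reduction need not
  be.\<close>

lemma mimp_adjoint: "mimp A B \<le>\<^sub>1 C \<longleftrightarrow> B \<le>\<^sub>1 mjoin A C"
proof
  assume "mimp A B \<le>\<^sub>1 C"
  then have "mjoin A (mimp A B) \<le>\<^sub>1 mjoin A C"
    by (intro mjoin_least le1_mjoin1) (rule le1_trans[OF _ le1_mjoin2])
  then show "B \<le>\<^sub>1 mjoin A C" using le1_mjoin_mimp le1_trans by blast
next
  assume "B \<le>\<^sub>1 mjoin A C"
  then obtain R G where RG: "semi R" "semi G" "red R G B (mjoin A C)" using le1_iff by blast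
  then obtain r q where rq: "halts r = R" "halts q = G" using semi_halts by metis
  show "mimp A B \<le>\<^sub>1 C"
  proof (rule le1_eff[of "cons (pr r q)"])
    fix f
    assume "f \<in> C"
    with RG(3) show "cons (pr r q) f \<in> mimp A B"
      unfolding mimp_def red_def mjoin_def by (simp add: rq)
  qed (intro eff_cons eff_basic)
qed

section \<open>The Brouwer algebra and soundness\<close>

definition deg :: "(nat \<Rightarrow> nat) set \<Rightarrow> (nat \<Rightarrow> nat) set set" where
  "deg A = equiv1 `` {A}"

lemma deg_iff: "B \<in> deg A \<longleftrightarrow> A \<le>\<^sub>1 B \<and> B \<le>\<^sub>1 A"
  by (simp add: deg_def equiv1_def)

lemma deg_eq_iff: "deg A = deg B \<longleftrightarrow> A \<le>\<^sub>1 B \<and> B \<le>\<^sub>1 A"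
  using le1_refl le1_trans unfolding set_eq_iff deg_iff by blast

lemma carrier_M1: "carrier \<M>\<^sub>1 = range deg"
  by (auto simp: M1_def quotient_def deg_def)

lemma deg_carrier [simp]: "deg A \<in> carrier \<M>\<^sub>1"
  by (simp add: carrier_M1)

lemma le_M1 [simp]: "deg A \<sqsubseteq>\<^bsub>\<M>\<^sub>1\<^esub> deg B \<longleftrightarrow> A \<le>\<^sub>1 B"
proof -
  have "(\<exists>X\<in>deg A. \<exists>Y\<in>deg B. X \<le>\<^sub>1 Y) \<longleftrightarrow> A \<le>\<^sub>1 B"
    unfolding Bex_def deg_iff using le1_refl le1_trans by meson
  then show ?thesis by (simp add: M1_def)
qed

text \<open>The bounds of a \<open>gorder\<close> are picked by choice; antisymmetry on degrees
  makes the choice unique. The next lemma is the dual.\<close>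

lemma least_M1: "least \<M>\<^sub>1 (deg C) S \<Longrightarrow> (SOME x. least \<M>\<^sub>1 x S) = deg C"
proof (rule some_equality)
  fix x
  assume *: "least \<M>\<^sub>1 (deg C) S" "least \<M>\<^sub>1 x S"
  then obtain D where "x = deg D" by (auto simp: least_def carrier_M1)
  with * show "x = deg C" by (auto simp: least_def deg_eq_iff)
qed

lemma greatest_M1: "greatest \<M>\<^sub>1 (deg C) S \<Longrightarrow> (SOME x. greatest \<M>\<^sub>1 x S) = deg C"
proof (rule some_equality)
  fix x
  assume *: "greatest \<M>\<^sub>1 (deg C) S" "greatest \<M>\<^sub>1 x S"
  then obtain D where "x = deg D" by (auto simp: greatest_def carrier_M1)
  with * show "x = deg C" by (auto simp: greatest_def deg_eq_iff)
qed

lemma join_M1: "deg A \<squnion>\<^bsub>\<M>\<^sub>1\<^esub> deg B = deg (mjoin A B)"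
proof -
  have "Upper \<M>\<^sub>1 {deg A, deg B} = deg ` {C. A \<le>\<^sub>1 C \<and> B \<le>\<^sub>1 C}"
    unfolding Upper_def carrier_M1 by auto
  then have "least \<M>\<^sub>1 (deg (mjoin A B)) (Upper \<M>\<^sub>1 {deg A, deg B})"
    using le1_mjoin1 le1_mjoin2 mjoin_least by (simp add: least_def image_subset_iff)
  then show ?thesis
    unfolding join_def Lattice.sup_def by (rule least_M1)
qed

lemma meet_M1: "deg A \<sqinter>\<^bsub>\<M>\<^sub>1\<^esub> deg B = deg (mmeet A B)"
proof -
  have "Lower \<M>\<^sub>1 {deg A, deg B} = deg ` {C. C \<le>\<^sub>1 A \<and> C \<le>\<^sub>1 B}"
    unfolding Lower_def carrier_M1 by auto
  then have "greatest \<M>\<^sub>1 (deg (mmeet A B)) (Lower \<M>\<^sub>1 {deg A, deg B})"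
    using mmeet_le1_1 mmeet_le1_2 mmeet_greatest by (simp add: greatest_def image_subset_iff)
  then show ?thesis
    unfolding meet_def Lattice.inf_def by (rule greatest_M1)
qed

lemma bottom_M1: "\<bottom>\<^bsub>\<M>\<^sub>1\<^esub> = deg UNIV"
  unfolding bottom_def by (rule least_M1) (auto simp: least_def carrier_M1 le1_superset)

lemma top_M1: "\<top>\<^bsub>\<M>\<^sub>1\<^esub> = deg {}"
  unfolding top_def by (rule greatest_M1) (auto simp: greatest_def carrier_M1 le1_superset)

lemma imp_M1: "brouwer_imp \<M>\<^sub>1 (deg A) (deg B) = deg (mimp A B)"
  unfolding brouwer_imp_def
proof (rule the_equality)
  show "deg (mimp A B) \<in> carrier \<M>\<^sub>1 \<and>
    (\<forall>c\<in>carrier \<M>\<^sub>1. deg B \<sqsubseteq>\<^bsub>\<M>\<^sub>1\<^esub> deg A \<squnion>\<^bsub>\<M>\<^sub>1\<^esub> c \<longleftrightarrow> deg (mimp A B) \<sqsubseteq>\<^bsub>\<M>\<^sub>1\<^esub> c)"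
    by (auto simp: carrier_M1 join_M1 mimp_adjoint)
next
  fix d
  assume d: "d \<in> carrier \<M>\<^sub>1 \<and>
    (\<forall>c\<in>carrier \<M>\<^sub>1. deg B \<sqsubseteq>\<^bsub>\<M>\<^sub>1\<^esub> deg A \<squnion>\<^bsub>\<M>\<^sub>1\<^esub> c \<longleftrightarrow> d \<sqsubseteq>\<^bsub>\<M>\<^sub>1\<^esub> c)"
  then obtain D where D: "d = deg D" by (auto simp: carrier_M1)
  with d have "mimp A B \<le>\<^sub>1 C \<longleftrightarrow> D \<le>\<^sub>1 C" for C
    by (auto simp: carrier_M1 join_M1 mimp_adjoint)
  then show "d = deg (mimp A B)" unfolding D deg_eq_iff using le1_refl by blast
qed

primrec eval_form :: "(nat \<Rightarrow> (nat \<Rightarrow> nat) set) \<Rightarrow> form \<Rightarrow> (nat \<Rightarrow> nat) set" where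
  "eval_form V (Var p) = V p"
| "eval_form V (Conj \<phi> \<psi>) = mjoin (eval_form V \<phi>) (eval_form V \<psi>)"
| "eval_form V (Disj \<phi> \<psi>) = mmeet (eval_form V \<phi>) (eval_form V \<psi>)"
| "eval_form V (Impl \<phi> \<psi>) = mimp (eval_form V \<phi>) (eval_form V \<psi>)"
| "eval_form V (Neg \<phi>) = mimp (eval_form V \<phi>) {}"

lemma interp_M1: "interp \<M>\<^sub>1 (\<lambda>p. deg (V p)) \<phi> = deg (eval_form V \<phi>)"
  by (induction \<phi>) (simp_all add: join_M1 meet_M1 imp_M1 top_M1)

lemma Th_M1_iff: "\<phi> \<in> Th \<M>\<^sub>1 \<longleftrightarrow> (\<forall>V. eval_form V \<phi> \<le>\<^sub>1 UNIV)"
proof -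
  have bot: "interp \<M>\<^sub>1 (\<lambda>p. deg (V p)) \<phi> = \<bottom>\<^bsub>\<M>\<^sub>1\<^esub> \<longleftrightarrow> eval_form V \<phi> \<le>\<^sub>1 UNIV" for V
    by (simp add: interp_M1 bottom_M1 deg_eq_iff le1_superset)
  show ?thesis
  proof
    assume "\<phi> \<in> Th \<M>\<^sub>1"
    then have "interp \<M>\<^sub>1 (\<lambda>p. deg (V p)) \<phi> = \<bottom>\<^bsub>\<M>\<^sub>1\<^esub>" for V
      by (simp add: Th_def image_subset_iff)
    then show "\<forall>V. eval_form V \<phi> \<le>\<^sub>1 UNIV" by (simp add: bot)
  next
    assume *: "\<forall>V. eval_form V \<phi> \<le>\<^sub>1 UNIV"
    have "interp \<M>\<^sub>1 v \<phi> = \<bottom>\<^bsub>\<M>\<^sub>1\<^esub>" if "range v \<subseteq> carrier \<M>\<^sub>1" for v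
    proof -
      from that have "\<forall>p. \<exists>A. v p = deg A" by (auto simp: carrier_M1)
      then obtain V where "v = (\<lambda>p. deg (V p))" by (metis ext)
      then show ?thesis using * by (simp add: bot)
    qed
    then show "\<phi> \<in> Th \<M>\<^sub>1" by (simp add: Th_def)
  qed
qed

lemma mimp_true: "mimp A B \<le>\<^sub>1 UNIV \<longleftrightarrow> B \<le>\<^sub>1 A"
proof -
  have "mjoin A UNIV \<le>\<^sub>1 A" by (intro mjoin_least le1_refl le1_superset) simp
  then show ?thesis unfolding mimp_adjoint using le1_mjoin1 le1_trans by blast
qed

lemma mimp_mp: "A \<le>\<^sub>1 Z \<Longrightarrow> mimp A B \<le>\<^sub>1 Z \<Longrightarrow> B \<le>\<^sub>1 Z"
  using mimp_adjoint le1_trans mjoin_least le1_refl by blast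

lemma empty_le1: "{} \<le>\<^sub>1 X \<longleftrightarrow> X = {}"
proof
  assume "{} \<le>\<^sub>1 X"
  then show "X = {}" unfolding le1_def by auto
qed (simp add: le1_refl)

lemma mjoin_empty: "mjoin A B = {} \<longleftrightarrow> A = {} \<or> B = {}"
proof
  show "A = {} \<or> B = {}" if "mjoin A B = {}"
  proof (rule ccontr)
    assume "\<not> (A = {} \<or> B = {})"
    then obtain g h where "g \<in> A" "h \<in> B" by blast
    then have "ileave g h \<in> mjoin A B" by (simp add: mjoin_def)
    with that show False by simp
  qed
qed (auto simp: mjoin_def)

text \<open>Distributivity comes from the adjunction: \<open>mimp W X\<close> lies below
  \<open>A\<close> and below \<open>B\<close>, hence below their meet.\<close>

lemma mjoin_mmeet_distrib:
  assumes "X \<le>\<^sub>1 mjoin A W" "X \<le>\<^sub>1 mjoin B W"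
  shows "X \<le>\<^sub>1 mjoin (mmeet A B) W"
proof -
  have comm: "mjoin P Q \<le>\<^sub>1 mjoin Q P" for P Q by (intro mjoin_least le1_mjoin1 le1_mjoin2)
  then have "mimp W X \<le>\<^sub>1 A" "mimp W X \<le>\<^sub>1 B"
    unfolding mimp_adjoint using assms le1_trans by blast+
  then have "X \<le>\<^sub>1 mjoin W (mmeet A B)"
    unfolding mimp_adjoint[symmetric] by (rule mmeet_greatest)
  then show ?thesis using comm le1_trans by blast
qed

lemma wlem_true: "mmeet (mimp A {}) (mimp (mimp A {}) {}) \<le>\<^sub>1 UNIV"
proof (cases "A = {}")
  case True
  then have "mimp A {} \<le>\<^sub>1 UNIV" by (simp add: mimp_true le1_refl)
  then show ?thesis using mmeet_le1_1 le1_trans by blast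
next
  case False
  have "{} \<le>\<^sub>1 mjoin A (mimp A {})" by (simp add: mimp_adjoint[symmetric] le1_refl)
  with False have "mimp A {} = {}" by (simp add: empty_le1 mjoin_empty)
  then have "mimp (mimp A {}) {} \<le>\<^sub>1 UNIV" by (simp add: mimp_true le1_refl)
  then show ?thesis using mmeet_le1_2 le1_trans by blast
qed

lemma Jan_sound: "\<phi> \<in> Jan \<Longrightarrow> eval_form V \<phi> \<le>\<^sub>1 UNIV"
  unfolding Jan_def
proof (induction rule: IPC_closure.induct)
  case (hyp \<phi>)
  then show ?case by (auto simp: wlem_true)
next
  case (K \<phi> \<psi>)
  \<comment> \<open>Two passes, because \<open>mimp_adjoint\<close> would also match the outermost
    implication, which is to be read by \<open>mimp_true\<close>. The other axioms with nested
    implications are treated in the same way.\<close>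
  show ?case by (simp add: mimp_true, simp add: mimp_adjoint le1_mjoin2)
next
  case (S \<phi> \<psi> \<chi>)
  let ?X = "mimp (eval_form V \<phi>) (mimp (eval_form V \<psi>) (eval_form V \<chi>))" and ?Y = "mimp (eval_form V \<phi>) (eval_form V \<psi>)"
  let ?Z = "mjoin (eval_form V \<phi>) (mjoin ?Y ?X)"
  have *: "eval_form V \<phi> \<le>\<^sub>1 ?Z" "?X \<le>\<^sub>1 ?Z" "?Y \<le>\<^sub>1 ?Z"
    by (rule le1_mjoin1 le1_trans[OF le1_mjoin1 le1_mjoin2] le1_trans[OF le1_mjoin2 le1_mjoin2])+
  have "eval_form V \<chi> \<le>\<^sub>1 ?Z"
    by (rule mimp_mp[OF mimp_mp[OF *(1,3)] mimp_mp[OF *(1,2)]])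
  then show ?case by (simp add: mimp_true, simp add: mimp_adjoint)
next
  case (conjE1 \<phi> \<psi>)
  show ?case by (simp add: mimp_true le1_mjoin1)
next
  case (conjE2 \<phi> \<psi>)
  show ?case by (simp add: mimp_true le1_mjoin2)
next
  case (conjI \<phi> \<psi>)
  show ?case by (simp add: mimp_true, simp add: mimp_adjoint) (intro mjoin_least le1_mjoin1 le1_mjoin2)
next
  case (disjI1 \<phi> \<psi>)
  show ?case by (simp add: mimp_true mmeet_le1_1)
next
  case (disjI2 \<psi> \<phi>)
  show ?case by (simp add: mimp_true mmeet_le1_2)
next
  case (disjE \<phi> \<chi> \<psi>)
  let ?X = "mimp (eval_form V \<phi>) (eval_form V \<chi>)" and ?Y = "mimp (eval_form V \<psi>) (eval_form V \<chi>)"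
  have "eval_form V \<chi> \<le>\<^sub>1 mjoin (eval_form V \<phi>) (mjoin ?Y ?X)" "eval_form V \<chi> \<le>\<^sub>1 mjoin (eval_form V \<psi>) (mjoin ?Y ?X)"
    by (rule mimp_mp[OF le1_mjoin1 le1_trans[OF le1_mjoin2 le1_mjoin2]] mimp_mp[OF le1_mjoin1 le1_trans[OF le1_mjoin1 le1_mjoin2]])+
  then show ?case by (simp add: mimp_true, simp add: mimp_adjoint mjoin_mmeet_distrib)
next
  case (negI \<phi> \<psi>)
  let ?X = "mimp (eval_form V \<phi>) (eval_form V \<psi>)" and ?Y = "mimp (eval_form V \<phi>) (mimp (eval_form V \<psi>) {})"
  let ?Z = "mjoin (eval_form V \<phi>) (mjoin ?Y ?X)"
  have *: "eval_form V \<phi> \<le>\<^sub>1 ?Z" "?X \<le>\<^sub>1 ?Z" "?Y \<le>\<^sub>1 ?Z"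
    by (rule le1_mjoin1 le1_trans[OF le1_mjoin1 le1_mjoin2] le1_trans[OF le1_mjoin2 le1_mjoin2])+
  have "{} \<le>\<^sub>1 ?Z"
    by (rule mimp_mp[OF mimp_mp[OF *(1,2)] mimp_mp[OF *(1,3)]])
  then show ?case by (simp add: mimp_true, simp add: mimp_adjoint)
next
  case (negE \<phi> \<psi>)
  let ?Z = "mjoin (eval_form V \<phi>) (mimp (eval_form V \<phi>) {})"
  have "{} \<le>\<^sub>1 ?Z" by (rule mimp_mp[OF le1_mjoin1 le1_mjoin2])
  then have "eval_form V \<psi> \<le>\<^sub>1 ?Z" by (simp add: empty_le1 le1_superset)
  then show ?case by (simp add: mimp_true, simp add: mimp_adjoint)
next
  case (mp \<phi> \<psi>)
  then have "mimp (eval_form V \<phi>) (eval_form V \<psi>) \<le>\<^sub>1 UNIV" "eval_form V \<phi> \<le>\<^sub>1 UNIV" by simp_all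
  then show ?case using mimp_mp by blast
qed

corollary Jan_subset_Th: "Jan \<subseteq> Th \<M>\<^sub>1"
  using Jan_sound Th_M1_iff by blast

section \<open>Finite Kripke models for the logic\<close>

definition WLEM :: "form set" where
  "WLEM = {Disj (Neg \<phi>) (Neg (Neg \<phi>)) | \<phi>. True}"

text \<open>Hypotheses are added as axioms. Modus ponens is the only rule, so the deduction theorem
  holds for them.\<close>

abbreviation pv :: "form set \<Rightarrow> form \<Rightarrow> bool" (infix \<open>\<turnstile>\<close> 50) where
  "\<Gamma> \<turnstile> \<phi> \<equiv> \<phi> \<in> IPC_closure (WLEM \<union> \<Gamma>)"

lemmas IPC_axioms = IPC_closure.K IPC_closure.S IPC_closure.conjE1 IPC_closure.conjE2 IPC_closure.conjI
  IPC_closure.disjI1 IPC_closure.disjI2 IPC_closure.disjE IPC_closure.negI IPC_closure.negE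

lemma pv_hyp: "\<phi> \<in> \<Gamma> \<Longrightarrow> \<Gamma> \<turnstile> \<phi>"
  by (simp add: IPC_closure.hyp)

lemma pv_wlem: "\<Gamma> \<turnstile> Disj (Neg \<phi>) (Neg (Neg \<phi>))"
  by (rule IPC_closure.hyp) (auto simp: WLEM_def)

lemma pv_mono: "\<Gamma> \<turnstile> \<phi> \<Longrightarrow> \<Gamma> \<subseteq> \<Delta> \<Longrightarrow> \<Delta> \<turnstile> \<phi>"
proof (induction rule: IPC_closure.induct)
  case (hyp \<phi>)
  then show ?case by (intro IPC_closure.hyp) blast
next
  case (mp \<phi> \<psi>)
  then show ?case using IPC_closure.mp by blast
qed (rule IPC_axioms)+

lemma pv_refl: "\<Gamma> \<turnstile> Impl \<phi> \<phi>"
proof -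
  have "\<Gamma> \<turnstile> Impl (Impl \<phi> (Impl (Impl \<phi> \<phi>) \<phi>)) (Impl (Impl \<phi> (Impl \<phi> \<phi>)) (Impl \<phi> \<phi>))"
    by (rule IPC_closure.S)
  from IPC_closure.mp[OF IPC_closure.mp[OF this IPC_closure.K] IPC_closure.K] show ?thesis .
qed

lemma pv_weaken: "\<Gamma> \<turnstile> \<psi> \<Longrightarrow> \<Gamma> \<turnstile> Impl \<phi> \<psi>"
  by (rule IPC_closure.mp[OF IPC_closure.K])

lemma pv_deduction: "insert \<phi> \<Gamma> \<turnstile> \<psi> \<Longrightarrow> \<Gamma> \<turnstile> Impl \<phi> \<psi>"
proof (induction rule: IPC_closure.induct)
  case (hyp \<psi>)
  then show ?case by (auto intro: pv_refl pv_weaken IPC_closure.hyp)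
next
  case (mp \<psi> \<chi>)
  have "\<Gamma> \<turnstile> Impl (Impl \<phi> (Impl \<psi> \<chi>)) (Impl (Impl \<phi> \<psi>) (Impl \<phi> \<chi>))"
    by (rule IPC_closure.S)
  from IPC_closure.mp[OF IPC_closure.mp[OF this mp.IH(1)] mp.IH(2)] show ?case .
qed (rule pv_weaken, rule IPC_axioms)+

text \<open>Compactness in the form needed for Zorn's lemma: at modus ponens, the larger of two
  members of the chain proves both premises.\<close>

lemma pv_chain:
  assumes "\<Union>C \<turnstile> \<phi>" "C \<noteq> {}" "\<And>X Y. X \<in> C \<Longrightarrow> Y \<in> C \<Longrightarrow> X \<subseteq> Y \<or> Y \<subseteq> X"
  shows "\<exists>X\<in>C. X \<turnstile> \<phi>"
proof -
  obtain X0 where X0: "X0 \<in> C" using assms(2) by blast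
  show ?thesis
    using assms(1)
  proof (induction rule: IPC_closure.induct)
    case (hyp \<phi>)
    then consider "\<phi> \<in> WLEM" | X where "X \<in> C" "\<phi> \<in> X" by blast
    then show ?case
    proof cases
      case 1
      with X0 show ?thesis using IPC_closure.hyp by blast
    next
      case 2
      then show ?thesis using pv_hyp by blast
    qed
  next
    case (mp \<phi> \<psi>)
    then obtain X Y where XY: "X \<in> C" "Y \<in> C" "X \<turnstile> Impl \<phi> \<psi>" "Y \<turnstile> \<phi>" by blast
    then obtain Z where "Z \<in> C" "X \<subseteq> Z" "Y \<subseteq> Z" using assms(3)[of X Y] by blast
    with XY show ?case using pv_mono IPC_closure.mp by meson
  qed (rule bexI[OF _ X0], rule IPC_axioms)+
qed

section \<open>Prime theories\<close>

definition prime_theory :: "form set \<Rightarrow> bool" where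
  "prime_theory v \<longleftrightarrow> (\<forall>\<phi>. v \<turnstile> \<phi> \<longrightarrow> \<phi> \<in> v) \<and>
     (\<forall>\<phi> \<psi>. Disj \<phi> \<psi> \<in> v \<longrightarrow> \<phi> \<in> v \<or> \<psi> \<in> v) \<and> v \<noteq> UNIV"

text \<open>A maximal set not proving \<open>\<chi>\<close> is prime by the elimination axiom for
  disjunction. The last conclusion records the maximality: for \<open>falsum\<close> it says that
  \<open>v\<close> refutes every formula outside it, which yields the greatest world.\<close>

lemma lindenbaum:
  assumes "\<not> \<Gamma> \<turnstile> \<chi>"
  obtains v where "\<Gamma> \<subseteq> v" "prime_theory v" "\<chi> \<notin> v" "\<And>\<phi>. \<phi> \<notin> v \<Longrightarrow> v \<turnstile> Impl \<phi> \<chi>"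
proof -
  let ?A = "{X. \<Gamma> \<subseteq> X \<and> \<not> X \<turnstile> \<chi>}"
  have "\<exists>M\<in>?A. \<forall>X\<in>?A. M \<subseteq> X \<longrightarrow> X = M"
  proof (rule subset_Zorn_nonempty)
    show "?A \<noteq> {}" using assms by blast
    fix C
    assume C: "C \<noteq> {}" "subset.chain ?A C"
    then have "X \<in> C \<Longrightarrow> Y \<in> C \<Longrightarrow> X \<subseteq> Y \<or> Y \<subseteq> X" for X Y
      by (auto simp: subset_chain_def)
    with C pv_chain[of \<chi> C] show "\<Union>C \<in> ?A"
      by (auto simp: subset_chain_def)
  qed
  then obtain M where "M \<in> ?A" and M_max: "\<forall>X\<in>?A. M \<subseteq> X \<longrightarrow> X = M" ..
  then have M: "\<Gamma> \<subseteq> M" "\<not> M \<turnstile> \<chi>" by simp_all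
  have max: "M \<turnstile> Impl \<phi> \<chi>" if "\<phi> \<notin> M" for \<phi>
  proof (rule ccontr)
    assume "\<not> M \<turnstile> Impl \<phi> \<chi>"
    then have "\<not> insert \<phi> M \<turnstile> \<chi>" using pv_deduction by blast
    with M(1) have "insert \<phi> M \<in> ?A" by simp blast
    with M_max have "insert \<phi> M = M" by blast
    with that show False by blast
  qed
  show thesis
  proof (rule that)
    show "\<chi> \<notin> M" using M(2) pv_hyp by blast
    have closed: "\<phi> \<in> M" if "M \<turnstile> \<phi>" for \<phi>
    proof (rule ccontr)
      assume "\<phi> \<notin> M"
      then show False using IPC_closure.mp[OF max that] M(2) by blast
    qed
    moreover have "\<phi> \<in> M \<or> \<psi> \<in> M" if "Disj \<phi> \<psi> \<in> M" for \<phi> \<psi>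
    proof (rule ccontr)
      assume "\<not> (\<phi> \<in> M \<or> \<psi> \<in> M)"
      then have "M \<turnstile> Impl \<phi> \<chi>" "M \<turnstile> Impl \<psi> \<chi>" using max by auto
      then have "M \<turnstile> Impl (Disj \<phi> \<psi>) \<chi>"
        by (rule IPC_closure.mp[OF IPC_closure.mp[OF IPC_closure.disjE]])
      from IPC_closure.mp[OF this pv_hyp[OF that]] M(2) show False by blast
    qed
    ultimately show "prime_theory M"
      using \<open>\<chi> \<notin> M\<close> by (auto simp: prime_theory_def)
  qed (use M max in auto)
qed

lemma prime_theory_pv: "prime_theory v \<Longrightarrow> v \<turnstile> \<phi> \<Longrightarrow> \<phi> \<in> v"
  by (simp add: prime_theory_def)

lemma prime_theory_mp:
  assumes "prime_theory v" "Impl \<phi> \<psi> \<in> v" "\<phi> \<in> v"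
  shows "\<psi> \<in> v"
  using assms(1) IPC_closure.mp[OF pv_hyp[OF assms(2)] pv_hyp[OF assms(3)]] by (rule prime_theory_pv)

lemma prime_theory_Conj:
  assumes "prime_theory v"
  shows "Conj \<phi> \<psi> \<in> v \<longleftrightarrow> \<phi> \<in> v \<and> \<psi> \<in> v"
  using prime_theory_mp[OF assms prime_theory_pv[OF assms IPC_closure.conjE1]]
    prime_theory_mp[OF assms prime_theory_pv[OF assms IPC_closure.conjE2]]
    prime_theory_mp[OF assms prime_theory_mp[OF assms prime_theory_pv[OF assms IPC_closure.conjI]]]
  by metis

lemma prime_theory_Disj:
  assumes "prime_theory v"
  shows "Disj \<phi> \<psi> \<in> v \<longleftrightarrow> \<phi> \<in> v \<or> \<psi> \<in> v"
  using prime_theory_mp[OF assms prime_theory_pv[OF assms IPC_closure.disjI1]]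
    prime_theory_mp[OF assms prime_theory_pv[OF assms IPC_closure.disjI2]] assms
  unfolding prime_theory_def by metis

lemma prime_theory_Neg:
  assumes "prime_theory v" "\<phi> \<in> v"
  shows "Neg \<phi> \<notin> v"
proof
  assume "Neg \<phi> \<in> v"
  then have "\<psi> \<in> v" for \<psi>
    by (rule prime_theory_mp[OF assms(1) prime_theory_mp[OF assms(1) prime_theory_pv[OF assms(1) IPC_closure.negE]] assms(2)])
  with assms(1) show False by (auto simp: prime_theory_def)
qed

lemma pv_NegI:
  assumes "\<Gamma> \<turnstile> Impl \<phi> \<psi>" "\<Gamma> \<turnstile> Impl \<phi> (Neg \<psi>)"
  shows "\<Gamma> \<turnstile> Neg \<phi>"
  by (rule IPC_closure.mp[OF IPC_closure.mp[OF IPC_closure.negI assms(1)] assms(2)])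

text \<open>The language has no constant for falsity; the negation of a theorem takes its
  place.\<close>

definition falsum :: form where "falsum = Neg (Impl (Var 0) (Var 0))"

lemma pv_not_falsum: "\<Gamma> \<turnstile> Neg falsum"
  unfolding falsum_def by (rule pv_NegI[OF _ pv_refl]) (intro pv_weaken pv_refl)

lemma pv_Neg_falsum: "\<Gamma> \<turnstile> Impl \<phi> falsum \<Longrightarrow> \<Gamma> \<turnstile> Neg \<phi>"
  by (rule pv_NegI[OF _ pv_weaken[OF pv_not_falsum]])

lemma falsum_notin: "prime_theory v \<Longrightarrow> falsum \<notin> v"
  by (meson prime_theory_Neg prime_theory_pv pv_not_falsum)

lemma prime_extension:
  assumes "prime_theory v" "\<not> v \<turnstile> Impl \<phi> \<psi>"
  obtains u where "v \<subseteq> u" "prime_theory u" "\<phi> \<in> u" "\<psi> \<notin> u"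
proof -
  have "\<not> insert \<phi> v \<turnstile> \<psi>" using assms(2) pv_deduction by blast
  then show thesis by (rule lindenbaum) (use that in auto)
qed

section \<open>Subformulas and filtration\<close>

primrec sub :: "form \<Rightarrow> form set" where
  "sub (Var p) = {Var p}"
| "sub (Conj \<phi> \<psi>) = insert (Conj \<phi> \<psi>) (sub \<phi> \<union> sub \<psi>)"
| "sub (Disj \<phi> \<psi>) = insert (Disj \<phi> \<psi>) (sub \<phi> \<union> sub \<psi>)"
| "sub (Impl \<phi> \<psi>) = insert (Impl \<phi> \<psi>) (sub \<phi> \<union> sub \<psi>)"
| "sub (Neg \<phi>) = insert (Neg \<phi>) (sub \<phi>)"

lemma finite_sub: "finite (sub \<phi>)"
  by (induction \<phi>) auto

lemma self_sub [simp]: "\<phi> \<in> sub \<phi>"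
  by (cases \<phi>) auto

lemma sub_trans: "\<psi> \<in> sub \<phi> \<Longrightarrow> sub \<psi> \<subseteq> sub \<phi>"
  by (induction \<phi>) auto

lemma sub_args:
  "Conj \<psi> \<chi> \<in> sub \<phi> \<Longrightarrow> \<psi> \<in> sub \<phi> \<and> \<chi> \<in> sub \<phi>"
  "Disj \<psi> \<chi> \<in> sub \<phi> \<Longrightarrow> \<psi> \<in> sub \<phi> \<and> \<chi> \<in> sub \<phi>"
  "Impl \<psi> \<chi> \<in> sub \<phi> \<Longrightarrow> \<psi> \<in> sub \<phi> \<and> \<chi> \<in> sub \<phi>"
  "Neg \<psi> \<in> sub \<phi> \<Longrightarrow> \<psi> \<in> sub \<phi>"
  using sub_trans self_sub by fastforce+

text \<open>All that the truth lemma needs: in the frame \<open>W\<close> ordered by inclusion,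
  membership obeys the forcing clauses for formulas of \<open>F\<close>. Provability does not occur
  any more from here on.\<close>

definition saturated :: "form set \<Rightarrow> form set set \<Rightarrow> bool" where
  "saturated F W \<longleftrightarrow> (\<forall>t\<in>W.
     (\<forall>\<phi> \<psi>. Conj \<phi> \<psi> \<in> F \<longrightarrow> (Conj \<phi> \<psi> \<in> t \<longleftrightarrow> \<phi> \<in> t \<and> \<psi> \<in> t)) \<and>
     (\<forall>\<phi> \<psi>. Disj \<phi> \<psi> \<in> F \<longrightarrow> (Disj \<phi> \<psi> \<in> t \<longleftrightarrow> \<phi> \<in> t \<or> \<psi> \<in> t)) \<and>
     (\<forall>\<phi> \<psi>. Impl \<phi> \<psi> \<in> F \<longrightarrow>
        (Impl \<phi> \<psi> \<in> t \<longleftrightarrow> (\<forall>u\<in>W. t \<subseteq> u \<longrightarrow> \<phi> \<in> u \<longrightarrow> \<psi> \<in> u))) \<and>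
     (\<forall>\<phi>. Neg \<phi> \<in> F \<longrightarrow> (Neg \<phi> \<in> t \<longleftrightarrow> (\<forall>u\<in>W. t \<subseteq> u \<longrightarrow> \<phi> \<notin> u))))"

text \<open>The canonical model above a prime theory omitting \<open>\<phi>\<close>, filtered through the subformulas of \<open>\<phi>\<close>.
  The weak excluded middle makes its maximal consistent theory unique.\<close>

lemma finite_canonical_model:
  assumes "\<phi> \<notin> Jan"
  obtains W r m where "finite W" "r \<in> W" "m \<in> W" "\<phi> \<notin> r" "saturated (sub \<phi>) W"
    "\<And>t. t \<in> W \<Longrightarrow> r \<subseteq> t \<and> t \<subseteq> m"
proof -
  have "\<not> {} \<turnstile> \<phi>" using assms by (simp add: Jan_def WLEM_def)
  then obtain v0 where v0: "prime_theory v0" "\<phi> \<notin> v0" by (rule lindenbaum)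
  have "\<not> v0 \<turnstile> falsum" using falsum_notin[OF v0(1)] prime_theory_pv[OF v0(1)] by blast
  then obtain M where M: "v0 \<subseteq> M" "prime_theory M" "\<And>\<psi>. \<psi> \<notin> M \<Longrightarrow> M \<turnstile> Impl \<psi> falsum"
    by (rule lindenbaum) blast
  define T where "T = {v. prime_theory v \<and> v0 \<subseteq> v}"
  have top: "v \<subseteq> M" if "v \<in> T" for v
  proof
    fix \<psi>
    assume "\<psi> \<in> v"
    with that have "Neg \<psi> \<notin> v0" using prime_theory_Neg by (auto simp: T_def)
    \<comment> \<open>The root contains one disjunct of the weak excluded middle, and the first
      would persist into \<open>v\<close>.\<close>
    then have "Neg (Neg \<psi>) \<in> v0"
      using prime_theory_Disj[OF v0(1)] prime_theory_pv[OF v0(1) pv_wlem] by blast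
    show "\<psi> \<in> M"
    proof (rule ccontr)
      assume "\<psi> \<notin> M"
      then have "M \<turnstile> Neg \<psi>" using M(3) by (intro pv_Neg_falsum)
      with M(2) have "Neg \<psi> \<in> M" by (rule prime_theory_pv)
      with \<open>Neg (Neg \<psi>) \<in> v0\<close> M(1,2) show False
        using prime_theory_Neg[of M "Neg \<psi>"] by blast
    qed
  qed
  define W where "W = (\<lambda>v. v \<inter> sub \<phi>) ` T"
  have Impl: "Impl \<psi> \<chi> \<in> v \<longleftrightarrow> (\<forall>u\<in>W. v \<inter> sub \<phi> \<subseteq> u \<longrightarrow> \<psi> \<in> u \<longrightarrow> \<chi> \<in> u)"
    if v: "v \<in> T" and s: "Impl \<psi> \<chi> \<in> sub \<phi>" for v \<psi> \<chi>
  proof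
    assume "Impl \<psi> \<chi> \<in> v"
    \<comment> \<open>Inclusion of the filtered sets suffices: \<open>Impl \<psi> \<chi>\<close> is
      itself a subformula and therefore survives the filtering.\<close>
    with s show "\<forall>u\<in>W. v \<inter> sub \<phi> \<subseteq> u \<longrightarrow> \<psi> \<in> u \<longrightarrow> \<chi> \<in> u"
      using sub_args(3)[OF s] prime_theory_mp by (auto simp: W_def T_def)
  next
    assume *: "\<forall>u\<in>W. v \<inter> sub \<phi> \<subseteq> u \<longrightarrow> \<psi> \<in> u \<longrightarrow> \<chi> \<in> u"
    show "Impl \<psi> \<chi> \<in> v"
    proof (rule ccontr)
      assume "Impl \<psi> \<chi> \<notin> v"
      then have "\<not> v \<turnstile> Impl \<psi> \<chi>" using v prime_theory_pv by (auto simp: T_def)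
      moreover have "prime_theory v" using v by (simp add: T_def)
      ultimately obtain u where "v \<subseteq> u" "prime_theory u" "\<psi> \<in> u" "\<chi> \<notin> u"
        using prime_extension[of v \<psi> \<chi>] by blast
      moreover from this v have "u \<inter> sub \<phi> \<in> W" by (auto simp: W_def T_def)
      moreover have "\<psi> \<in> sub \<phi>" using sub_args(3)[OF s] by auto
      ultimately show False using bspec[OF *, of "u \<inter> sub \<phi>"] by blast
    qed
  qed
  have Neg: "Neg \<psi> \<in> v \<longleftrightarrow> (\<forall>u\<in>W. v \<inter> sub \<phi> \<subseteq> u \<longrightarrow> \<psi> \<notin> u)"
    if v: "v \<in> T" and s: "Neg \<psi> \<in> sub \<phi>" for v \<psi>
  proof
    assume "Neg \<psi> \<in> v"
    with s show "\<forall>u\<in>W. v \<inter> sub \<phi> \<subseteq> u \<longrightarrow> \<psi> \<notin> u"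
      using prime_theory_Neg by (auto simp: W_def T_def)
  next
    assume *: "\<forall>u\<in>W. v \<inter> sub \<phi> \<subseteq> u \<longrightarrow> \<psi> \<notin> u"
    show "Neg \<psi> \<in> v"
    proof (rule ccontr)
      assume "Neg \<psi> \<notin> v"
      then have "\<not> v \<turnstile> Neg \<psi>" using v prime_theory_pv by (auto simp: T_def)
      then have "\<not> v \<turnstile> Impl \<psi> falsum" using pv_Neg_falsum by blast
      moreover have "prime_theory v" using v by (simp add: T_def)
      ultimately obtain u where "v \<subseteq> u" "prime_theory u" "\<psi> \<in> u" "falsum \<notin> u"
        using prime_extension[of v \<psi> falsum] by blast
      moreover from this v have "u \<inter> sub \<phi> \<in> W" by (auto simp: W_def T_def)
      moreover have "\<psi> \<in> sub \<phi>" using sub_args(4)[OF s] by auto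
      ultimately show False using bspec[OF *, of "u \<inter> sub \<phi>"] by blast
    qed
  qed
  show thesis
  proof (rule that[of W "v0 \<inter> sub \<phi>" "M \<inter> sub \<phi>"])
    show "finite W"
      by (rule finite_subset[of _ "Pow (sub \<phi>)"]) (auto simp: W_def finite_sub)
    show "v0 \<inter> sub \<phi> \<in> W" "M \<inter> sub \<phi> \<in> W" using v0 M by (auto simp: W_def T_def)
    show "\<phi> \<notin> v0 \<inter> sub \<phi>" using v0 by simp
    show "v0 \<inter> sub \<phi> \<subseteq> t \<and> t \<subseteq> M \<inter> sub \<phi>" if "t \<in> W" for t
      using that top by (auto simp: W_def T_def)
    show "saturated (sub \<phi>) W"
      unfolding saturated_def
    proof (intro ballI HOL.conjI allI impI)
      fix t
      assume "t \<in> W"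
      then obtain v where v: "v \<in> T" "prime_theory v" "t = v \<inter> sub \<phi>" by (auto simp: W_def T_def)
      fix \<psi>
      show "Conj \<psi> \<chi> \<in> t \<longleftrightarrow> \<psi> \<in> t \<and> \<chi> \<in> t" if "Conj \<psi> \<chi> \<in> sub \<phi>" for \<chi>
        using sub_args(1)[OF that] prime_theory_Conj[OF v(2), of \<psi> \<chi>] that v(3) by auto
      show "Disj \<psi> \<chi> \<in> t \<longleftrightarrow> \<psi> \<in> t \<or> \<chi> \<in> t" if "Disj \<psi> \<chi> \<in> sub \<phi>" for \<chi>
        using sub_args(2)[OF that] prime_theory_Disj[OF v(2), of \<psi> \<chi>] that v(3) by auto
      show "Impl \<psi> \<chi> \<in> t \<longleftrightarrow> (\<forall>u\<in>W. t \<subseteq> u \<longrightarrow> \<psi> \<in> u \<longrightarrow> \<chi> \<in> u)"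
        if "Impl \<psi> \<chi> \<in> sub \<phi>" for \<chi>
        using Impl[OF v(1) that] that v(3) by simp
      show "Neg \<psi> \<in> t \<longleftrightarrow> (\<forall>u\<in>W. t \<subseteq> u \<longrightarrow> \<psi> \<notin> u)" if "Neg \<psi> \<in> sub \<phi>"
        using Neg[OF v(1) that] that v(3) by simp
    qed
  qed
qed

section \<open>Forcing over finite powersets\<close>

primrec forces :: "nat \<Rightarrow> (nat \<Rightarrow> nat set set) \<Rightarrow> form \<Rightarrow> nat set set" where
  "forces N U (Var p) = U p"
| "forces N U (Conj \<phi> \<psi>) = forces N U \<phi> \<inter> forces N U \<psi>"
| "forces N U (Disj \<phi> \<psi>) = forces N U \<phi> \<union> forces N U \<psi>"
| "forces N U (Impl \<phi> \<psi>) = {c \<in> Pow {..<N}. \<forall>d\<in>Pow {..<N}. c \<subseteq> d \<longrightarrow> d \<in> forces N U \<phi> \<longrightarrow> d \<in> forces N U \<psi>}"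
| "forces N U (Neg \<phi>) = {c \<in> Pow {..<N}. \<forall>d\<in>Pow {..<N}. c \<subseteq> d \<longrightarrow> d \<notin> forces N U \<phi>}"

definition upset :: "nat \<Rightarrow> nat set set \<Rightarrow> bool" where
  "upset N U \<longleftrightarrow> U \<subseteq> Pow {..<N} \<and> (\<forall>c d. c \<in> U \<longrightarrow> c \<subseteq> d \<longrightarrow> d \<subseteq> {..<N} \<longrightarrow> d \<in> U)"

lemma upset_forces: "(\<And>p. upset N (U p)) \<Longrightarrow> upset N (forces N U \<phi>)"
  by (induction \<phi>) (auto simp: upset_def)

text \<open>Truth is invariant under p-morphisms. For implication and negation, monotonicity sends
  supersets of \<open>c\<close> to worlds above \<open>\<pi> c\<close>, and lifting brings every
  such world back.\<close>

lemma forces_p_morphism: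
  assumes sat: "saturated (sub \<phi>) W"
    and W: "\<And>c. c \<subseteq> {..<N} \<Longrightarrow> \<pi> c \<in> W"
    and mono: "\<And>c d. c \<subseteq> d \<Longrightarrow> d \<subseteq> {..<N} \<Longrightarrow> \<pi> c \<subseteq> \<pi> d"
    and lift: "\<And>c t. c \<subseteq> {..<N} \<Longrightarrow> t \<in> W \<Longrightarrow> \<pi> c \<subseteq> t \<Longrightarrow> \<exists>d. c \<subseteq> d \<and> d \<subseteq> {..<N} \<and> \<pi> d = t"
    and "\<psi> \<in> sub \<phi>" "c \<subseteq> {..<N}"
  shows "c \<in> forces N (\<lambda>p. {c. c \<subseteq> {..<N} \<and> Var p \<in> \<pi> c}) \<psi> \<longleftrightarrow> \<psi> \<in> \<pi> c"
  using assms(5,6)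
proof (induction \<psi> arbitrary: c)
  case (Var p)
  then show ?case by simp
next
  case (Conj \<psi> \<chi>)
  have "\<psi> \<in> sub \<phi>" "\<chi> \<in> sub \<phi>" using sub_args(1)[OF Conj.prems(1)] by auto
  then show ?case using Conj sat W[of c] unfolding saturated_def by simp
next
  case (Disj \<psi> \<chi>)
  have "\<psi> \<in> sub \<phi>" "\<chi> \<in> sub \<phi>" using sub_args(2)[OF Disj.prems(1)] by auto
  then show ?case using Disj sat W[of c] unfolding saturated_def by simp
next
  case (Impl \<psi> \<chi>)
  have s: "\<psi> \<in> sub \<phi>" "\<chi> \<in> sub \<phi>" using sub_args(3)[OF Impl.prems(1)] by auto
  have "Impl \<psi> \<chi> \<in> \<pi> c \<longleftrightarrow> (\<forall>u\<in>W. \<pi> c \<subseteq> u \<longrightarrow> \<psi> \<in> u \<longrightarrow> \<chi> \<in> u)"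
    using sat W[OF Impl.prems(2)] Impl.prems(1) unfolding saturated_def by blast
  also have "\<dots> \<longleftrightarrow> (\<forall>d. d \<subseteq> {..<N} \<longrightarrow> c \<subseteq> d \<longrightarrow> \<psi> \<in> \<pi> d \<longrightarrow> \<chi> \<in> \<pi> d)"
    using W mono lift[OF Impl.prems(2)] by metis
  finally show ?case using Impl.IH s Impl.prems(2) by auto
next
  case (Neg \<psi>)
  have s: "\<psi> \<in> sub \<phi>" using sub_args(4)[OF Neg.prems(1)] by auto
  have "Neg \<psi> \<in> \<pi> c \<longleftrightarrow> (\<forall>u\<in>W. \<pi> c \<subseteq> u \<longrightarrow> \<psi> \<notin> u)"
    using sat W[OF Neg.prems(2)] Neg.prems(1) unfolding saturated_def by blast
  also have "\<dots> \<longleftrightarrow> (\<forall>d. d \<subseteq> {..<N} \<longrightarrow> c \<subseteq> d \<longrightarrow> \<psi> \<notin> \<pi> d)"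
    using W mono lift[OF Neg.prems(2)] by metis
  finally show ?case using Neg.IH s Neg.prems(2) by auto
qed

text \<open>A powerset is mapped onto \<open>W\<close> by reading its elements as strictly increasing sequences: a set of
  pairwise comparable sequences denotes the end of the longest one, any other set the maximum of \<open>W\<close>.\<close>

lemma powerset_p_morphism:
  fixes W :: "'a set set"
  assumes "finite W" "r \<in> W" "m \<in> W" and rm: "\<And>t. t \<in> W \<Longrightarrow> r \<subseteq> t \<and> t \<subseteq> m"
  obtains X \<pi> where "finite (X :: 'a set list set)" "\<pi> {} = r" "\<And>c. c \<subseteq> X \<Longrightarrow> \<pi> c \<in> W"
    "\<And>c d. c \<subseteq> d \<Longrightarrow> d \<subseteq> X \<Longrightarrow> \<pi> c \<subseteq> \<pi> d"
    "\<And>c t. c \<subseteq> X \<Longrightarrow> t \<in> W \<Longrightarrow> \<pi> c \<subseteq> t \<Longrightarrow> \<exists>d. c \<subseteq> d \<and> d \<subseteq> X \<and> \<pi> d = t"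
proof -
  \<comment> \<open>Prepending \<open>r\<close> makes all entries lie strictly above the root; the
    empty sequence denotes the root itself.\<close>
  define X where "X = {l. set l \<subseteq> W \<and> sorted_wrt (\<subset>) (r # l)}"
  define cmp where "cmp c \<longleftrightarrow> (\<forall>k\<in>c. \<forall>l\<in>c. prefix k l \<or> prefix l k)" for c :: "'a set list set"
  \<comment> \<open>On comparable sequences the last entries increase with the length, so the union
    is the last entry of the longest sequence. Written as a union, monotonicity is
    immediate.\<close>
  define \<pi> where "\<pi> c = (if cmp c then r \<union> (\<Union>l\<in>c. last (r # l)) else m)" for c
  have "distinct l" if "sorted_wrt (\<subset>) l" for l :: "'a set list"
    using that by (induction l) auto
  then have "finite X"
    using assms(1) by (auto intro!: finite_subset[OF _ finite_subset_distinct[of W]] simp: X_def)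
  have lastW: "last (r # l) \<in> W" if "l \<in> X" for l
    using that assms(2) last_in_set[of l] by (auto simp: X_def)
  have last_mono: "last (r # k) \<subseteq> last (r # l)" if "prefix k l" "l \<in> X" for k l
  proof -
    from that(1) obtain j where l: "l = k @ j" by (auto simp: prefix_def)
    have "sorted_wrt (\<subset>) (r # l)" using that(2) by (simp add: X_def)
    then have "sorted_wrt (\<subset>) ((r # k) @ j)" by (simp add: l)
    then have *: "\<forall>x\<in>set (r # k). \<forall>y\<in>set j. x \<subset> y" unfolding sorted_wrt_append by blast
    have "last (r # l) = (if j = [] then last (r # k) else last j)"
      using last_append[of "r # k" j] by (simp add: l)
    moreover have "last (r # k) \<subset> last j" if "j \<noteq> []"
      using bspec[OF bspec[OF *, of "last (r # k)"], of "last j"] that last_in_set[of "r # k"] by simp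
    ultimately show ?thesis by auto
  qed
  have longest: "\<exists>l\<in>X. (\<forall>k\<in>c. prefix k l) \<and> (l \<in> c \<or> c = {} \<and> l = [])" if c: "c \<subseteq> X" "cmp c" for c
  proof (cases "c = {}")
    case True
    then show ?thesis by (intro bexI[of _ "[]"]) (auto simp: X_def)
  next
    case False
    have "finite c" using c(1) \<open>finite X\<close> finite_subset by blast
    with False have "Max (length ` c) \<in> length ` c" by simp
    then obtain l where "l \<in> c" "length l = Max (length ` c)" by auto
    with \<open>finite c\<close> have l: "l \<in> c" "\<forall>k\<in>c. length k \<le> length l" by simp_all
    have "prefix k l" if "k \<in> c" for k
      using c(2) l that unfolding cmp_def by (metis prefix_length_le prefix_order.refl le_antisym not_equal_is_parallel parallelE)
    with l c(1) show ?thesis by blast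
  qed
  have \<pi>_longest: "\<pi> c = last (r # l)" if "c \<subseteq> X" "cmp c" "l \<in> X" "\<forall>k\<in>c. prefix k l" "l \<in> c \<or> c = {} \<and> l = []" for c l
  proof -
    have "r \<subseteq> last (r # l)" using rm lastW that(3) by blast
    moreover have "(\<Union>k\<in>c. last (r # k)) \<subseteq> last (r # l)"
      using last_mono that(3,4) by blast
    moreover have "last (r # l) \<subseteq> r \<union> (\<Union>k\<in>c. last (r # k))"
      using that(5) by (elim HOL.disjE) auto
    ultimately have "r \<union> (\<Union>k\<in>c. last (r # k)) = last (r # l)" by blast
    then show ?thesis unfolding \<pi>_def using that(2) by (simp only: if_True)
  qed
  have \<pi>_W: "\<pi> c \<in> W" if "c \<subseteq> X" for c
  proof (cases "cmp c")
    case True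
    from longest[OF that True] obtain l where l: "l \<in> X" "\<forall>k\<in>c. prefix k l" "l \<in> c \<or> c = {} \<and> l = []"
      by blast
    from \<pi>_longest[OF that True l] lastW[OF l(1)] show ?thesis by metis
  qed (simp add: \<pi>_def assms(3))
  show thesis
  proof (rule that[of X \<pi>])
    show "finite X" by fact
    show "\<pi> {} = r" by (simp add: \<pi>_def cmp_def)
    show "\<pi> c \<in> W" if "c \<subseteq> X" for c using that by (rule \<pi>_W)
    show "\<pi> c \<subseteq> \<pi> d" if "c \<subseteq> d" "d \<subseteq> X" for c d
    proof (cases "cmp d")
      case True
      with that(1) have "cmp c" by (auto simp: cmp_def)
      with True that(1) show ?thesis by (auto simp: \<pi>_def)
    next
      case False
      with rm \<pi>_W[of c] that show ?thesis by (auto simp: \<pi>_def[of d])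
    qed
    show "\<exists>d. c \<subseteq> d \<and> d \<subseteq> X \<and> \<pi> d = t" if c: "c \<subseteq> X" and t: "t \<in> W" "\<pi> c \<subseteq> t" for c t
    proof (cases "\<pi> c = t")
      case True
      with c show ?thesis by blast
    next
      case False
      \<comment> \<open>Otherwise \<open>\<pi> c\<close> is the maximum \<open>m\<close>, and
        \<open>t\<close> above it would have to equal it.\<close>
      with t rm have "cmp c" by (auto simp: \<pi>_def split: if_splits)
      with longest c obtain l where l: "l \<in> X" "\<forall>k\<in>c. prefix k l" "l \<in> c \<or> c = {} \<and> l = []" by blast
      with \<pi>_longest[OF c \<open>cmp c\<close> l] False t have "last (r # l) \<subset> t" by auto
      moreover have "x \<subseteq> last (r # l)" if "x \<in> set (r # l)" for x
      proof -
        from split_list_last[OF that] obtain as bs where "r # l = as @ x # bs" by blast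
        moreover have "sorted_wrt (\<subset>) (r # l)" using l(1) by (simp add: X_def)
        ultimately have "sorted_wrt (\<subset>) (as @ x # bs)" "last (r # l) = last (x # bs)" by simp_all
        then have "\<forall>y\<in>set bs. x \<subset> y" "last (r # l) = last (x # bs)"
          unfolding sorted_wrt_append by simp_all
        then show ?thesis using last_in_set[of bs] by auto
      qed
      ultimately have "sorted_wrt (\<subset>) ((r # l) @ [t])"
        using l(1) unfolding sorted_wrt_append by (auto simp: X_def)
      \<comment> \<open>Appending \<open>t\<close> to the longest sequence of \<open>c\<close> gives
        a sequence that extends every member of \<open>c\<close>, so adding it keeps the set
        comparable and moves its value to \<open>t\<close>.\<close>
      with l(1) t(1) have X: "l @ [t] \<in> X" by (simp add: X_def)
      have "prefix k (l @ [t])" if "k \<in> c" for k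
        using l(2) that prefix_append by blast
      with \<open>cmp c\<close> have "cmp (insert (l @ [t]) c)" by (auto simp: cmp_def)
      then have "\<pi> (insert (l @ [t]) c) = \<pi> c \<union> t"
        using \<open>cmp c\<close> by (auto simp: \<pi>_def)
      with X c t show ?thesis by (intro exI[of _ "insert (l @ [t]) c"]) auto
    qed
  qed
qed

theorem Jan_complete:
  assumes "\<phi> \<notin> Jan"
  obtains N U where "\<And>p. upset N (U p)" "{} \<notin> forces N U \<phi>"
proof -
  obtain W r m where W: "finite W" "r \<in> W" "m \<in> W" "\<phi> \<notin> r" "saturated (sub \<phi>) W"
    "\<And>t. t \<in> W \<Longrightarrow> r \<subseteq> t \<and> t \<subseteq> m"
    using finite_canonical_model[OF assms] by blast
  obtain X :: "form set list set" and \<pi> where X: "finite X" "\<pi> {} = r" "\<And>c. c \<subseteq> X \<Longrightarrow> \<pi> c \<in> W"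
    "\<And>c d. c \<subseteq> d \<Longrightarrow> d \<subseteq> X \<Longrightarrow> \<pi> c \<subseteq> \<pi> d"
    "\<And>c t. c \<subseteq> X \<Longrightarrow> t \<in> W \<Longrightarrow> \<pi> c \<subseteq> t \<Longrightarrow> \<exists>d. c \<subseteq> d \<and> d \<subseteq> X \<and> \<pi> d = t"
    using powerset_p_morphism[OF W(1,2,3,6)] by metis
  \<comment> \<open>The sequences are replaced by numbers, which will index the incomparable
    functions.\<close>
  obtain N h where "bij_betw h {..<N::nat} X"
    using ex_bij_betw_nat_finite[OF X(1)] by (auto simp: atLeast0LessThan)
  then have h: "h ` {..<N} = X" "inj_on h {..<N}" by (auto simp: bij_betw_def)
  let ?\<pi> = "\<lambda>c. \<pi> (h ` c)"
  let ?U = "\<lambda>p. {c. c \<subseteq> {..<N} \<and> Var p \<in> ?\<pi> c}"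
  have sub: "h ` c \<subseteq> X" if "c \<subseteq> {..<N}" for c using that h by blast
  have mono: "?\<pi> c \<subseteq> ?\<pi> d" if "c \<subseteq> d" "d \<subseteq> {..<N}" for c d
    using X(4)[OF image_mono[OF that(1)] sub[OF that(2)]] by simp
  have lift: "\<exists>d. c \<subseteq> d \<and> d \<subseteq> {..<N} \<and> ?\<pi> d = t" if "c \<subseteq> {..<N}" "t \<in> W" "?\<pi> c \<subseteq> t" for c t
  proof -
    from X(5)[OF sub[OF that(1)] that(2,3)] obtain d where "h ` c \<subseteq> d" "d \<subseteq> X" "\<pi> d = t" by blast
    moreover from this(2) obtain e where "e \<subseteq> {..<N}" "d = h ` e"
      using h(1) subset_image_iff by metis
    moreover have "c \<subseteq> e"
    proof
      fix x
      assume "x \<in> c"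
      with \<open>h ` c \<subseteq> d\<close> \<open>d = h ` e\<close> obtain y where "y \<in> e" "h x = h y" by blast
      with h(2) \<open>x \<in> c\<close> \<open>e \<subseteq> {..<N}\<close> that(1) show "x \<in> e" by (metis inj_onD subsetD)
    qed
    ultimately show ?thesis by blast
  qed
  have "{} \<in> forces N ?U \<phi> \<longleftrightarrow> \<phi> \<in> ?\<pi> {}"
    by (rule forces_p_morphism[OF W(5), of N ?\<pi>]) (use X(3) sub mono lift in auto)
  then have "{} \<notin> forces N ?U \<phi>" using W(4) X(2) by simp
  moreover have "upset N (?U p)" for p
    unfolding upset_def by (auto intro: subsetD[OF mono])
  ultimately show thesis by (intro that[of N ?U])
qed

section \<open>Mass problems avoiding lower cones\<close>

definition turing_le :: "(nat \<Rightarrow> nat) \<Rightarrow> (nat \<Rightarrow> nat) \<Rightarrow> bool" where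
  "turing_le f g \<longleftrightarrow> (\<exists>p. \<forall>n. run p g n = Some (f n))"

lemma turing_le_semi:
  assumes "semi G" "\<And>n y. G g (pr n y) \<longleftrightarrow> f n = y"
  shows "turing_le f g"
proof -
  obtain q where q: "\<And>f n. run q f n = None \<longleftrightarrow> (\<forall>y. \<not> G f (pr n y))"
    "\<And>f n y. run q f n = Some y \<Longrightarrow> G f (pr n y)"
    using semi_uniformize[OF assms(1)] by blast
  have "run q g n = Some (f n)" for n
    using q(1)[of g n] q(2)[of g n] assms(2)[of n] by (cases "run q g n") auto
  then show ?thesis unfolding turing_le_def by blast
qed

lemma turing_le_eff: "eff F \<Longrightarrow> turing_le (F g) g"
  unfolding eff_def turing_le_def by blast

lemma turing_le_graph: "turing_le f g \<Longrightarrow> \<exists>G. semi G \<and> (\<forall>n y. G g (pr n y) \<longleftrightarrow> f n = y)"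
proof -
  assume "turing_le f g"
  then obtain p where p: "\<And>n. run p g n = Some (f n)" unfolding turing_le_def by blast
  have "semi (\<lambda>g m. run (prog_of_nat (nat_of_prog p)) g (pfst m) = Some (psnd m))"
    by (intro semi_run eff_basic)
  then show ?thesis by (intro exI[of _ "\<lambda>g m. run p g (pfst m) = Some (psnd m)"]) (simp add: p)
qed

lemma turing_le_trans:
  assumes "turing_le f g" "turing_le g h"
  shows "turing_le f h"
proof -
  obtain G1 G2 where G: "semi G1" "\<And>n y. G1 g (pr n y) \<longleftrightarrow> f n = y"
    "semi G2" "\<And>n y. G2 h (pr n y) \<longleftrightarrow> g n = y"
    using turing_le_graph[OF assms(1)] turing_le_graph[OF assms(2)] by blast
  have "semi (\<lambda>f m. G2 f (psnd m))" by (intro semi_comp[OF G(3)] eff_basic)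
  then obtain Q where Q: "semi Q"
    "\<And>f n g. (\<And>l y. G2 f (pr l y) \<longleftrightarrow> g l = y) \<Longrightarrow> Q f n \<longleftrightarrow> G1 g n"
    by (rule semi_subst[OF G(1)]) simp
  from Q(1) show ?thesis
    by (rule turing_le_semi) (simp add: Q(2)[OF G(4)] G(2))
qed

lemma turing_le_ileave:
  assumes "turing_le f h" "turing_le g h"
  shows "turing_le (ileave f g) h"
proof -
  obtain G1 G2 where G: "semi G1" "\<And>n y. G1 h (pr n y) \<longleftrightarrow> f n = y"
    "semi G2" "\<And>n y. G2 h (pr n y) \<longleftrightarrow> g n = y"
    using turing_le_graph[OF assms(1)] turing_le_graph[OF assms(2)] by blast
  have "semi (\<lambda>h m. even (pfst m) \<and> G1 h (pr (pfst m div 2) (psnd m)) \<or> odd (pfst m) \<and> G2 h (pr (pfst m div 2) (psnd m)))"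
    by (intro semi_disj semi_conj semi_comp[OF G(1)] semi_comp[OF G(3)])
      (intro semi_dec dec_not dec_even eff_basic eff_half)+
  then show ?thesis by (rule turing_le_semi) (auto simp: G ileave_def)
qed

lemma turing_le_tail: "turing_le (tail f) f" and turing_le_evens: "turing_le (evens f) f" and turing_le_odds: "turing_le (odds f) f"
  and turing_le_refl: "turing_le f f"
proof -
  have "eff tail" "eff evens" "eff odds" "eff (\<lambda>f n. f n)"
    unfolding tail_def[abs_def] evens_def[abs_def] odds_def[abs_def] by (intro eff_arith)+
  from this[THEN turing_le_eff, of f] show "turing_le (tail f) f" "turing_le (evens f) f" "turing_le (odds f) f" "turing_le f f" .
qed

lemma turing_le_cons: "turing_le (cons a f) f"
  by (rule turing_le_eff[of "cons a"]) (intro eff_cons eff_basic)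

lemma turing_le_finite_modification:
  assumes "\<And>n. n \<ge> k \<Longrightarrow> f n = g n"
  shows "turing_le f g"
proof -
  obtain h where h: "eff (\<lambda>_. h)" "\<forall>n\<in>{..<k}. h n = f n" using eff_table[of "{..<k}" f] by auto
  have "eff (\<lambda>g n. if n < k then h n else g n)"
    by (intro eff_if dec_less h(1) eff_basic)
  moreover have "(\<lambda>n. if n < k then h n else g n) = f"
    using assms h(2) by (auto simp: fun_eq_iff)
  ultimately show ?thesis using turing_le_eff[of "\<lambda>g n. if n < k then h n else g n" g] by simp
qed

text \<open>Lower cones are countable. With \<open>the\<close>, every index names a total function,
  so that it is possible to diagonalise against all indices.\<close>

lemma turing_le_enum: "turing_le f g \<Longrightarrow> \<exists>e. f = (\<lambda>n. the (run (prog_of_nat e) g n))"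
proof -
  assume "turing_le f g"
  then obtain p where "\<And>n. run p g n = Some (f n)" unfolding turing_le_def by blast
  then show ?thesis by (intro exI[of _ "nat_of_prog p"]) (simp add: fun_eq_iff)
qed

section \<open>Finite-extension constructions\<close>

definition agree :: "(nat \<Rightarrow> nat) \<Rightarrow> (nat \<Rightarrow> nat) \<Rightarrow> nat \<Rightarrow> bool" where
  "agree f g k \<longleftrightarrow> (\<forall>i<k. f i = g i)"

lemma semi_open:
  assumes "semi R" "R f n"
  shows "\<exists>k. \<forall>h. agree f h k \<longrightarrow> R h n"
proof -
  obtain D where "dec (\<lambda>f. D)"
    and D: "\<And>f n. R f n \<longleftrightarrow> (\<exists>k t. D (pr (list_encode (map f [0..<k])) (pr n t)))"
    using semi_use[OF assms(1)] by blast
  from assms(2) obtain k t where kt: "D (pr (list_encode (map f [0..<k])) (pr n t))" using D by blast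
  have "R h n" if "agree f h k" for h
  proof -
    have "map f [0..<k] = map h [0..<k]" using that by (simp add: agree_def)
    with kt show ?thesis unfolding D by metis
  qed
  then show ?thesis by blast
qed

text \<open>The Baire category argument. A pair of a function and a length stands for an initial
  segment; each step meets one requirement and strictly lengthens the segment.\<close>

lemma generic_exists:
  assumes dense: "\<And>j f k. \<exists>g k'. agree f g k \<and> (\<forall>h. agree g h k' \<longrightarrow> Q j h)"
  shows "\<exists>h. \<forall>j::nat. Q j h"
proof -
  let ?P = "\<lambda>j s t. agree (fst s) (fst t) (snd s) \<and> snd s < snd t \<and> (\<forall>h. agree (fst t) h (snd t) \<longrightarrow> Q j h)"
  have ex: "\<exists>t. ?P j s t" for j and s :: "(nat \<Rightarrow> nat) \<times> nat"
  proof -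
    obtain g k' where "agree (fst s) g (snd s)" "\<forall>h. agree g h k' \<longrightarrow> Q j h" using dense by blast
    then show ?thesis
      by (intro exI[of _ "(g, max k' (Suc (snd s)))"]) (auto simp: agree_def)
  qed
  define nx where "nx j s = (SOME t. ?P j s t)" for j s
  have P: "?P j s (nx j s)" for j s
    unfolding nx_def by (rule someI_ex[OF ex])
  have nx: "agree (fst s) (fst (nx j s)) (snd s)" "snd s < snd (nx j s)"
    "agree (fst (nx j s)) h (snd (nx j s)) \<Longrightarrow> Q j h" for j s h
    using P[of s j] by blast+
  define s where "s = rec_nat (\<lambda>_. 0, 0) nx"
  have s_Suc: "s (Suc j) = nx j (s j)" for j by (simp add: s_def)
  have len: "j \<le> snd (s j)" for j
  proof (induction j)
    case (Suc j)
    then show ?case using nx(2)[of "s j" j] by (simp add: s_Suc)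
  qed simp
  have coh: "snd (s j) \<le> snd (s (j + d)) \<and> agree (fst (s j)) (fst (s (j + d))) (snd (s j))" for j d
  proof (induction d)
    case (Suc d)
    with nx(1)[of "s (j + d)" "j + d"] nx(2)[of "s (j + d)" "j + d"] show ?case
      by (auto simp: s_Suc agree_def)
  qed (simp add: agree_def)
  \<comment> \<open>The segment at stage \<open>Suc i\<close> has length at least
    \<open>Suc i\<close>, so it already fixes the value at \<open>i\<close>.\<close>
  define h where "h i = fst (s (Suc i)) i" for i
  have "agree (fst (s j)) h (snd (s j))" for j
    unfolding agree_def h_def
  proof (intro allI impI)
    fix i
    assume i: "i < snd (s j)"
    show "fst (s j) i = fst (s (Suc i)) i"
    proof (cases "j \<le> Suc i")
      case True
      then show ?thesis using coh[of j "Suc i - j"] i by (simp add: agree_def)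
    next
      case False
      then show ?thesis using coh[of "Suc i" "j - Suc i"] len[of "Suc i"] by (simp add: agree_def)
    qed
  qed
  then have "Q j h" for j using nx(3)[of j "s j" h] by (simp add: s_Suc[symmetric])
  then show ?thesis by blast
qed

text \<open>Kleene-Post: a finite condition either has an extension on which the computation converges, and is then
  extended so as to disagree with its value, or it forces divergence.\<close>

lemma antichain_exists: "\<exists>g :: nat \<Rightarrow> nat \<Rightarrow> nat. \<forall>x y. x \<noteq> y \<longrightarrow> \<not> turing_le (g x) (g y)"
proof -
  define sec where "sec x H n = H (pr x n)" for x and H :: "nat \<Rightarrow> nat" and n
  define Q where "Q j H \<longleftrightarrow> (pfst (psnd j) \<noteq> psnd (psnd j) \<longrightarrow>
      (\<exists>n. run (prog_of_nat (pfst j)) (sec (psnd (psnd j)) H) n \<noteq> Some (sec (pfst (psnd j)) H n)))" for j H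
  have "\<exists>g k'. agree f g k \<and> (\<forall>h. agree g h k' \<longrightarrow> Q j h)" for j f k
  proof -
    let ?x = "pfst (psnd j)" and ?y = "psnd (psnd j)" and ?p = "prog_of_nat (pfst j)"
    let ?R = "\<lambda>H n. \<exists>v. run ?p (sec ?y H) k = Some v \<and> v \<noteq> sec ?x H k"
    consider "?x = ?y" | "?x \<noteq> ?y" "\<exists>g v. agree f g k \<and> run ?p (sec ?y g) k = Some v"
      | "?x \<noteq> ?y" "\<forall>g. agree f g k \<longrightarrow> run ?p (sec ?y g) k = None"
      by (metis not_Some_eq)
    then show ?thesis
    proof cases
      case 1
      then show ?thesis by (intro exI[of _ f] exI[of _ k]) (simp add: Q_def agree_def)
    next
      case 2
      then obtain g v where g: "agree f g k" "run ?p (sec ?y g) k = Some v" by blast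
      \<comment> \<open>The length \<open>k\<close> also serves as the argument of the
        diagonalisation: the place \<open>pr ?x k\<close> is not below \<open>k\<close>, hence still
        free, and column \<open>?y\<close> keeps its values.\<close>
      let ?g = "g(pr ?x k := Suc v)"
      have "semi ?R"
        unfolding sec_def
        by (intro semi_ex semi_conj semi_run) (intro eff_basic semi_dec dec_not dec_eq)+
      moreover have "sec ?y ?g = sec ?y g" using 2(1) by (auto simp: sec_def fun_eq_iff)
      then have "?R ?g 0" using g(2) by (simp add: sec_def)
      ultimately obtain k' where k': "\<forall>h. agree ?g h k' \<longrightarrow> ?R h 0" using semi_open by blast
      have "k \<le> pr ?x k" by (rule le_prod_encode_2)
      then have "agree f ?g k" using g(1) by (auto simp: agree_def)
      moreover have "Q j h" if "agree ?g h k'" for h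
      proof -
        from that k' obtain v where "run ?p (sec ?y h) k = Some v" "v \<noteq> sec ?x h k" by blast
        then show ?thesis unfolding Q_def by (intro impI exI[of _ k]) simp
      qed
      ultimately show ?thesis by blast
    next
      case 3
      then have "Q j h" if "agree f h k" for h using that unfolding Q_def by (intro impI exI[of _ k]) simp
      then show ?thesis by (intro exI[of _ f] exI[of _ k]) (simp add: agree_def)
    qed
  qed
  then obtain H where H: "\<And>j. Q j H" using generic_exists by blast
  have "\<not> turing_le (sec x H) (sec y H)" if "x \<noteq> y" for x y
  proof
    assume "turing_le (sec x H) (sec y H)"
    then obtain p where "\<And>n. run p (sec y H) n = Some (sec x H n)" unfolding turing_le_def by blast
    then show False using H[of "pr (nat_of_prog p) (pr x y)"] that by (simp add: Q_def)
  qed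
  then show ?thesis by (intro exI[of _ "\<lambda>x. sec x H"]) simp
qed

definition antichain :: "nat \<Rightarrow> nat \<Rightarrow> nat" where
  "antichain = (SOME g. \<forall>x y. x \<noteq> y \<longrightarrow> \<not> turing_le (g x) (g y))"

lemma antichain: "x \<noteq> y \<Longrightarrow> \<not> turing_le (antichain x) (antichain y)"
  using someI_ex[OF antichain_exists] unfolding antichain_def by blast

definition avoid :: "nat set \<Rightarrow> (nat \<Rightarrow> nat) set" where
  "avoid c = {f. \<forall>x\<in>c. \<not> turing_le f (antichain x)}"

text \<open>\<open>mass U\<close> is the meet of the mass problems \<open>avoid c\<close> with \<open>c \<in> U\<close>, the first value being the tag.\<close>

definition mass :: "nat set set \<Rightarrow> (nat \<Rightarrow> nat) set" where
  "mass U = {f. set_decode (f 0) \<in> U \<and> tail f \<in> avoid (set_decode (f 0))}"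

section \<open>Meets of cone-avoiding problems\<close>

lemma avoid_turing_le: "f \<in> avoid c \<Longrightarrow> turing_le f h \<Longrightarrow> h \<in> avoid c"
  unfolding avoid_def using turing_le_trans by blast

lemma mass_mono: "U \<subseteq> V \<Longrightarrow> mass V \<le>\<^sub>1 mass U"
  by (rule le1_superset) (auto simp: mass_def)

lemma cons_mass: "finite c \<Longrightarrow> cons (set_encode c) f \<in> mass U \<longleftrightarrow> c \<in> U \<and> f \<in> avoid c"
  by (simp add: mass_def)

lemma finite_codes: "U \<subseteq> Pow {..<N} \<Longrightarrow> finite (set_encode ` U)" for N :: nat
  by (rule finite_imageI) (rule finite_subset, auto)

text \<open>Tags are united and functions interleaved. The union of the tags lies in both up-closed
  sets, and the interleaving computes both functions, so it avoids all cones that either of them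
  avoids.\<close>

lemma mass_Int:
  assumes "upset N U" "upset N V"
  shows "mass (U \<inter> V) \<le>\<^sub>1 mjoin (mass U) (mass V)"
proof -
  let ?codes = "set_encode ` Pow {..<N}"
  have "finite ?codes" by (rule finite_codes[of _ N]) simp
  then obtain t where t: "eff (\<lambda>f. t)" "\<And>a b. a \<in> ?codes \<Longrightarrow> b \<in> ?codes \<Longrightarrow>
      t (pr a b) = set_encode (set_decode a \<union> set_decode b)"
    using eff_table[of "(\<lambda>(a, b). pr a b) ` (?codes \<times> ?codes)"
      "\<lambda>w. set_encode (set_decode (pfst w) \<union> set_decode (psnd w))"] by force
  show ?thesis
  proof (rule le1_eff[of "\<lambda>f. cons (t (pr (f 0) (f 1))) (tail (tail f))"])
    show "eff (\<lambda>f. cons (t (pr (f 0) (f 1))) (tail (tail f)))"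
      unfolding tail_def by (intro eff_cons eff_comp[OF t(1)] eff_basic)
    fix f
    assume "f \<in> mjoin (mass U) (mass V)"
    then have f: "set_decode (f 0) \<in> U" "tail (evens f) \<in> avoid (set_decode (f 0))"
      "set_decode (f 1) \<in> V" "tail (odds f) \<in> avoid (set_decode (f 1))"
      by (simp_all add: mjoin_def mass_def evens_def odds_def)
    let ?c = "set_decode (f 0) \<union> set_decode (f 1)"
    have sub: "set_decode (f 0) \<subseteq> {..<N}" "set_decode (f 1) \<subseteq> {..<N}"
      using f assms by (auto simp: upset_def)
    then have "f 0 \<in> ?codes" "f 1 \<in> ?codes"
      by (metis PowI image_eqI set_decode_inverse)+
    then have "t (pr (f 0) (f 1)) = set_encode ?c" by (rule t(2))
    moreover have "?c \<in> U \<inter> V" using f sub assms unfolding upset_def by (metis IntI Un_least Un_upper1 Un_upper2)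
    \<comment> \<open>The two tags occupy the places 0 and 1; removing both leaves exactly the
      interleaving of the two tails.\<close>
    moreover have "tail (evens f) = evens (tail (tail f))" "tail (odds f) = odds (tail (tail f))"
      by (simp_all add: fun_eq_iff tail_def evens_def odds_def)
    then have "tail (tail f) \<in> avoid ?c"
      using avoid_turing_le[OF f(2)] avoid_turing_le[OF f(4)] turing_le_evens turing_le_odds by (auto simp: avoid_def)
    ultimately show "cons (t (pr (f 0) (f 1))) (tail (tail f)) \<in> mass (U \<inter> V)"
      by (simp add: cons_mass)
  qed
qed

lemma deg_mass_Int:
  assumes "upset N U" "upset N V"
  shows "deg (mjoin (mass U) (mass V)) = deg (mass (U \<inter> V))"
  unfolding deg_eq_iff using mass_Int[OF assms] by (auto intro!: mjoin_least mass_mono)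

text \<open>An element of \<open>mass (U \<union> V)\<close> lacks only the information which of the
  two sets contains its tag, and this is decidable because \<open>U\<close> is finite.\<close>

lemma deg_mass_Un:
  assumes "upset N U" "upset N V"
  shows "deg (mmeet (mass U) (mass V)) = deg (mass (U \<union> V))"
  unfolding deg_eq_iff
proof
  show "mass (U \<union> V) \<le>\<^sub>1 mmeet (mass U) (mass V)" by (intro mmeet_greatest mass_mono) auto
  have fin: "finite (set_encode ` U)" using finite_codes assms(1) by (auto simp: upset_def)
  show "mmeet (mass U) (mass V) \<le>\<^sub>1 mass (U \<union> V)"
  proof (rule le1_eff[of "\<lambda>f. cons (if f 0 \<in> set_encode ` U then 0 else 1) f"])
    show "eff (\<lambda>f. cons (if f 0 \<in> set_encode ` U then 0 else 1) f)"
      by (intro eff_cons eff_if dec_comp[OF dec_finite[OF fin]] eff_basic)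
    fix f
    assume f: "f \<in> mass (U \<union> V)"
    have "set_decode (f 0) \<in> U" if "f 0 \<in> set_encode ` U"
      using that assms(1) by (auto simp: upset_def finite_subset[of _ "{..<N}"])
    moreover have "set_decode (f 0) \<in> V" if "f 0 \<notin> set_encode ` U"
      using that f by (auto simp: mass_def image_iff)
    ultimately show "cons (if f 0 \<in> set_encode ` U then 0 else 1) f \<in> mmeet (mass U) (mass V)"
      using f by (auto simp: mmeet_def mass_def)
  qed
qed

section \<open>Extensions of strings and the degree of an implication\<close>

definition str :: "nat \<Rightarrow> nat \<Rightarrow> nat" where
  "str w n = (if cdrop n w = 0 then 0 else chd (cdrop n w))"

text \<open>The string overwrites an initial segment of \<open>f\<close> instead of shifting it, so
  the result is a finite modification of \<open>f\<close> and has the same Turing degree.\<close>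

definition pre :: "nat \<Rightarrow> (nat \<Rightarrow> nat) \<Rightarrow> nat \<Rightarrow> nat" where
  "pre s f n = (if cdrop n s = 0 then f n else chd (cdrop n s))"

lemma str_list_encode: "str (list_encode xs) n = (if n < length xs then xs ! n else 0)"
  by (simp add: str_def hd_drop_conv_nth)

lemma pre_list_encode: "pre (list_encode xs) f n = (if n < length xs then xs ! n else f n)"
  by (simp add: pre_def hd_drop_conv_nth)

lemma turing_le_pre: "turing_le (pre s f) f" "turing_le f (pre s f)"
proof -
  have "pre s f n = f n" if "n \<ge> length (list_decode s)" for n
    using that pre_list_encode[of "list_decode s" f n] by simp
  then show "turing_le (pre s f) f" "turing_le f (pre s f)"
    by (auto intro: turing_le_finite_modification[of "length (list_decode s)"])
qed

text \<open>The value \<open>f i\<close> moves to the place \<open>2 * i + 2\<close>, so agreement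
  below \<open>k\<close> is preserved.\<close>

lemma agree_ileave_cons: "agree f g k \<Longrightarrow> agree (ileave (cons a f) h) (ileave (cons a g) h) k"
  by (auto simp: agree_def ileave_def cons_def split: nat.split)

text \<open>The lower cones of all the functions \<open>antichain x\<close> together are countable;
  differing from each member is one more dense open requirement, met along with
  \<open>Q\<close>.\<close>

lemma generic_avoid:
  assumes "finite u"
    and dense: "\<And>j f k. \<exists>g k'. agree f g k \<and> (\<forall>h. agree g h k' \<longrightarrow> Q j h)"
  shows "\<exists>x\<in>avoid u. \<forall>j::nat. Q j x"
proof -
  define e where "e j n = the (run (prog_of_nat (pfst j)) (antichain (psnd j)) n)" for j n
  have "\<exists>g k'. agree f g k \<and> (\<forall>h. agree g h k' \<longrightarrow> Q j h \<and> h \<noteq> e j)" for j f k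
  proof -
    obtain g k' where g: "agree f g k" "\<And>h. agree g h k' \<Longrightarrow> Q j h" using dense by blast
    \<comment> \<open>A place beyond both the given condition and the part that secures
      \<open>Q\<close>; changing the value there disturbs neither.\<close>
    let ?l = "max k k'"
    let ?g = "g(?l := Suc (e j ?l))"
    have "agree f ?g k" using g(1) by (auto simp: agree_def)
    moreover have "Q j h \<and> h \<noteq> e j" if "agree ?g h (Suc ?l)" for h
    proof
      have "agree g h k'" using that unfolding agree_def by (metis fun_upd_apply less_SucI less_max_iff_disj less_not_refl)
      then show "Q j h" by (rule g(2))
      have "?g ?l = h ?l" using that unfolding agree_def by blast
      then have "h ?l = Suc (e j ?l)" by simp
      then show "h \<noteq> e j" by auto
    qed
    ultimately show ?thesis by blast
  qed
  then obtain x where x: "\<And>j. Q j x \<and> x \<noteq> e j" using generic_exists[of "\<lambda>j h. Q j h \<and> h \<noteq> e j"] by blast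
  have "x \<in> avoid u"
    unfolding avoid_def
  proof (intro CollectI ballI notI)
    fix z
    assume "turing_le x (antichain z)"
    then obtain c where "x = (\<lambda>n. the (run (prog_of_nat c) (antichain z) n))" using turing_le_enum by blast
    then have "x = e (pr c z)" by (simp add: e_def fun_eq_iff)
    then show False using x by blast
  qed
  with x show ?thesis by blast
qed

text \<open>These are the computationally weak members of \<open>avoid u\<close> inside a given
  basic open set, against which the output of a reduction is tested.\<close>

lemma avoid_antichain: "y \<notin> u \<Longrightarrow> pre s (antichain y) \<in> avoid u"
  unfolding avoid_def
proof (intro CollectI ballI notI)
  fix x
  assume "y \<notin> u" "x \<in> u" "turing_le (pre s (antichain y)) (antichain x)"
  moreover from this(3) have "turing_le (antichain y) (antichain x)" by (rule turing_le_trans[OF turing_le_pre(2)])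
  ultimately show False using antichain[of y x] by auto
qed

text \<open>A set \<open>avoid u\<close> is comeager, so one piece of the covering by \<open>\<Pi>\<^sup>0\<^sub>1\<close> classes contains all of its elements
  extending some string \<open>s\<close>; on that piece the tag \<open>c\<close> of the output can be fixed as well. The elements of
  \<open>avoid u\<close> computable from the generator \<open>x\<close> then witness that \<open>h\<close> is not computable from \<open>x\<close> when
  \<open>x \<in> c - u\<close>.\<close>

lemma mass_imp_single:
  assumes "upset N U" "upset N V" "mass V \<le>\<^sub>1 mjoin (mass U) C" "u \<in> U"
  shows "mass {c \<in> Pow {..<N}. c \<union> u \<in> V} \<le>\<^sub>1 C"
proof -
  obtain R G where RG: "semi R" "semi G" "red R G (mass V) (mjoin (mass U) C)" using assms(3) le1_iff by blast
  have u: "u \<subseteq> {..<N}" "finite u" using assms(1,4) finite_subset by (auto simp: upset_def)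
  define J where "J x h = ileave (cons (set_encode u) x) h" for x h
  \<comment> \<open>Splits each piece according to the tag of the output. Within a piece the output
    is total, so having another tag is semidecidable and the smaller pieces are still effectively
    closed.\<close>
  define R2 where "R2 g k \<longleftrightarrow> R g (pfst k) \<or> (\<exists>y. G g (pr (pr (pfst k) 0) y) \<and> y \<noteq> psnd k)" for g k
  have "semi R2"
    unfolding R2_def by (intro semi_disj semi_ex semi_conj semi_comp[OF RG(1)] semi_comp[OF RG(2)])
      (intro eff_basic semi_dec dec_not dec_eq)+
  have J: "J x h \<in> mjoin (mass U) C" if "x \<in> avoid u" "h \<in> C" for x h
    using that assms(4) u(2) by (simp add: J_def mjoin_def cons_mass)
  have R2: "\<exists>k. \<not> R2 (J x h) k" if x: "x \<in> avoid u" "h \<in> C" for x h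
  proof -
    from J[OF x] RG(3) obtain i q where "\<not> R (J x h) i" "\<forall>n y. G (J x h) (pr (pr i n) y) \<longleftrightarrow> q n = y"
      unfolding red_def by blast
    then show ?thesis by (intro exI[of _ "pr i (q 0)"]) (simp add: R2_def)
  qed
  have not_R2: "\<exists>q\<in>mass V. q 0 = psnd k \<and> turing_le q (J x h)"
    if x: "x \<in> avoid u" "h \<in> C" and k: "\<not> R2 (J x h) k" for x h k
  proof -
    from k have "\<not> R (J x h) (pfst k)" by (simp add: R2_def)
    with J[OF x] RG(3) obtain q where q: "q \<in> mass V"
      "\<And>n y. G (J x h) (pr (pr (pfst k) n) y) \<longleftrightarrow> q n = y"
      unfolding red_def by blast
    have "semi (\<lambda>f m. G f (pr (pr (pfst k) (pfst m)) (psnd m)))"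
      by (intro semi_comp[OF RG(2)] eff_basic)
    then have "turing_le q (J x h)" by (rule turing_le_semi) (simp add: q)
    moreover have "q 0 = psnd k" using k q(2) by (auto simp: R2_def)
    ultimately show ?thesis using q(1) by blast
  qed
  \<comment> \<open>A guess \<open>z\<close> codes a string, a piece and a tag. It is refuted by an
    extension of the string outside the piece; only extensions of finite support are tried, since
    these can be enumerated.\<close>
  define R' where "R' h z \<longleftrightarrow> (\<exists>w. R2 (J (pre (pfst z) (str w)) h) (psnd z))" for h z
  have "eff (\<lambda>f m. J (pre (pfst (pfst (pfst m))) (str (psnd (pfst m)))) f (psnd m))"
    unfolding J_def pre_def str_def
    by (intro eff_ileave eff_cons eff_if dec_eq eff_chd eff_cdrop eff_basic)
  then have "semi (\<lambda>f m. R2 (J (pre (pfst (pfst m)) (str (psnd m))) f) (psnd (pfst m)))"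
    by (intro semi_oracle[OF \<open>semi R2\<close>] eff_basic)
  then have "semi R'" unfolding R'_def by (rule semi_ex)
  have R'_ex: "\<exists>z. \<not> R' h z" if h: "h \<in> C" for h
  proof (rule ccontr)
    assume "\<nexists>z. \<not> R' h z"
    then have all: "R' h z" for z by blast
    \<comment> \<open>If every guess is refuted, the complement of each piece is dense as well as
      open, and a generic member of \<open>avoid u\<close> escapes the whole covering.\<close>
    have "\<exists>g k'. agree f g k \<and> (\<forall>x. agree g x k' \<longrightarrow> R2 (J x h) j)" for j f k
    proof -
      let ?s = "list_encode (map f [0..<k])"
      from all[of "pr ?s j"] obtain w where w: "R2 (J (pre ?s (str w)) h) j" unfolding R'_def by auto
      from semi_open[of R2, OF \<open>semi R2\<close> w] obtain k' where
        k': "\<forall>g. agree (J (pre ?s (str w)) h) g k' \<longrightarrow> R2 g j" ..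
      have "R2 (J x h) j" if "agree (pre ?s (str w)) x k'" for x
        using k' agree_ileave_cons[OF that] unfolding J_def by simp
      moreover have "agree f (pre ?s (str w)) k" by (simp add: agree_def pre_list_encode)
      ultimately show ?thesis by blast
    qed
    then have "\<exists>x\<in>avoid u. \<forall>j. R2 (J x h) j" by (rule generic_avoid[OF u(2), of "\<lambda>j x. R2 (J x h) j"])
    then show False using R2[OF _ h] by blast
  qed
  have R'_ext: "\<not> R2 (J (pre (pfst z) x) h) (psnd z)" if z: "\<not> R' h z" for h z x
  proof
    assume "R2 (J (pre (pfst z) x) h) (psnd z)"
    from semi_open[of R2, OF \<open>semi R2\<close> this] obtain k where
      k: "\<forall>g. agree (J (pre (pfst z) x) h) g k \<longrightarrow> R2 g (psnd z)" ..
    \<comment> \<open>Functions of finite support are dense: if some extension leaves the closed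
      piece, then so does one of finite support.\<close>
    have "agree (pre (pfst z) x) (pre (pfst z) (str (list_encode (map x [0..<k])))) k"
      by (simp add: agree_def pre_def str_list_encode)
    then have "R2 (J (pre (pfst z) (str (list_encode (map x [0..<k])))) h) (psnd z)"
      using k agree_ileave_cons unfolding J_def by simp
    with z show False unfolding R'_def by blast
  qed
  have "finite (set_encode ` V)" using finite_codes assms(2) by (auto simp: upset_def)
  then obtain t where t: "eff (\<lambda>f. t)" "\<And>c. c \<in> set_encode ` V \<Longrightarrow> t c = set_encode (set_decode c - u)"
    using eff_table[of "set_encode ` V" "\<lambda>c. set_encode (set_decode c - u)"] by blast
  have out: "cons (t (psnd (psnd z))) h \<in> mass {c \<in> Pow {..<N}. c \<union> u \<in> V}" if h: "h \<in> C" and z: "\<not> R' h z" for h z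
  proof -
    let ?c = "set_decode (psnd (psnd z))"
    have q: "\<exists>q\<in>mass V. q 0 = psnd (psnd z) \<and> turing_le q (J (pre (pfst z) (antichain y)) h)" if "y \<notin> u" for y
      by (rule not_R2[OF avoid_antichain[OF that] h R'_ext[OF z]])
    \<comment> \<open>\<open>N\<close> is an index outside \<open>u\<close>, so there is at least
      one output, and its tag lies in \<open>V\<close>.\<close>
    from q[of N] u(1) obtain q where "q \<in> mass V" "q 0 = psnd (psnd z)" by auto
    then have c: "?c \<in> V" by (auto simp: mass_def)
    then have cN: "?c \<subseteq> {..<N}" using assms(2) by (auto simp: upset_def)
    have "psnd (psnd z) \<in> set_encode ` V" using c by (metis image_eqI set_decode_inverse)
    then have "t (psnd (psnd z)) = set_encode (?c - u)" by (rule t(2))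
    moreover have "(?c - u) \<union> u \<in> V"
    proof -
      have "?c \<subseteq> (?c - u) \<union> u" "(?c - u) \<union> u \<subseteq> {..<N}" using cN u(1) by auto
      then show ?thesis using c assms(2) unfolding upset_def by blast
    qed
    moreover have "h \<in> avoid (?c - u)"
      unfolding avoid_def
    proof (intro CollectI ballI notI)
      fix y
      assume y: "y \<in> ?c - u" and h_y: "turing_le h (antichain y)"
      from q[of y] y obtain q where q: "q \<in> mass V" "q 0 = psnd (psnd z)"
        "turing_le q (J (pre (pfst z) (antichain y)) h)" by blast
      \<comment> \<open>If \<open>h\<close> were computable from \<open>antichain y\<close>, so
        would be the whole input and hence the output \<open>q\<close>, whose tag contains
        \<open>y\<close>.\<close>
      have "turing_le (J (pre (pfst z) (antichain y)) h) (antichain y)"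
        unfolding J_def by (intro turing_le_ileave h_y turing_le_trans[OF turing_le_cons] turing_le_pre(1))
      then have "turing_le (tail q) (antichain y)" using q(3) turing_le_tail turing_le_trans by blast
      moreover have "tail q \<in> avoid ?c" using q(1,2) by (simp add: mass_def)
      ultimately show False using y by (simp add: avoid_def)
    qed
    ultimately show ?thesis using cN by (auto simp: cons_mass)
  qed
  show ?thesis
  proof (rule le1I)
    show "semi R'" by fact
    show "semi (\<lambda>f m. cons (t (psnd (psnd (pfst (pfst m))))) f (psnd (pfst m)) = psnd m)"
      by (intro semi_dec dec_eq eff_cons eff_comp[OF t(1)] eff_basic)
    show "red R' (\<lambda>f m. cons (t (psnd (psnd (pfst (pfst m))))) f (psnd (pfst m)) = psnd m)
      (mass {c \<in> Pow {..<N}. c \<union> u \<in> V}) C"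
      unfolding red_def using R'_ex out by auto
  qed
qed

text \<open>The tag 0 codes the empty set, and \<open>avoid {}\<close> contains every
  function.\<close>

lemma mass_Pow: "mass (Pow {..<N}) \<le>\<^sub>1 C"
  by (rule le1_eff[of "cons 0"]) (auto simp: mass_def avoid_def intro!: eff_cons eff_basic)

lemma mass_Inter:
  assumes "finite F" "\<And>u. u \<in> F \<Longrightarrow> upset N (P u) \<and> mass (P u) \<le>\<^sub>1 C"
  shows "mass {c \<in> Pow {..<N}. \<forall>u\<in>F. c \<in> P u} \<le>\<^sub>1 C"
  using assms
proof (induction rule: finite_induct)
  case empty
  show ?case using mass_Pow[of N C] by (simp add: Pow_def)
next
  case (insert a F)
  let ?I = "{c \<in> Pow {..<N}. \<forall>u\<in>F. c \<in> P u}"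
  have "upset N ?I" using insert.prems unfolding upset_def by blast
  moreover have "upset N (P a)" using insert.prems by blast
  ultimately have "mass (P a \<inter> ?I) \<le>\<^sub>1 mjoin (mass (P a)) (mass ?I)" by (intro mass_Int)
  moreover have "mass ?I \<le>\<^sub>1 C" "mass (P a) \<le>\<^sub>1 C" using insert by blast+
  then have "mjoin (mass (P a)) (mass ?I) \<le>\<^sub>1 C" by (intro mjoin_least)
  ultimately have "mass (P a \<inter> ?I) \<le>\<^sub>1 C" by (rule le1_trans)
  moreover have "P a \<inter> ?I = {c \<in> Pow {..<N}. \<forall>u\<in>insert a F. c \<in> P u}" by blast
  ultimately show ?case by (simp only:)
qed

text \<open>The right-hand side is the implication of up-closed sets. The first inequality is modus
  ponens for them. For the second, the supersets of \<open>c\<close> in \<open>U\<close> are the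
  sets \<open>c \<union> u\<close> with \<open>u\<close> in \<open>U\<close>, so the implication is
  a finite intersection of the sets treated by \<open>mass_imp_single\<close>.\<close>

lemma deg_mass_imp:
  assumes U: "upset N U" and V: "upset N V"
  shows "deg (mimp (mass U) (mass V)) =
    deg (mass {c \<in> Pow {..<N}. \<forall>d\<in>Pow {..<N}. c \<subseteq> d \<longrightarrow> d \<in> U \<longrightarrow> d \<in> V})" (is "_ = deg (mass ?I)")
  unfolding deg_eq_iff
proof
  have "upset N ?I" unfolding upset_def by auto
  then have "mass (U \<inter> ?I) \<le>\<^sub>1 mjoin (mass U) (mass ?I)" by (rule mass_Int[OF U])
  moreover have "mass V \<le>\<^sub>1 mass (U \<inter> ?I)" by (rule mass_mono) auto
  ultimately show "mimp (mass U) (mass V) \<le>\<^sub>1 mass ?I"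
    unfolding mimp_adjoint using le1_trans by blast
next
  let ?P = "\<lambda>u. {c \<in> Pow {..<N}. c \<union> u \<in> V}"
  have "finite U" using U finite_subset[of U "Pow {..<N}"] by (simp add: upset_def)
  then have "mass {c \<in> Pow {..<N}. \<forall>u\<in>U. c \<in> ?P u} \<le>\<^sub>1 mimp (mass U) (mass V)"
  proof (rule mass_Inter)
    fix u
    assume u: "u \<in> U"
    have "c \<union> u \<in> V \<Longrightarrow> c \<subseteq> d \<Longrightarrow> d \<subseteq> {..<N} \<Longrightarrow> d \<union> u \<in> V" for c d
      using U V u unfolding upset_def by (metis PowD Un_least Un_mono order_refl subsetD)
    then have "upset N (?P u)" unfolding upset_def by auto
    moreover have "mass (?P u) \<le>\<^sub>1 mimp (mass U) (mass V)"
      using mass_imp_single[OF U V le1_mjoin_mimp u] .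
    ultimately show "upset N (?P u) \<and> mass (?P u) \<le>\<^sub>1 mimp (mass U) (mass V)" ..
  qed
  moreover have "{c \<in> Pow {..<N}. \<forall>u\<in>U. c \<in> ?P u} = ?I"
  proof -
    have "(\<forall>u\<in>U. c \<union> u \<in> V) \<longleftrightarrow> (\<forall>d\<in>Pow {..<N}. c \<subseteq> d \<longrightarrow> d \<in> U \<longrightarrow> d \<in> V)" if "c \<subseteq> {..<N}" for c
    proof
      assume *: "\<forall>u\<in>U. c \<union> u \<in> V"
      show "\<forall>d\<in>Pow {..<N}. c \<subseteq> d \<longrightarrow> d \<in> U \<longrightarrow> d \<in> V"
        using * by (metis sup.absorb2)
    next
      assume *: "\<forall>d\<in>Pow {..<N}. c \<subseteq> d \<longrightarrow> d \<in> U \<longrightarrow> d \<in> V"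
      show "\<forall>u\<in>U. c \<union> u \<in> V"
      proof
        fix u
        assume u: "u \<in> U"
        then have "c \<union> u \<subseteq> {..<N}" using U that by (auto simp: upset_def)
        moreover from this u have "c \<union> u \<in> U" using U unfolding upset_def by (metis Un_upper2)
        ultimately show "c \<union> u \<in> V" using * by auto
      qed
    qed
    then show ?thesis by (intro Collect_cong conj_cong refl) simp
  qed
  ultimately show "mass ?I \<le>\<^sub>1 mimp (mass U) (mass V)" by simp
qed

lemma deg_eval_form_forces:
  assumes "\<And>p. upset N (U p)"
  shows "deg (eval_form (\<lambda>p. mass (U p)) \<phi>) = deg (mass (forces N U \<phi>))"
proof (induction \<phi>)
  case (Conj \<phi> \<psi>)
  then show ?case
    using deg_mass_Int[OF upset_forces[OF assms] upset_forces[OF assms]] by (simp add: join_M1[symmetric])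
next
  case (Disj \<phi> \<psi>)
  then show ?case
    using deg_mass_Un[OF upset_forces[OF assms] upset_forces[OF assms]] by (simp add: meet_M1[symmetric])
next
  case (Impl \<phi> \<psi>)
  then show ?case
    using deg_mass_imp[OF upset_forces[OF assms] upset_forces[OF assms]] by (simp add: imp_M1[symmetric])
next
  case (Neg \<phi>)
  \<comment> \<open>Negation becomes implication into the empty up-closed set, whose mass problem is
    empty and has the top degree.\<close>
  have "upset N {}" "mass {} = {}" by (simp_all add: upset_def mass_def)
  then show ?case
    using Neg deg_mass_imp[OF upset_forces[OF assms], of "{}"] by (simp add: imp_M1[symmetric])
qed simp

text \<open>Applied to the zero function, a reduction would produce a computable element. Its tag is
  nonempty, but a computable function lies in every lower cone.\<close>

lemma mass_not_bottom:
  assumes "{} \<notin> U"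
  shows "\<not> mass U \<le>\<^sub>1 UNIV"
proof
  assume "mass U \<le>\<^sub>1 UNIV"
  then obtain R G where RG: "semi R" "semi G" "red R G (mass U) UNIV" using le1_iff by blast
  let ?o = "\<lambda>_::nat. 0::nat"
  obtain i q where q: "q \<in> mass U" "\<And>n y. G ?o (pr (pr i n) y) \<longleftrightarrow> q n = y"
    using RG(3) unfolding red_def by blast
  have "semi (\<lambda>f m. G f (pr (pr i (pfst m)) (psnd m)))"
    by (intro semi_comp[OF RG(2)] eff_basic)
  then have "turing_le q ?o" by (rule turing_le_semi) (simp add: q)
  moreover have "turing_le ?o g" for g by (rule turing_le_eff[of "\<lambda>f n. 0"]) (rule eff_const)
  ultimately have "turing_le (tail q) g" for g using turing_le_tail turing_le_trans by blast
  moreover have "set_decode (q 0) \<noteq> {}" "tail q \<in> avoid (set_decode (q 0))"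
    using q(1) assms by (auto simp: mass_def)
  ultimately show False by (auto simp: avoid_def)
qed

theorem corollary6p3:
  shows "Th \<M>\<^sub>1 = Jan"
proof
  show "Jan \<subseteq> Th \<M>\<^sub>1" by (rule Jan_subset_Th)
  show "Th \<M>\<^sub>1 \<subseteq> Jan"
  proof
    fix \<phi>
    assume "\<phi> \<in> Th \<M>\<^sub>1"
    show "\<phi> \<in> Jan"
    proof (rule ccontr)
      assume "\<phi> \<notin> Jan"
      then obtain N U where U: "\<And>p. upset N (U p)" "{} \<notin> forces N U \<phi>"
        using Jan_complete by blast
      have "eval_form (\<lambda>p. mass (U p)) \<phi> \<le>\<^sub>1 UNIV" using \<open>\<phi> \<in> Th \<M>\<^sub>1\<close> Th_M1_iff by blast
      moreover have "mass (forces N U \<phi>) \<le>\<^sub>1 eval_form (\<lambda>p. mass (U p)) \<phi>"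
        using deg_eval_form_forces[of N U \<phi>, OF U(1)] unfolding deg_eq_iff by blast
      ultimately have "mass (forces N U \<phi>) \<le>\<^sub>1 UNIV" by (rule le1_trans[rotated])
      with mass_not_bottom[OF U(2)] show False by blast
    qed
  qed
qed

end
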